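(* Let $p$ be a prime and let $(r_n)_{n\ge 1}$ be a sequence of positive integers such that $\lim_{n\to\infty} r_n=+\infty$ and $\lim_{n\to\infty}(n-r_n)=+\infty$. Then, as $n\to\infty$, $$\sum_{[K:\mathbb{Q}_p]\le r_n}\mathbb{E}\left[Z^{\mathrm{poly}}_{K^{\mathrm{new}},n}\right]=r_n+\frac{1}{p-1}+o(1),$$ where the sum ranges over all finite extensions $K/\mathbb{Q}_p$, viewed as subfields of $\overline{\mathbb{Q}}_p$, of degree at most $r_n$.
   Context: $\overline{\mathbb{Q}}_p$ is a fixed algebraic closure of $\mathbb{Q}_p$. $\Omega_n(\mathbb{Z}_p)=\{a_nx^n+\cdots+a_1x+a_0: a_0,\dots,a_n\in\mathbb{Z}_p\}$ is the space of polynomials over $\mathbb{Z}_p$ of degree at most $n$, regarded as a probability space by taking $a_0,\dots,a_n$ independent and distributed according to the additive Haar probability measure on $\mathbb{Z}_p$. For $U\subset\overline{\mathbb{Q}}_p$ and $P\in\Omega_n(\mathbb{Z}_p)$, $Z^{\mathrm{poly}}_{U,n}=Z^{\mathrm{poly}}_{U,n}(P)$ is the number of roots of $P$ lying in $U$, counted with multiplicity; $\mathbb{E}$ is expectation over this random $P$. For a finite extension $K/\mathbb{Q}_p$, $K^{\mathrm{new}}$ is the set of elements of $K$ not lying in any proper subextension of $K/\mathbb{Q}_p$ (i.e. $x\in K$ with $\mathbb{Q}_p[x]=K$). Note that elements of $K^{\mathrm{new}}$ need not be integral. *)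

theory Defs
  imports
    "HOL-Probability.Probability"
    "HOL-Algebra.Algebraic_Closure_Type"
    "HOL-Computational_Algebra.Fraction_Field"
    "HOL-Library.Landau_Symbols"
    "Berlekamp_Zassenhaus.Finite_Field"
begin

hide_const (open) Divisibility.prime UnivPoly.monom

section \<open>The \<open>p\<close>-adic integers\<close>

text \<open>
  The prime \<open>p\<close> is the cardinality of a type \<open>'p\<close> of class \<^class>\<open>prime_card\<close>. The ring \<open>\<int>\<^sub>p\<close> is the
  inverse limit of the rings \<open>\<int>/p\<^sup>n\<close>: an element is the sequence of its least nonnegative residues
  modulo \<open>p\<^sup>n\<close>. The case \<open>m = n\<close> of the compatibility condition says that the \<open>n\<close>-th entry lies
  in \<open>{0..<p\<^sup>n}\<close>.
\<close>

abbreviation pp :: "'p::prime_card itself \<Rightarrow> nat \<Rightarrow> int" where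
  "pp _ n \<equiv> int CARD('p) ^ n"

lemma p_gt_1: "int CARD('p::prime_card) > 1"
  using prime_card_int[where 'a='p] prime_gt_1_int by blast

lemma pp_pos [simp]: "0 < int CARD('p::prime_card) ^ n"
  using p_gt_1[where 'p='p] by simp

lemma pp_dvd: "m \<le> n \<Longrightarrow> pp TYPE('p::prime_card) m dvd pp TYPE('p) n"
  by (rule le_imp_power_dvd)

typedef (overloaded) 'p padic_int =
  "{f :: nat \<Rightarrow> int. \<forall>m n. m \<le> n \<longrightarrow> f n mod pp TYPE('p::prime_card) m = f m}"
  by (rule exI[of _ "\<lambda>_. 0"]) simp

setup_lifting type_definition_padic_int

lift_definition residue :: "'p::prime_card padic_int \<Rightarrow> nat \<Rightarrow> int" is "\<lambda>f. f" .

lemma residue_mod: "m \<le> n \<Longrightarrow> residue (x :: 'p::prime_card padic_int) n mod pp TYPE('p) m = residue x m"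
  by transfer simp

lemma residue_mod_same [simp]: "residue (x :: 'p::prime_card padic_int) n mod pp TYPE('p) n = residue x n"
  by (rule residue_mod) simp

lemma residue_range: "0 \<le> residue (x :: 'p::prime_card padic_int) n" "residue x n < pp TYPE('p) n"
  using pp_pos[where 'p='p, of n] residue_mod_same[of x n]
  by (metis pos_mod_sign, metis pos_mod_bound)

lemma padic_int_eqI: "(\<And>n. residue x n = residue y n) \<Longrightarrow> x = y"
  by transfer auto

lemma residue_eq_mono:
  fixes x y :: "'p::prime_card padic_int"
  shows "m \<le> n \<Longrightarrow> residue x n = residue y n \<Longrightarrow> residue x m = residue y m"
  using residue_mod[of m n x] residue_mod[of m n y] by simp

instantiation padic_int :: (prime_card) comm_ring_1
begin

lift_definition zero_padic_int :: "'a padic_int" is "\<lambda>_. 0" by simp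

lift_definition one_padic_int :: "'a padic_int" is "\<lambda>n. 1 mod pp TYPE('a) n"
  by (simp add: mod_mod_cancel le_imp_power_dvd)

lift_definition plus_padic_int :: "'a padic_int \<Rightarrow> 'a padic_int \<Rightarrow> 'a padic_int"
  is "\<lambda>f g n. (f n + g n) mod pp TYPE('a) n"
  by (simp add: mod_mod_cancel le_imp_power_dvd) (metis mod_add_eq)

lift_definition uminus_padic_int :: "'a padic_int \<Rightarrow> 'a padic_int"
  is "\<lambda>f n. (- f n) mod pp TYPE('a) n"
  by (simp add: mod_mod_cancel le_imp_power_dvd) (metis mod_minus_eq)

lift_definition minus_padic_int :: "'a padic_int \<Rightarrow> 'a padic_int \<Rightarrow> 'a padic_int"
  is "\<lambda>f g n. (f n - g n) mod pp TYPE('a) n"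
  by (simp add: mod_mod_cancel le_imp_power_dvd) (metis mod_diff_eq)

lift_definition times_padic_int :: "'a padic_int \<Rightarrow> 'a padic_int \<Rightarrow> 'a padic_int"
  is "\<lambda>f g n. (f n * g n) mod pp TYPE('a) n"
  by (simp add: mod_mod_cancel le_imp_power_dvd) (metis mod_mult_eq)

instance
proof
  fix a b c :: "'a padic_int"
  show "a * b * c = a * (b * c)"
    by transfer (auto simp: fun_eq_iff mod_simps algebra_simps)
  show "a * b = b * a"
    by transfer (auto simp: fun_eq_iff algebra_simps)
  show "1 * a = a"
    by transfer (auto simp: fun_eq_iff mod_simps)
  show "a + b + c = a + (b + c)"
    by transfer (auto simp: fun_eq_iff mod_simps algebra_simps)
  show "a + b = b + a"
    by transfer (auto simp: fun_eq_iff algebra_simps)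
  show "0 + a = a"
    by transfer (auto simp: fun_eq_iff)
  show "- a + a = 0"
    by transfer (auto simp: fun_eq_iff mod_simps)
  show "a - b = a + - b"
    by transfer (auto simp: fun_eq_iff mod_simps)
  show "(a + b) * c = a * c + b * c"
    by transfer (auto simp: fun_eq_iff mod_simps algebra_simps)
  show "(0 :: 'a padic_int) \<noteq> 1"
  proof
    assume "(0 :: 'a padic_int) = 1"
    hence "residue (0 :: 'a padic_int) 1 = residue 1 1" by simp
    thus False
      using p_gt_1[where 'p='a] by transfer simp
  qed
qed

end

lemma residue_0: "residue 0 n = 0" by transfer simp
lemma residue_add: "residue (x + y :: 'p::prime_card padic_int) n = (residue x n + residue y n) mod pp TYPE('p) n"
  by transfer simp
lemma residue_uminus: "residue (- x :: 'p::prime_card padic_int) n = (- residue x n) mod pp TYPE('p) n"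
  by transfer simp
lemma residue_mult: "residue (x * y :: 'p::prime_card padic_int) n = (residue x n * residue y n) mod pp TYPE('p) n"
  by transfer simp

lemma residue_of_nat: "residue (of_nat k :: 'p::prime_card padic_int) n = int k mod pp TYPE('p) n"
proof (induction k)
  case 0 show ?case by (simp add: residue_0)
next
  case (Suc k)
  have "residue (1 :: 'p padic_int) n = 1 mod pp TYPE('p) n" by transfer simp
  thus ?case using Suc by (simp add: residue_add mod_simps)
qed

lemma residue_of_int: "residue (of_int k :: 'p::prime_card padic_int) n = k mod pp TYPE('p) n"
proof (cases k)
  case (nonneg m) thus ?thesis by (simp add: residue_of_nat)
next
  case (neg m)
  have "residue (of_int k :: 'p padic_int) n = residue (- of_nat (Suc m) :: 'p padic_int) n"
    using neg by simp
  also have "\<dots> = k mod pp TYPE('p) n"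
    unfolding residue_uminus residue_of_nat mod_minus_eq neg ..
  finally show ?thesis .
qed

lemma prime_power_not_dvd_mult:
  fixes p a b :: int
  assumes "prime p" "\<not> p ^ m dvd a" "\<not> p ^ n dvd b"
  shows "\<not> p ^ (m + n) dvd a * b"
proof
  assume *: "p ^ (m + n) dvd a * b"
  have nz: "a \<noteq> 0" "b \<noteq> 0" using assms by auto
  have np: "\<not> is_unit p" using assms(1) not_prime_unit by blast
  have "multiplicity p a < m" "multiplicity p b < n"
    using assms nz np by (metis multiplicity_lessI)+
  moreover have "m + n \<le> multiplicity p (a * b)"
    using * nz np by (simp add: power_dvd_iff_le_multiplicity)
  moreover have "multiplicity p (a * b) = multiplicity p a + multiplicity p b"
    using assms(1) nz by (intro prime_elem_multiplicity_mult_distrib) auto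
  ultimately show False by simp
qed

instance padic_int :: (prime_card) idom
proof
  fix x y :: "'a padic_int"
  assume "x \<noteq> 0" "y \<noteq> 0"
  then obtain m n where "residue x m \<noteq> 0" "residue y n \<noteq> 0"
    by (metis padic_int_eqI residue_0)
  hence "\<not> pp TYPE('a) m dvd residue x (m + n)" "\<not> pp TYPE('a) n dvd residue y (m + n)"
    by (auto simp: dvd_eq_mod_eq_0 residue_mod)
  hence "\<not> pp TYPE('a) (m + n) dvd residue x (m + n) * residue y (m + n)"
    by (rule prime_power_not_dvd_mult[OF prime_card_int])
  hence "residue (x * y) (m + n) \<noteq> 0"
    by (simp add: residue_mult dvd_eq_mod_eq_0)
  thus "x * y \<noteq> 0"
    by (auto simp: residue_0)
qed


section \<open>Topology and Haar measure on \<open>\<int>\<^sub>p\<close>\<close>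

instantiation padic_int :: (prime_card) topological_space
begin

definition open_padic_int :: "'a padic_int set \<Rightarrow> bool" where
  "open_padic_int U \<longleftrightarrow> (\<forall>x\<in>U. \<exists>n. \<forall>y. residue y n = residue x n \<longrightarrow> y \<in> U)"

instance
proof
  show "open (UNIV :: 'a padic_int set)" by (auto simp: open_padic_int_def)
next
  fix S T :: "'a padic_int set"
  assume ST: "open S" "open T"
  show "open (S \<inter> T)"
    unfolding open_padic_int_def
  proof
    fix x assume "x \<in> S \<inter> T"
    with ST obtain m n where
      mn: "\<forall>y. residue y m = residue x m \<longrightarrow> y \<in> S" "\<forall>y. residue y n = residue x n \<longrightarrow> y \<in> T"
      unfolding open_padic_int_def by (meson IntE)
    show "\<exists>n. \<forall>y. residue y n = residue x n \<longrightarrow> y \<in> S \<inter> T"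
    proof (intro exI[of _ "max m n"] allI impI)
      fix y :: "'a padic_int" assume *: "residue y (max m n) = residue x (max m n)"
      have "residue y m = residue x m" "residue y n = residue x n"
        using residue_eq_mono[OF _ *, of m] residue_eq_mono[OF _ *, of n] by simp_all
      with mn show "y \<in> S \<inter> T" by blast
    qed
  qed
next
  fix K :: "'a padic_int set set"
  assume "\<forall>S\<in>K. open S"
  thus "open (\<Union>K)" unfolding open_padic_int_def by (meson UnionE UnionI)
qed

end

definition is_haar_prob :: "'p::prime_card padic_int measure \<Rightarrow> bool" where
  "is_haar_prob M \<longleftrightarrow> prob_space M \<and> sets M = sets borel \<and>
     (\<forall>a. \<forall>A\<in>sets borel. emeasure M ((+) a ` A) = emeasure M A)"

definition haar :: "'p::prime_card padic_int measure" where
  "haar = (THE M. is_haar_prob M)"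

definition cyl :: "nat \<Rightarrow> int \<Rightarrow> 'p::prime_card padic_int set" where
  "cyl n a = {x. residue x n = a}"

lemma open_cyl: "open (cyl n a)"
  unfolding open_padic_int_def cyl_def by auto

lemma cyl_in_borel [measurable]: "cyl n a \<in> sets borel"
  by (simp add: open_cyl borel_open)

definition cyls :: "'p::prime_card padic_int set set" where
  "cyls = insert {} (range (\<lambda>(n, a). cyl n a))"

lemma empty_in_cyls: "{} \<in> cyls"
  by (simp add: cyls_def)

lemma cyl_in_cyls: "cyl n a \<in> cyls"
  unfolding cyls_def by (intro insertI2 range_eqI[of _ _ "(n, a)"]) simp

lemma cyls_cases:
  assumes "A \<in> cyls"
  obtains "A = {}" | n a where "A = cyl n a"
  using assms unfolding cyls_def by (auto simp only: insert_iff image_iff split: prod.splits)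

lemma sets_borel_padic: "sets (borel :: 'p::prime_card padic_int measure) = sigma_sets UNIV cyls"
proof -
  have "topological_basis (cyls :: 'p padic_int set set)"
  proof (rule topological_basisI)
    show "open B" if "B \<in> cyls" for B :: "'p padic_int set"
      using that by (auto simp: cyls_def open_cyl)
  next
    fix U :: "'p padic_int set" and x assume "open U" "x \<in> U"
    then obtain n where "\<forall>y. residue y n = residue x n \<longrightarrow> y \<in> U"
      unfolding open_padic_int_def by blast
    thus "\<exists>B\<in>cyls. x \<in> B \<and> B \<subseteq> U"
      by (intro bexI[of _ "cyl n (residue x n)"]) (auto simp: cyls_def cyl_def)
  qed
  moreover have "countable (cyls :: 'p padic_int set set)"
    unfolding cyls_def by auto
  ultimately have "(borel :: 'p padic_int measure) = sigma UNIV cyls"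
    by (intro borel_eq_countable_basis)
  hence "sets (borel :: 'p padic_int measure) = sets (sigma UNIV cyls)" by (rule arg_cong)
  also have "\<dots> = sigma_sets UNIV cyls" by (rule sets_measure_of) simp
  finally show ?thesis .
qed

lemma Int_stable_cyls: "Int_stable (cyls :: 'p::prime_card padic_int set set)"
proof (rule Int_stableI)
  have aux: "cyl m a \<inter> cyl n b \<in> (cyls :: 'p padic_int set set)" if "m \<le> n" for m n a b
  proof -
    have *: "residue x m = b mod pp TYPE('p) m" if "residue x n = b" for x :: "'p padic_int"
      using residue_mod[OF \<open>m \<le> n\<close>, of x] that by simp
    show ?thesis
    proof (cases "b mod pp TYPE('p) m = a")
      case True
      hence "cyl m a \<inter> cyl n b = (cyl n b :: 'p padic_int set)"
        using * by (auto simp: cyl_def)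
      thus ?thesis by (simp only: cyl_in_cyls)
    next
      case False
      hence "cyl m a \<inter> cyl n b = ({} :: 'p padic_int set)"
        using * by (auto simp: cyl_def)
      thus ?thesis by (simp only: empty_in_cyls)
    qed
  qed
  fix A B :: "'p padic_int set" assume AB: "A \<in> cyls" "B \<in> cyls"
  from AB(1) show "A \<inter> B \<in> cyls"
  proof (cases rule: cyls_cases)
    case A: (2 m a)
    from AB(2) show ?thesis
    proof (cases rule: cyls_cases)
      case B: (2 n b)
      show ?thesis
      proof (cases "m \<le> n")
        case True
        thus ?thesis using aux[of m n a b] by (simp only: A B)
      next
        case False
        hence "n \<le> m" by simp
        thus ?thesis using aux[of n m b a] by (simp only: A B Int_commute)
      qed
    qed (simp only: Int_empty_right empty_in_cyls)
  qed (simp only: Int_empty_left empty_in_cyls)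
qed

lemma padic_measure_eqI:
  fixes M N :: "'p::prime_card padic_int measure"
  assumes "prob_space M" "sets M = sets borel" "sets N = sets borel"
    and "\<And>n a. emeasure M (cyl n a) = emeasure N (cyl n a)"
  shows "M = N"
proof -
  have eq: "emeasure M B = emeasure N B" if "B \<in> cyls" for B
    using that by (cases rule: cyls_cases) (simp_all add: assms(4))
  have sub: "range (\<lambda>_ :: nat. cyl 0 0) \<subseteq> (cyls :: 'p padic_int set set)"
    by (simp add: cyl_in_cyls image_subset_iff)
  have "residue x 0 = 0" for x :: "'p padic_int"
    using residue_range[of x 0] by simp
  hence un: "(\<Union>i::nat. cyl 0 0) = (UNIV :: 'p padic_int set)"
    by (simp add: cyl_def)
  have fin: "emeasure M (cyl 0 0) \<noteq> \<infinity>"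
    using assms(1) by (simp add: prob_space_def finite_measure.emeasure_finite)
  show ?thesis
    by (rule measure_eqI_generator_eq[OF Int_stable_cyls _ eq _ _ sub un fin])
       (simp_all only: assms sets_borel_padic Pow_UNIV subset_UNIV)
qed

lemma cyl_empty: "\<not> (0 \<le> a \<and> a < pp TYPE('p) n) \<Longrightarrow> cyl n a = ({} :: 'p::prime_card padic_int set)"
  using residue_range by (auto simp: cyl_def)

lemma translate_cyl: "(+) c ` cyl n a = (cyl n ((residue c n + a) mod pp TYPE('p) n) :: 'p::prime_card padic_int set)"
  if "0 \<le> a" "a < pp TYPE('p) n"
proof (intro equalityI subsetI)
  fix x :: "'p padic_int" assume "x \<in> cyl n ((residue c n + a) mod pp TYPE('p) n)"
  hence "residue (x - c) n = ((residue c n + a) mod pp TYPE('p) n - residue c n) mod pp TYPE('p) n"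
    unfolding cyl_def by transfer simp
  also have "\<dots> = a" using that by (simp add: mod_simps)
  finally have "x - c \<in> cyl n a" by (simp add: cyl_def)
  thus "x \<in> (+) c ` cyl n a" by (rule rev_image_eqI) simp
qed (auto simp: cyl_def residue_add)

lemma is_haar_prob_cyl:
  assumes "is_haar_prob (M :: 'p::prime_card padic_int measure)" "0 \<le> a" "a < pp TYPE('p) n"
  shows "measure M (cyl n a) = 1 / real CARD('p) ^ n"
proof -
  interpret prob_space M using assms by (simp add: is_haar_prob_def)
  have sb: "sets M = sets borel" using assms by (simp add: is_haar_prob_def)
  have sp: "space M = UNIV" using sets_eq_imp_space_eq[OF sb] by simp
  have eq: "measure M (cyl n b) = measure M (cyl n 0)" if "0 \<le> b" "b < pp TYPE('p) n" for b
  proof -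
    have "cyl n b = (+) (of_int b) ` (cyl n 0 :: 'p padic_int set)"
      using that by (subst translate_cyl) (auto simp: residue_of_int)
    thus ?thesis using assms(1) unfolding is_haar_prob_def measure_def by auto
  qed
  have "(\<Union>b\<in>{0..<pp TYPE('p) n}. cyl n b) = (UNIV :: 'p padic_int set)"
    using residue_range by (auto simp: cyl_def)
  hence "1 = measure M (\<Union>b\<in>{0..<pp TYPE('p) n}. cyl n b)"
    using prob_space sp by simp
  also have "\<dots> = (\<Sum>b\<in>{0..<pp TYPE('p) n}. measure M (cyl n b))"
    by (rule finite_measure_finite_Union) (auto simp: sb disjoint_family_on_def cyl_in_borel, auto simp: cyl_def)
  also have "\<dots> = (\<Sum>b\<in>{0..<pp TYPE('p) n}. measure M (cyl n 0))"
    by (rule sum.cong) (auto intro: eq)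
  also have "\<dots> = real CARD('p) ^ n * measure M (cyl n 0)"
    by (simp add: nat_power_eq)
  finally show ?thesis
    using eq[OF assms(2,3)] p_gt_1[where 'p='p] by (simp add: field_simps)
qed

lemma is_haar_prob_unique:
  assumes "is_haar_prob (M :: 'p::prime_card padic_int measure)" "is_haar_prob N"
  shows "M = N"
proof (rule padic_measure_eqI)
  fix n a
  interpret M: prob_space M using assms by (simp add: is_haar_prob_def)
  interpret N: prob_space N using assms by (simp add: is_haar_prob_def)
  show "emeasure M (cyl n a) = emeasure N (cyl n a)"
  proof (cases "0 \<le> a \<and> a < pp TYPE('p) n")
    case True
    thus ?thesis
      using assms by (simp add: M.emeasure_eq_measure N.emeasure_eq_measure is_haar_prob_cyl)
  qed (simp add: cyl_empty)
qed (use assms in \<open>auto simp: is_haar_prob_def\<close>)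

text \<open>
  Existence: the law of the random digit expansion \<open>\<Sum>i. d i * p ^ i\<close> with independent uniform
  digits \<open>d i\<close> is translation invariant.
\<close>

lemma digits_compat:
  assumes "m \<le> n"
  shows "(\<Sum>i<n. d i * pp TYPE('p::prime_card) i) mod pp TYPE('p) m =
    (\<Sum>i<m. d i * pp TYPE('p) i) mod pp TYPE('p) m"
  using assms
proof (induction n rule: dec_induct)
  case (step n)
  have "pp TYPE('p) m dvd d n * pp TYPE('p) n"
    using step.hyps by (intro dvd_mult pp_dvd)
  hence "(S + d n * pp TYPE('p) n) mod pp TYPE('p) m = S mod pp TYPE('p) m" for S
    by (elim dvdE) (simp only: mod_mult_self2)
  thus ?case using step.IH by (simp only: sum.lessThan_Suc)
qed simp

lift_definition of_digits :: "(nat \<Rightarrow> int) \<Rightarrow> 'p::prime_card padic_int" is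
  "\<lambda>d n. (\<Sum>i<n. d i * pp TYPE('p) i) mod pp TYPE('p) n"
  using digits_compat by (auto simp: mod_mod_cancel le_imp_power_dvd simp del: of_nat_power)

lemma digits_sum_range:
  fixes p :: int
  assumes "p > 1" "\<And>i. 0 \<le> d i \<and> d i < p"
  shows "0 \<le> (\<Sum>i<n. d i * p ^ i) \<and> (\<Sum>i<n. d i * p ^ i) < p ^ n"
proof (induction n)
  case (Suc n)
  have "d n * p ^ n \<le> (p - 1) * p ^ n" using assms by (intro mult_right_mono) (auto simp: zle_diff1_eq)
  moreover have "0 \<le> d n * p ^ n" using assms by simp
  ultimately show ?case using Suc by (auto simp: algebra_simps)
qed simp

lemma digits_sum_eq_iff:
  fixes p :: int
  assumes p: "p > 1" and d: "\<And>i. 0 \<le> d i \<and> d i < p" and a: "0 \<le> a" "a < p ^ n"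
  shows "(\<Sum>i<n. d i * p ^ i) = a \<longleftrightarrow> (\<forall>i<n. d i = a div p ^ i mod p)"
  using a
proof (induction n arbitrary: a)
  case (Suc n)
  define s where "s = (\<Sum>i<n. d i * p ^ i)"
  have s: "0 \<le> s" "s < p ^ n" using digits_sum_range[of p d n, OF p d] by (auto simp: s_def)
  have ppos: "p ^ n > 0" using p by simp
  have "a div p ^ n < p"
  proof (rule ccontr)
    assume "\<not> a div p ^ n < p"
    hence "p * p ^ n \<le> a div p ^ n * p ^ n" using ppos by (intro mult_right_mono) auto
    also have "\<dots> \<le> a" using ppos by (simp add: flip: minus_mod_eq_div_mult)
    finally show False using Suc.prems by simp
  qed
  moreover have "0 \<le> a div p ^ n" using Suc.prems ppos by (simp add: pos_imp_zdiv_nonneg_iff)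
  ultimately have an: "a div p ^ n mod p = a div p ^ n" by simp
  have "(\<Sum>i<Suc n. d i * p ^ i) = a \<longleftrightarrow> s + d n * p ^ n = a" by (simp add: s_def)
  also have "\<dots> \<longleftrightarrow> s = a mod p ^ n \<and> d n = a div p ^ n"
  proof
    assume *: "s + d n * p ^ n = a"
    have "a mod p ^ n = s" using s by (simp flip: *)
    moreover have "p ^ n \<noteq> 0" using ppos by linarith
    hence "(s + d n * p ^ n) div p ^ n = d n"
      by (subst div_mult_self1) (use s in simp_all)
    hence "a div p ^ n = d n" by (simp only: *)
    ultimately show "s = a mod p ^ n \<and> d n = a div p ^ n" by simp
  next
    assume "s = a mod p ^ n \<and> d n = a div p ^ n"
    thus "s + d n * p ^ n = a" by (simp add: mod_div_mult_eq)
  qed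
  also have "s = a mod p ^ n \<longleftrightarrow> (\<forall>i<n. d i = a mod p ^ n div p ^ i mod p)"
    unfolding s_def using ppos by (intro Suc.IH) auto
  also have "\<dots> \<longleftrightarrow> (\<forall>i<n. d i = a div p ^ i mod p)"
  proof -
    have "a mod p ^ n div p ^ i mod p = a div p ^ i mod p" if "i < n" for i
    proof -
      define k where "k = n - Suc i"
      have n: "p ^ n = p ^ i * (p * p ^ k)"
        using that by (simp add: k_def flip: power_Suc power_add)
      have "a div p ^ i mod p = (a mod p ^ n + p ^ n * (a div p ^ n)) div p ^ i mod p" by simp
      also have "p ^ n * (a div p ^ n) = (p * p ^ k * (a div p ^ n)) * p ^ i"
        by (subst (1) n) (simp only: ac_simps)
      also have "(a mod p ^ n + p * p ^ k * (a div p ^ n) * p ^ i) div p ^ i = p * p ^ k * (a div p ^ n) + a mod p ^ n div p ^ i"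
        using p by (subst div_mult_self1) auto
      also have "\<dots> mod p = a mod p ^ n div p ^ i mod p"
        by (simp add: mult.assoc)
      finally show ?thesis by simp
    qed
    thus ?thesis by auto
  qed
  also have "(\<forall>i<n. d i = a div p ^ i mod p) \<and> d n = a div p ^ n \<longleftrightarrow> (\<forall>i<Suc n. d i = a div p ^ i mod p)"
    using an by (auto simp: less_Suc_eq)
  finally show ?case .
qed simp

lemma ex_is_haar_prob: "\<exists>M :: 'p::prime_card padic_int measure. is_haar_prob M"
proof -
  define p where "p = int CARD('p)"
  have p: "p > 1" using p_gt_1[where 'p='p] by (simp add: p_def)
  define D where "D = uniform_count_measure {0..<p}"
  have D: "prob_space D" unfolding D_def using p by (intro prob_space_uniform_count_measure) auto
  interpret product_prob_space "\<lambda>_ :: nat. D" UNIV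
    by (intro product_prob_spaceI D)
  define P where "P = PiM (UNIV :: nat set) (\<lambda>_. D)"
  have spP: "0 \<le> d i \<and> d i < p" if "d \<in> space P" for d i
    using that by (auto simp: P_def space_PiM D_def space_uniform_count_measure PiE_iff)
  have pre: "of_digits -` (cyl n a :: 'p padic_int set) \<inter> space P =
      {d\<in>space P. \<forall>i\<in>{..<n}. d i \<in> {a div p ^ i mod p}}"
    if "0 \<le> a" "a < p ^ n" for n a
  proof -
    have "residue (of_digits d :: 'p padic_int) n = a \<longleftrightarrow> (\<forall>i<n. d i = a div p ^ i mod p)"
      if d: "d \<in> space P" for d
    proof -
      have "residue (of_digits d :: 'p padic_int) n = (\<Sum>i<n. d i * p ^ i)"
        using digits_sum_range[of p d n, OF p spP[OF d]] unfolding p_def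
        by transfer (metis mod_pos_pos_trivial)
      thus ?thesis using digits_sum_eq_iff[of p d a n, OF p spP[OF d]] \<open>0 \<le> a\<close> \<open>a < p ^ n\<close> by simp
    qed
    thus ?thesis by (auto simp: cyl_def)
  qed
  have digD: "{a div p ^ i mod p} \<in> sets D" for a i
    unfolding D_def sets_uniform_count_measure using p by auto
  have em: "emeasure P (of_digits -` (cyl n a :: 'p padic_int set) \<inter> space P) = ennreal ((1 / p) ^ n)"
    if "0 \<le> a" "a < p ^ n" for n a
  proof -
    have "emeasure P (of_digits -` (cyl n a :: 'p padic_int set) \<inter> space P) = (\<Prod>i<n. emeasure D {a div p ^ i mod p})"
      unfolding pre[OF that] unfolding P_def by (intro emeasure_PiM_Collect) (auto simp: digD)
    also have "\<dots> = (\<Prod>i<n. ennreal (1 / p))"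
      using p unfolding D_def by (intro prod.cong refl, subst emeasure_uniform_count_measure) auto
    also have "\<dots> = ennreal ((1 / p) ^ n)"
      using p by (simp add: ennreal_power)
    finally show ?thesis .
  qed
  have meas: "(of_digits :: _ \<Rightarrow> 'p padic_int) \<in> measurable P borel"
  proof -
    have "of_digits -` A \<inter> space P \<in> sets P" if A: "A \<in> cyls" for A :: "'p padic_int set"
    proof -
      have "of_digits -` (cyl n a :: 'p padic_int set) \<inter> space P \<in> sets P" for n a
      proof (cases "0 \<le> a \<and> a < p ^ n")
        case True
        have "{d\<in>space P. \<forall>i\<in>{..<n}. d i \<in> {a div p ^ i mod p}} \<in> sets P"
        proof (intro sets.sets_Collect_finite_All)
          fix i
          have "(\<lambda>d. d i) \<in> measurable P D"
            unfolding P_def by (rule measurable_component_singleton) simp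
          hence "(\<lambda>d. d i) -` {a div p ^ i mod p} \<inter> space P \<in> sets P"
            by (rule measurable_sets) (rule digD)
          also have "(\<lambda>d. d i) -` {a div p ^ i mod p} \<inter> space P = {d\<in>space P. d i \<in> {a div p ^ i mod p}}"
            by auto
          finally show "{d\<in>space P. d i \<in> {a div p ^ i mod p}} \<in> sets P" .
        qed simp
        thus ?thesis using pre True by simp
      next
        case False
        thus ?thesis using cyl_empty[where 'p='p] by (simp add: p_def)
      qed
      with A show ?thesis by (cases rule: cyls_cases) simp_all
    qed
    thus ?thesis
      unfolding measurable_cong_sets[OF refl, of borel "sigma UNIV cyls" P, simplified sets_borel_padic, simplified]
      by (intro measurable_measure_of) auto
  qed
  define M where "M = distr P (borel :: 'p padic_int measure) of_digits"
  have prM: "prob_space M"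
    unfolding M_def using meas P.prob_space_axioms by (intro prob_space.prob_space_distr) (auto simp: P_def)
  have sM: "sets M = sets borel" by (simp add: M_def)
  have M: "emeasure M (cyl n a) = ennreal ((1 / p) ^ n)" if "0 \<le> a" "a < p ^ n" for n a
    unfolding M_def using meas em[OF that] by (subst emeasure_distr) auto
  have "emeasure M ((+) c ` A) = emeasure M A" if A: "A \<in> sets borel" for c A
  proof -
    have vim: "(\<lambda>x. x - c) -` B = (+) c ` B" for B
      by (auto intro: image_eqI[of _ _ "_ - c"])
    have cyl_im: "\<exists>b. 0 \<le> b \<and> b < p ^ n \<and> (+) c ` cyl n a = (cyl n b :: 'p padic_int set)"
      if "0 \<le> a" "a < p ^ n" for n a
      using that translate_cyl[where 'p='p, of a n c] p unfolding p_def
      by (intro exI[of _ "(residue c n + a) mod pp TYPE('p) n"]) auto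
    have mt: "(\<lambda>x. x - c) \<in> measurable M M"
    proof -
      have "(\<lambda>x. x - c) -` B \<inter> space M \<in> sets M" if B: "B \<in> cyls" for B :: "'p padic_int set"
      proof -
        have "(+) c ` (cyl n a :: 'p padic_int set) \<in> sets borel" for n a
        proof (cases "0 \<le> a \<and> a < p ^ n")
          case True
          thus ?thesis using cyl_im[of a n] by auto
        next
          case False
          thus ?thesis using cyl_empty[where 'p='p] by (simp add: p_def)
        qed
        with B show ?thesis using sets_eq_imp_space_eq[OF sM]
          by (cases rule: cyls_cases) (simp_all add: vim sM)
      qed
      thus ?thesis
        using sets_eq_imp_space_eq[OF sM] sM sets_borel_padic
        by (intro measurable_sigma_sets[of M UNIV cyls]) auto
    qed
    have "M = distr M M (\<lambda>x. x - c)"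
    proof (rule padic_measure_eqI)
      fix n a
      show "emeasure M (cyl n a) = emeasure (distr M M (\<lambda>x. x - c)) (cyl n a)"
      proof (cases "0 \<le> a \<and> a < p ^ n")
        case True
        then obtain b where b: "0 \<le> b" "b < p ^ n" "(+) c ` cyl n a = (cyl n b :: 'p padic_int set)"
          using cyl_im by blast
        have "emeasure (distr M M (\<lambda>x. x - c)) (cyl n a) = emeasure M (cyl n b)"
          using mt sets_eq_imp_space_eq[OF sM] by (subst emeasure_distr) (auto simp: sM vim b)
        thus ?thesis using M True b by simp
      next
        case False
        thus ?thesis using cyl_empty[where 'p='p] by (simp add: p_def)
      qed
    qed (use prM sM in auto)
    hence "emeasure M A = emeasure (distr M M (\<lambda>x. x - c)) A" by simp
    also have "\<dots> = emeasure M ((+) c ` A)"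
      using mt A sets_eq_imp_space_eq[OF sM] by (subst emeasure_distr) (auto simp: sM vim)
    finally show ?thesis by simp
  qed
  thus ?thesis using prM sM unfolding is_haar_prob_def by blast
qed

lemma is_haar_prob_haar: "is_haar_prob haar"
  unfolding haar_def by (rule theI') (use ex_is_haar_prob is_haar_prob_unique in blast)


section \<open>Finite extensions of \<open>\<rat>\<^sub>p\<close> inside a fixed algebraic closure\<close>

type_synonym 'p padic = "'p padic_int fract"

abbreviation Qp_bar :: "'p::prime_card padic alg_closure ring" where
  "Qp_bar \<equiv> ring_of_type_algebra"

abbreviation Qp :: "'p::prime_card padic alg_closure set" where
  "Qp \<equiv> range to_ac"

definition extension :: "'p::prime_card padic alg_closure set \<Rightarrow> bool" where
  "extension K \<longleftrightarrow> subfield K Qp_bar \<and> Qp \<subseteq> K"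

definition finite_extensions_upto :: "nat \<Rightarrow> 'p::prime_card padic alg_closure set set" where
  "finite_extensions_upto r =
     {K. extension K \<and> ring.finite_dimension Qp_bar Qp K \<and> ring.dim Qp_bar Qp K \<le> r}"

definition new_elements :: "'p::prime_card padic alg_closure set \<Rightarrow> 'p padic alg_closure set" where
  "new_elements K = {x \<in> K. \<forall>L. extension L \<and> L \<subset> K \<longrightarrow> x \<notin> L}"


section \<open>Roots of random polynomials over \<open>\<int>\<^sub>p\<close>\<close>

definition of_Zp :: "'p::prime_card padic_int \<Rightarrow> 'p padic alg_closure" where
  "of_Zp x = to_ac (Fract x 1)"

definition poly_of_coeffs :: "nat \<Rightarrow> (nat \<Rightarrow> 'p::prime_card padic_int) \<Rightarrow> 'p padic_int poly" where
  "poly_of_coeffs n a = (\<Sum>i\<le>n. Polynomial.monom (a i) i)"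

text \<open>
  The multiset \<^const>\<open>proots\<close> is empty for the zero polynomial, which occurs with probability \<open>0\<close>.
\<close>

definition num_roots :: "'p::prime_card padic alg_closure set \<Rightarrow> 'p padic_int poly \<Rightarrow> nat" where
  "num_roots U P = size (filter_mset (\<lambda>x. x \<in> U) (proots (map_poly of_Zp P)))"

definition expected_roots :: "nat \<Rightarrow> 'p::prime_card padic alg_closure set \<Rightarrow> real" where
  "expected_roots n U =
     (\<integral>a. real (num_roots U (poly_of_coeffs n a)) \<partial>(\<Pi>\<^sub>M i\<in>{..n}. haar))"

end

theory Submission
  imports Defs
begin

hide_const (open) Polynomials.degree Polynomials.lead_coeff UnivPoly.coeff Module.smult Coset.order

text \<open>
  Every root \<open>x\<close> of a polynomial lies in \<open>K\<^sup>n\<^sup>e\<^sup>w\<close> for exactly one field \<open>K\<close>, namely \<open>K = \<rat>\<^sub>p(x)\<close>, so the sum is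
  the expected number of roots of degree at most \<open>r\<close>. By Hensel's lemma, the roots of \<open>P\<close> fall into blocks
  according to the prime factors \<open>f\<close> of the reduction of \<open>P\<close> modulo \<open>p\<close>: the block of \<open>f\<close> has
  \<open>degree f\<close> times the multiplicity of \<open>f\<close> elements, and each of its elements has a degree between \<open>degree f\<close> and
  the size of the block; one more block consists of the roots that reduce to infinity. Up to an
  exponentially small error, the roots of degree at most \<open>r\<close> are therefore those in blocks of size at most
  \<open>r\<close>. Since the reduction is uniformly distributed, the blocks of the prime polynomials contribute \<open>r\<close> on
  average, by the prime polynomial theorem, and the block at infinity contributes
  \<open>\<Sum>e. 1 / p ^ e = 1 / (p - 1)\<close>.

  Exchanging the sum and the expectation requires that there are only countably many fields \<open>\<rat>\<^sub>p(x)\<close> and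
  that the number of roots in \<open>K\<^sup>n\<^sup>e\<^sup>w\<close> is measurable. Both follow from Newton's method in a finite extension,
  which shows that simple roots persist, with the same field, under small perturbations of the polynomial.
\<close>

section \<open>Arithmetic of the p-adic integers\<close>

text \<open>No valuation is constructed on the extensions. Its role in Q_p(x) is played by the
  powers of \<open>p\<close> in a ring Z_p[u] with \<open>u\<close> an integral generator. This ring
  need not be integrally closed, but it is free over Z_p on the powers of \<open>u\<close>, hence
  separated and complete coefficient by coefficient; a denominator \<open>p ^ c\<close> in Newton's
  method makes up for the rest. To have at least \<open>k\<close> roots generating \<open>K\<close>,
  counted with multiplicity, is not an open condition: a multiple root may split into roots outside
  \<open>K\<close>. Such polynomials are therefore written as products with a factor having simple
  roots, and countable unions of compact sets take the place of open sets because they survive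
  multiplication. The estimate has two sides: from above all multiplicities of primes of degree at
  most \<open>r\<close> count, from below only the blocks that fit into \<open>r\<close>. The main
  losses come from proper prime powers of degree \<open>k > r\<close>, of weight about
  \<open>p ^ (-k/2)\<close>, and from the zero polynomial, of order \<open>p ^ (r - n)\<close>; they
  vanish because \<open>r\<close> and \<open>n - r\<close> tend to infinity.\<close>

definition unif :: "'p::prime_card padic_int" where
  "unif = of_nat CARD('p)"

lemma residue_unif_power:
  "residue ((unif :: 'p::prime_card padic_int) ^ k) n = pp TYPE('p) k mod pp TYPE('p) n"
proof -
  have "residue (of_nat (CARD('p) ^ k) :: 'p padic_int) n = int (CARD('p) ^ k) mod pp TYPE('p) n"
    by (rule residue_of_nat)
  thus ?thesis by (simp add: unif_def)
qed

lemma residue_diff: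
  "residue (x - y :: 'p::prime_card padic_int) n = (residue x n - residue y n) mod pp TYPE('p) n"
  by transfer simp

lemma residue_1: "residue (1 :: 'p::prime_card padic_int) n = 1 mod pp TYPE('p) n"
  by transfer simp

lemma shift_residue_compat:
  assumes "\<And>m n. m \<le> n \<Longrightarrow> f n mod pp TYPE('p::prime_card) m = f m" "m \<le> n"
  shows "f (n + k) div pp TYPE('p) k mod pp TYPE('p) m = f (m + k) div pp TYPE('p) k"
proof -
  have "f (m + k) = f (n + k) mod (pp TYPE('p) k * pp TYPE('p) m)"
    using assms by (metis add.commute add_le_cancel_right power_add)
  also have "\<dots> = pp TYPE('p) k * (f (n + k) div pp TYPE('p) k mod pp TYPE('p) m) + f (n + k) mod pp TYPE('p) k"
    by (rule zmod_zmult2_eq) simp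
  finally show ?thesis by simp
qed

text \<open>Division by \<open>p ^ k\<close>: it drops \<open>k\<close> digits, so the quotient
  modulo \<open>p ^ n\<close> is read off from the element modulo
  \<open>p ^ (n + k)\<close>.\<close>

lift_definition shift_residue :: "nat \<Rightarrow> 'p::prime_card padic_int \<Rightarrow> 'p padic_int"
  is "\<lambda>k f n. f (n + k) div pp TYPE('p) k"
proof -
  fix k :: nat and f :: "nat \<Rightarrow> int" and m n :: nat
  assume "\<And>m n. m \<le> n \<Longrightarrow> f n mod pp TYPE('p) m = f m" "m \<le> n"
  thus "f (n + k) div pp TYPE('p) k mod pp TYPE('p) m = f (m + k) div pp TYPE('p) k"
    by (rule shift_residue_compat[of f])
qed

lemma unif_power_dvd_iff: "unif ^ k dvd (x :: 'p::prime_card padic_int) \<longleftrightarrow> residue x k = 0"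
proof
  assume "unif ^ k dvd x"
  then obtain y where "x = unif ^ k * y" by (elim dvdE)
  thus "residue x k = 0" by (simp add: residue_mult residue_unif_power)
next
  assume *: "residue x k = 0"
  have "x = unif ^ k * shift_residue k x"
  proof (rule padic_int_eqI)
    fix n
    have "residue x (n + k) mod pp TYPE('p) k = 0" using * residue_mod[of k "n + k" x] by simp
    hence eq: "pp TYPE('p) k * (residue x (n + k) div pp TYPE('p) k) = residue x (n + k)"
      by (simp add: dvd_eq_mod_eq_0)
    have "residue (unif ^ k * shift_residue k x) n =
        (pp TYPE('p) k * residue (shift_residue k x) n) mod pp TYPE('p) n"
      by (simp add: residue_mult residue_unif_power mod_simps)
    also have "residue (shift_residue k x) n = residue x (n + k) div pp TYPE('p) k"
      by transfer simp
    finally show "residue x n = residue (unif ^ k * shift_residue k x) n"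
      using eq residue_mod[of n "n + k" x] by simp
  qed
  thus "unif ^ k dvd x" by (metis dvd_triv_left)
qed

lemma unif_power_dvd_diff_iff:
  "unif ^ k dvd (x - y :: 'p::prime_card padic_int) \<longleftrightarrow> residue x k = residue y k"
proof -
  have "residue (x - y) k = 0 \<longleftrightarrow> residue x k mod pp TYPE('p) k = residue y k mod pp TYPE('p) k"
    unfolding residue_diff mod_mod_trivial by (simp only: mod_eq_dvd_iff dvd_eq_mod_eq_0)
  thus ?thesis by (simp only: unif_power_dvd_iff residue_mod_same)
qed

lemma padic_int_eq_0I: "(\<And>k. unif ^ k dvd (x :: 'p::prime_card padic_int)) \<Longrightarrow> x = 0"
  by (rule padic_int_eqI) (simp add: unif_power_dvd_iff residue_0)

lemma unif_nonzero [simp]: "(unif :: 'p::prime_card padic_int) \<noteq> 0"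
proof
  assume "(unif :: 'p padic_int) = 0"
  hence "residue (unif ^ 1 :: 'p padic_int) 2 = 0" by (simp add: residue_0)
  moreover have "residue (unif ^ 1 :: 'p padic_int) 2 = int CARD('p)"
    unfolding residue_unif_power using p_gt_1[where 'p='p] by (simp add: power2_eq_square)
  ultimately show False using p_gt_1[where 'p='p] by simp
qed

text \<open>Completeness of Z_p: the \<open>n\<close>-th residue no longer changes from the
  \<open>n\<close>-th term on, so the diagonal residues form a compatible sequence.\<close>

lemma padic_int_limit:
  fixes x :: "nat \<Rightarrow> 'p::prime_card padic_int"
  assumes "\<And>k. unif ^ k dvd x (Suc k) - x k"
  obtains l where "\<And>k. unif ^ k dvd l - x k"
proof -
  have step: "residue (x (Suc k)) k = residue (x k) k" for k
    using assms[of k] by (simp add: unif_power_dvd_diff_iff)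
  have const: "residue (x n) m = residue (x m) m" if "m \<le> n" for m n
    using that
  proof (induction n rule: dec_induct)
    case (step n)
    have "residue (x (Suc n)) m = residue (x n) m"
      by (rule residue_eq_mono[OF step.hyps(1) \<open>residue (x (Suc n)) n = residue (x n) n\<close>])
    thus ?case using step.IH by simp
  qed simp
  define l :: "'p padic_int" where "l = Abs_padic_int (\<lambda>n. residue (x n) n)"
  have "(\<lambda>n. residue (x n) n) \<in> {f. \<forall>m n. m \<le> n \<longrightarrow> f n mod pp TYPE('p) m = f m}"
  proof (intro CollectI allI impI)
    fix m n :: nat assume mn: "m \<le> n"
    have "residue (x n) n mod pp TYPE('p) m = residue (x n) m" by (rule residue_mod[OF mn])
    also have "\<dots> = residue (x m) m" by (rule const[OF mn])
    finally show "residue (x n) n mod pp TYPE('p) m = residue (x m) m" .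
  qed
  hence "residue l = (\<lambda>n. residue (x n) n)"
    unfolding l_def by (rule trans[OF residue.rep_eq Abs_padic_int_inverse])
  hence "unif ^ k dvd l - x k" for k by (simp add: unif_power_dvd_diff_iff)
  thus thesis by (rule that)
qed

section \<open>Reduction modulo \<open>p\<close>, units and valuations\<close>

definition red :: "'p::prime_card padic_int \<Rightarrow> 'p mod_ring" where
  "red x = of_int (residue x 1)"

lemma of_int_mod_card: "(of_int (k mod int CARD('p)) :: 'p::prime_card mod_ring) = of_int k"
  using of_int_mod_CHAR[where 'a = "'p mod_ring", of k] by simp

lemma comm_ring_hom_red: "comm_ring_hom (red :: 'p::prime_card padic_int \<Rightarrow> 'p mod_ring)"
proof
  fix x y :: "'p padic_int"
  show "red (x + y) = red x + red y"
    by (simp add: red_def residue_add of_int_mod_card)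
  show "red (x * y) = red x * red y"
    by (simp add: red_def residue_mult of_int_mod_card)
qed (simp_all add: red_def residue_0 residue_1 of_int_mod_card)

interpretation red: comm_ring_hom "red :: 'p::prime_card padic_int \<Rightarrow> 'p mod_ring"
  by (rule comm_ring_hom_red)

lemma red_eq_0_iff: "red x = 0 \<longleftrightarrow> unif dvd (x :: 'p::prime_card padic_int)"
proof -
  have "red x = 0 \<longleftrightarrow> residue x 1 = 0"
  proof
    assume "red x = 0"
    have "0 \<le> residue x 1" "residue x 1 < int CARD('p)" using residue_range[of x 1] by auto
    moreover from this have "(of_nat (nat (residue x 1)) :: 'p mod_ring) = 0"
      using \<open>red x = 0\<close> by (simp add: red_def)
    hence "CARD('p) dvd nat (residue x 1)" by (rule of_nat_0_mod_ring_dvd)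
    ultimately show "residue x 1 = 0"
      by (metis int_dvd_int_iff int_nat_eq zdvd_not_zless order_le_less)
  qed (simp add: red_def)
  thus ?thesis using unif_power_dvd_iff[of 1 x] by simp
qed

lemma red_unif [simp]: "red unif = 0"
  by (simp add: red_eq_0_iff)

lemma red_of_nat: "red (of_nat k) = of_nat k"
  by (induction k) (simp_all add: red.hom_add)

lemma surj_red: "\<exists>x. red x = (a :: 'p::prime_card mod_ring)"
  using surj_of_nat_mod_ring[of a] red_of_nat by metis

text \<open>The values at \<open>0\<close> and \<open>1\<close> are fixed so that lifting coefficientwise preserves degrees and monic polynomials.\<close>

definition lift_red :: "'p::prime_card mod_ring \<Rightarrow> 'p padic_int" where
  "lift_red a = (if a = 0 then 0 else if a = 1 then 1 else SOME x. red x = a)"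

lemma red_lift_red [simp]: "red (lift_red a) = a"
  using someI_ex[OF surj_red[of a]] by (auto simp: lift_red_def)

lemma lift_red_0 [simp]: "lift_red 0 = 0" and lift_red_1 [simp]: "lift_red 1 = 1"
  by (simp_all add: lift_red_def)

text \<open>If \<open>c\<close> lifts the inverse of the reduction, then
  \<open>c * x = 1 - unif * t\<close>, and the geometric series in \<open>unif * t\<close> converges
  to an inverse.\<close>

lemma dvd_1_if_red_nonzero:
  fixes x :: "'p::prime_card padic_int"
  assumes "red x \<noteq> 0"
  shows "x dvd 1"
proof -
  define c where "c = lift_red (inverse (red x))"
  have "red (1 - c * x) = 0" using assms by (simp add: red.hom_minus red.hom_mult c_def)
  then obtain t where t: "1 - c * x = unif * t" by (auto simp: red_eq_0_iff)
  define s where "s n = (\<Sum>i<n. (unif * t) ^ i)" for n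
  have "unif ^ k dvd s (Suc k) - s k" for k by (simp add: s_def power_mult_distrib)
  then obtain l where l: "\<And>k. unif ^ k dvd l - s k" by (rule padic_int_limit[of s]) auto
  have "unif ^ k dvd c * x * l - 1" for k
  proof -
    have "c * x * s k = 1 - (unif * t) ^ k"
      using one_diff_power_eq[of "unif * t" k] by (simp add: s_def t[symmetric])
    hence "c * x * l - 1 = c * x * (l - s k) - (unif * t) ^ k" by (simp add: algebra_simps)
    moreover have "unif ^ k dvd (unif * t) ^ k" by (simp add: power_mult_distrib)
    ultimately show ?thesis using l[of k] by (simp add: dvd_diff)
  qed
  hence "c * x * l - 1 = 0" by (rule padic_int_eq_0I)
  hence "1 = x * (c * l)" by (simp add: algebra_simps)
  thus ?thesis by (rule dvdI)
qed

lemma padic_int_decompose: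
  fixes x :: "'p::prime_card padic_int"
  assumes "x \<noteq> 0"
  obtains k u where "x = unif ^ k * u" "red u \<noteq> 0"
proof -
  obtain m where m: "\<not> unif ^ m dvd x" using assms padic_int_eq_0I by blast
  define k where "k = (LEAST m. \<not> unif ^ m dvd x) - 1"
  have L: "\<not> unif ^ (LEAST m. \<not> unif ^ m dvd x) dvd x" using m by (rule LeastI)
  hence "(LEAST m. \<not> unif ^ m dvd x) \<noteq> 0" by (metis power_0 one_dvd)
  hence k: "(LEAST m. \<not> unif ^ m dvd x) = Suc k" by (simp add: k_def)
  hence "unif ^ k dvd x" by (metis lessI not_less_Least)
  then obtain u where u: "x = unif ^ k * u" by (elim dvdE)
  have "red u \<noteq> 0"
  proof
    assume "red u = 0"
    then obtain v where "u = unif * v" by (auto simp: red_eq_0_iff)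
    hence "x = unif ^ Suc k * v" using u by simp
    thus False using L k by (metis dvd_triv_left)
  qed
  thus thesis using u that by blast
qed

section \<open>Polynomials over the p-adic integers and their reductions\<close>

interpretation redp: map_poly_comm_ring_hom "red :: 'p::prime_card padic_int \<Rightarrow> 'p mod_ring"
  by unfold_locales

abbreviation red_poly :: "'p::prime_card padic_int poly \<Rightarrow> 'p mod_ring poly" where
  "red_poly \<equiv> map_poly red"

definition lift_poly :: "'p::prime_card mod_ring poly \<Rightarrow> 'p padic_int poly" where
  "lift_poly = map_poly lift_red"

lemma red_lift_poly [simp]: "red_poly (lift_poly f) = f"
  by (rule poly_eqI) (simp add: lift_poly_def coeff_map_poly)

lemma lift_red_eq_0_iff [simp]: "lift_red a = 0 \<longleftrightarrow> a = 0"
  by (metis red.hom_zero red_lift_red lift_red_0)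

lemma degree_lift_poly [simp]: "degree (lift_poly f) = degree f"
  unfolding lift_poly_def by (rule degree_map_poly) simp

lemma monic_lift_poly: "monic f \<Longrightarrow> monic (lift_poly f)"
  by (simp add: lift_poly_def coeff_map_poly flip: degree_lift_poly[of f, unfolded lift_poly_def])

lemma coeff_red_poly [simp]: "coeff (red_poly P) i = red (coeff P i)"
  by (simp add: coeff_map_poly)

lemma degree_red_poly_le: "degree (red_poly P) \<le> degree P"
  by (rule degree_map_poly_le)

lemma red_poly_eq_0_iff: "red_poly P = 0 \<longleftrightarrow> [:unif:] dvd P"
  by (simp add: poly_eq_iff const_poly_dvd_iff red_eq_0_iff)

lemma red_poly_smult: "red_poly (smult c P) = smult (red c) (red_poly P)"
  by (rule poly_eqI) (simp add: red.hom_mult)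

text \<open>The valuation \<open>j\<close> of the leading coefficient drops with each division by
  \<open>unif\<close>, so the extraction of the content ends.\<close>

lemma poly_unif_power_decompose:
  fixes P :: "'p::prime_card padic_int poly"
  assumes "P \<noteq> 0"
  obtains k Q where "P = smult (unif ^ k) Q" "red_poly Q \<noteq> 0"
proof -
  obtain j u where ju: "lead_coeff P = unif ^ j * u" "red u \<noteq> 0"
    using assms by (metis leading_coeff_0_iff padic_int_decompose)
  have "\<exists>k Q. P = smult (unif ^ k) Q \<and> red_poly Q \<noteq> 0"
    using ju assms
  proof (induction j arbitrary: P)
    case 0
    hence "red_poly P \<noteq> 0" by (metis coeff_red_poly coeff_0 mult_1 power_0)
    thus ?case by (intro exI[of _ 0] exI[of _ P]) simp
  next
    case (Suc j)
    show ?case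
    proof (cases "red_poly P = 0")
      case True
      then obtain R where R: "P = smult unif R" by (auto simp: red_poly_eq_0_iff elim!: dvdE)
      have "unif * lead_coeff R = unif * (unif ^ j * u)"
        using Suc.prems(1) R by (simp add: mult.assoc)
      hence "lead_coeff R = unif ^ j * u" by simp
      moreover have "R \<noteq> 0" using R Suc.prems(3) by auto
      ultimately obtain k Q where "R = smult (unif ^ k) Q" "red_poly Q \<noteq> 0"
        using Suc.IH[of R] Suc.prems(2) by blast
      thus ?thesis using R by (intro exI[of _ "Suc k"] exI[of _ Q]) simp
    next
      case False
      thus ?thesis by (intro exI[of _ 0] exI[of _ P]) simp
    qed
  qed
  thus thesis using that by blast
qed

text \<open>Uniqueness of content and primitive part: with different exponents, one of the two
  primitive polynomials would be divisible by \<open>unif\<close>.\<close>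

lemma primitive_smult_eq:
  fixes G H :: "'p::prime_card padic_int poly"
  assumes "smult (unif ^ a) G = smult (unif ^ b) H" "red_poly G \<noteq> 0" "red_poly H \<noteq> 0"
  shows "a = b \<and> G = H"
proof -
  have *: "a = b"
    if "smult (unif ^ a) G = smult (unif ^ b) H" "red_poly H \<noteq> 0" "a \<le> b \<or> red_poly G \<noteq> 0" "b \<le> a"
    for a b and G H :: "'p padic_int poly"
  proof (rule ccontr)
    assume "a \<noteq> b"
    hence "a = b + Suc (a - b - 1)" using that by simp
    hence "smult (unif ^ b) (smult (unif ^ Suc (a - b - 1)) G) = smult (unif ^ b) H"
      using that(1) by (metis power_add smult_smult)
    hence "H = smult (unif ^ Suc (a - b - 1)) G" by (auto simp: poly_eq_iff mult.assoc)
    hence "red_poly H = 0" by (simp add: red_poly_smult red.hom_mult)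
    thus False using that by simp
  qed
  have "a = b"
    using *[of a G b H] *[of b H a G] assms by (metis nat_le_linear)
  thus ?thesis using assms by (auto simp: poly_eq_iff)
qed

text \<open>The common degree bound makes the coefficientwise limit a polynomial rather than a power
  series.\<close>

lemma poly_limit:
  fixes F :: "nat \<Rightarrow> 'p::prime_card padic_int poly"
  assumes "\<And>k. [:unif ^ k:] dvd F (Suc k) - F k" and deg: "\<And>k. degree (F k) \<le> n"
  obtains L where "degree L \<le> n" "\<And>k. [:unif ^ k:] dvd L - F k"
proof -
  have "\<exists>l. \<forall>k. unif ^ k dvd l - coeff (F k) i" for i
  proof -
    have "unif ^ k dvd coeff (F (Suc k)) i - coeff (F k) i" for k
      using assms(1)[of k] by (simp add: const_poly_dvd_iff)
    then obtain l where "\<And>k. unif ^ k dvd l - coeff (F k) i"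
      using padic_int_limit[of "\<lambda>k. coeff (F k) i"] by blast
    thus ?thesis by blast
  qed
  then obtain l where l: "\<And>i k. unif ^ k dvd l i - coeff (F k) i" by metis
  define L where "L = (\<Sum>i\<le>n. monom (l i) i)"
  have cL: "coeff L i = (if i \<le> n then l i else 0)" for i
    by (simp add: L_def coeff_sum)
  have "degree L \<le> n" by (rule degree_le) (simp add: cL)
  moreover have "[:unif ^ k:] dvd L - F k" for k
    using l deg[of k] by (auto simp: const_poly_dvd_iff cL coeff_eq_0)
  ultimately show thesis by (rule that)
qed

lemma poly_eq_0I:
  assumes "\<And>k. [:unif ^ k:] dvd (P :: 'p::prime_card padic_int poly)"
  shows "P = 0"
  using assms by (intro poly_eqI) (auto simp: const_poly_dvd_iff intro: padic_int_eq_0I)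

section \<open>Counting polynomials over a finite field\<close>

text \<open>\<open>prime\<close> includes being normalized, so each irreducible polynomial is
  represented once, by its monic associate. All sums over primes rely on this.\<close>

lemma prime_poly_monic:
  assumes "prime (f :: 'a::field_gcd poly)"
  shows "monic f"
proof -
  have "normalize f = f" "f \<noteq> 0" using assms by (auto simp: prime_def)
  hence "lead_coeff f = lead_coeff f div unit_factor (lead_coeff f)"
    by (metis coeff_normalize)
  also have "unit_factor (lead_coeff f) = lead_coeff f"
    using \<open>f \<noteq> 0\<close> by (intro is_unit_unit_factor) (simp add: dvd_field_iff)
  finally show ?thesis using \<open>f \<noteq> 0\<close> by simp
qed

lemma prime_poly_degree_pos:
  assumes "prime (f :: 'a::field_gcd poly)"
  shows "degree f > 0"
proof (rule ccontr)
  assume "\<not> degree f > 0"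
  hence "is_unit f" using assms by (intro is_unit_iff_degree[THEN iffD2]) (auto simp: prime_def)
  thus False using assms by (metis not_prime_unit)
qed

definition primes_upto_degree :: "nat \<Rightarrow> 'a::field_gcd poly set" where
  "primes_upto_degree n = {f. prime f \<and> degree f \<le> n}"

text \<open>The index set does not depend on \<open>P\<close>, in contrast to
  \<open>prime_factors P\<close>; this is what allows the exchange with sums over
  \<open>P\<close>.\<close>

lemma degree_eq_sum_multiplicity:
  fixes P :: "'a::field_gcd poly"
  assumes "P \<noteq> 0" "degree P \<le> n" "finite (primes_upto_degree n :: 'a poly set)"
  shows "degree P = (\<Sum>f\<in>primes_upto_degree n. degree f * multiplicity f P)"
proof -
  have "degree P = degree (normalize P)"
    using assms(1) by (metis dvd_imp_degree_le eq_iff dvd_normalize_iff dvd_refl normalize_dvd_iff normalize_eq_0_iff)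
  also have "normalize P = (\<Prod>f\<in>prime_factors P. f ^ multiplicity f P)"
    using assms(1) by (simp add: prod_prime_factors)
  also have "degree \<dots> = (\<Sum>f\<in>prime_factors P. degree (f ^ multiplicity f P))"
    by (intro degree_prod_sum_eq) (auto dest: in_prime_factors_imp_prime)
  also have "\<dots> = (\<Sum>f\<in>prime_factors P. degree f * multiplicity f P)"
    by (intro sum.cong refl, subst degree_power_eq) (auto dest: in_prime_factors_imp_prime)
  also have "\<dots> = (\<Sum>f\<in>primes_upto_degree n. degree f * multiplicity f P)"
  proof (rule sum.mono_neutral_left)
    show "prime_factors P \<subseteq> primes_upto_degree n"
    proof
      fix f assume "f \<in> prime_factors P"
      hence "prime f" "f dvd P" by (auto dest: in_prime_factors_imp_prime in_prime_factors_imp_dvd)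
      moreover from this have "degree f \<le> degree P" using assms(1) by (intro dvd_imp_degree_le)
      ultimately show "f \<in> primes_upto_degree n" using assms(2) by (simp add: primes_upto_degree_def)
    qed
    show "\<forall>f\<in>primes_upto_degree n - prime_factors P. degree f * multiplicity f P = 0"
      using assms(1)
      by (auto simp: primes_upto_degree_def in_prime_factors_iff not_dvd_imp_multiplicity_0)
  qed (use assms in auto)
  finally show ?thesis .
qed

lemma power_dvd_imp_le_degree:
  fixes P :: "'a::field_gcd poly"
  assumes "P \<noteq> 0" "prime f" "f ^ e dvd P"
  shows "e * degree f \<le> degree P" "e \<le> degree P"
proof -
  have "f \<noteq> 0" using assms by auto
  thus *: "e * degree f \<le> degree P"
    using dvd_imp_degree_le[OF assms(3,1)] by (simp add: degree_power_eq mult.commute)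
  thus "e \<le> degree P" using prime_poly_degree_pos[OF assms(2)]
    by (metis le_trans mult_le_mono2 nat_mult_1_right Suc_leI One_nat_def)
qed

lemma power_dvd_iff_le_mult:
  fixes Q :: "'a::field_gcd poly"
  assumes "Q \<noteq> 0" "prime f"
  shows "f ^ e dvd Q \<longleftrightarrow> e \<le> multiplicity f Q"
  using assms prime_poly_degree_pos[OF assms(2)]
  by (intro power_dvd_iff_le_multiplicity) (auto dest: not_prime_unit)

text \<open>Layer by layer, a multiplicity becomes a sum of divisibility events, and these can be
  counted over all \<open>P\<close>.\<close>

lemma multiplicity_eq_sum:
  fixes P :: "'a::field_gcd poly"
  assumes "P \<noteq> 0" "prime f" "degree P \<le> n"
  shows "multiplicity f P = (\<Sum>e=1..n. of_bool (f ^ e dvd P))"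
proof -
  have iff: "f ^ e dvd P \<longleftrightarrow> e \<le> multiplicity f P" for e
    by (rule power_dvd_iff_le_mult[OF assms(1,2)])
  have le: "multiplicity f P \<le> n"
    using power_dvd_imp_le_degree(2)[OF assms(1,2) multiplicity_dvd] assms(3) by simp
  have "(\<Sum>e=1..n. of_bool (f ^ e dvd P)) = card ({1..n} \<inter> {e. f ^ e dvd P})"
    by simp
  also have "{1..n} \<inter> {e. f ^ e dvd P} = {1..multiplicity f P}"
    using le by (auto simp: iff)
  finally show ?thesis by simp
qed

text \<open>Stated through coefficients, so that \<open>polys_below 0\<close> is \<open>{0}\<close>
  although the zero polynomial has degree \<open>0\<close>. The possible reductions of the random
  polynomial form \<open>polys_below (Suc n)\<close>.\<close>

definition polys_below :: "nat \<Rightarrow> 'a::zero poly set" where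
  "polys_below n = {P. \<forall>i\<ge>n. coeff P i = 0}"

lemma polys_below_0 [simp]: "polys_below 0 = {0}"
  by (auto simp: polys_below_def poly_eq_iff)

lemma zero_in_polys_below [simp]: "0 \<in> polys_below n"
  by (simp add: polys_below_def)

lemma polys_below_iff_degree: "P \<in> polys_below n \<longleftrightarrow> P = 0 \<or> degree P < n"
proof
  assume *: "P \<in> polys_below n"
  show "P = 0 \<or> degree P < n"
  proof (rule disjCI)
    assume "\<not> degree P < n"
    hence "lead_coeff P = 0" using * by (simp add: polys_below_def)
    thus "P = 0" by simp
  qed
qed (auto simp: polys_below_def coeff_eq_0)

lemma polys_below_Suc_iff: "P \<in> polys_below (Suc n) \<longleftrightarrow> degree P \<le> n"
  by (auto simp: polys_below_iff_degree)

lemma card_polys_below: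
  "finite (polys_below n :: 'a::{zero,finite} poly set) \<and> card (polys_below n :: 'a poly set) = CARD('a) ^ n"
proof (induction n)
  case (Suc n)
  have "bij_betw (\<lambda>(a, P). pCons a P) (UNIV \<times> polys_below n) (polys_below (Suc n) :: 'a poly set)"
  proof (rule bij_betwI')
    fix P :: "'a poly" assume P: "P \<in> polys_below (Suc n)"
    obtain a Q where PQ: "P = pCons a Q" by (rule pCons_cases)
    have "coeff Q i = coeff P (Suc i)" for i by (simp add: PQ)
    hence "Q \<in> polys_below n" using P by (simp add: polys_below_def)
    thus "\<exists>x\<in>UNIV \<times> polys_below n. P = (case x of (a, P) \<Rightarrow> pCons a P)"
      using PQ by (intro bexI[of _ "(a, Q)"]) auto
  qed (auto simp: polys_below_def coeff_pCons split: nat.splits)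
  from bij_betw_same_card[OF this] bij_betw_finite[OF this] Suc show ?case
    by (auto simp: card_cartesian_product)
qed simp

lemma finite_polys_below [simp]: "finite (polys_below n :: 'a::{zero,finite} poly set)"
  using card_polys_below by blast

lemma finite_primes_upto_degree [simp]: "finite (primes_upto_degree n :: 'a::{field_gcd,finite} poly set)"
  by (rule finite_subset[OF _ finite_polys_below[of "Suc n"]])
     (auto simp: primes_upto_degree_def polys_below_Suc_iff)

text \<open>Multiples correspond to their cofactors. The truncated difference is right also for
  \<open>degree g\<close> at least \<open>n\<close>: zero is then the only multiple.\<close>

lemma card_multiples_below:
  fixes g :: "'a::{field_gcd,finite} poly"
  assumes "g \<noteq> 0"
  shows "card {P\<in>polys_below n. g dvd P} = CARD('a) ^ (n - degree g)"
proof -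
  have "{P\<in>polys_below n. g dvd P} = (*) g ` polys_below (n - degree g)"
  proof (intro equalityI subsetI)
    fix P assume "P \<in> {P\<in>polys_below n. g dvd P}"
    then obtain Q where Q: "P = g * Q" "P = 0 \<or> degree P < n"
      unfolding polys_below_iff_degree by blast
    have "Q = 0 \<or> degree Q < n - degree g"
    proof (cases "Q = 0")
      case False
      hence "degree P = degree g + degree Q" "P \<noteq> 0" using assms Q(1) by (simp_all add: degree_mult_eq)
      thus ?thesis using Q(2) by (simp add: less_diff_conv add.commute)
    qed simp
    thus "P \<in> (*) g ` polys_below (n - degree g)" using Q by (auto simp: polys_below_iff_degree)
  next
    fix P assume "P \<in> (*) g ` polys_below (n - degree g)"
    then obtain Q where Q': "P = g * Q" "Q \<in> polys_below (n - degree g)" by blast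
    hence Q: "P = g * Q" "Q = 0 \<or> degree Q < n - degree g"
      by (simp_all add: polys_below_iff_degree)
    show "P \<in> {P\<in>polys_below n. g dvd P}"
    proof (cases "Q = 0")
      case False
      hence "degree P = degree g + degree Q" using assms Q(1) by (simp add: degree_mult_eq)
      moreover have "degree g + degree Q < n" using Q(2) False by linarith
      ultimately show ?thesis using Q(1) by (simp add: polys_below_iff_degree)
    qed (use Q in simp)
  qed
  moreover have "inj_on ((*) g) (polys_below (n - degree g))" using assms by (auto intro: inj_onI)
  ultimately show ?thesis using card_polys_below[where 'a='a] by (simp add: card_image)
qed

definition monics :: "nat \<Rightarrow> 'a::comm_ring_1 poly set" where
  "monics m = {P. monic P \<and> degree P = m}"

lemma card_monics:
  "finite (monics m :: 'a::{comm_ring_1,finite} poly set) \<and> card (monics m :: 'a poly set) = CARD('a) ^ m"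
proof -
  have "monics m = (+) (monom 1 m) ` (polys_below m :: 'a poly set)"
  proof (intro equalityI subsetI)
    fix P :: "'a poly" assume P: "P \<in> monics m"
    have "P - monom 1 m \<in> polys_below m"
      using P by (auto simp: monics_def polys_below_def coeff_eq_0 le_less)
    thus "P \<in> (+) (monom 1 m) ` polys_below m" by (intro image_eqI[of _ _ "P - monom 1 m"]) auto
  next
    fix P :: "'a poly" assume "P \<in> (+) (monom 1 m) ` polys_below m"
    then obtain Q where Q: "P = monom 1 m + Q" "\<forall>i\<ge>m. coeff Q i = 0" by (auto simp: polys_below_def)
    hence "coeff P m = 1" "\<forall>i>m. coeff P i = 0" by auto
    moreover from this have "degree P = m" by (metis degree_le le_antisym le_degree zero_neq_one)
    ultimately show "P \<in> monics m" by (simp add: monics_def)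
  qed
  thus ?thesis using card_polys_below[where 'a='a, of m] by (simp add: card_image)
qed

lemma finite_monics [simp]: "finite (monics m :: 'a::{comm_ring_1,finite} poly set)"
  using card_monics by blast

lemma card_monic_multiples:
  fixes g :: "'a::{field_gcd,finite} poly"
  assumes "monic g"
  shows "card {P\<in>monics m. g dvd P} = (if degree g \<le> m then CARD('a) ^ (m - degree g) else 0)"
proof (cases "degree g \<le> m")
  case True
  have g: "g \<noteq> 0" using assms by auto
  have "{P\<in>monics m. g dvd P} = (*) g ` monics (m - degree g)"
  proof (intro equalityI subsetI)
    fix P assume "P \<in> {P\<in>monics m. g dvd P}"
    then obtain Q where Q: "P = g * Q" "monic P" "degree P = m"
      by (auto simp: monics_def elim!: dvdE)
    moreover from this have "Q \<noteq> 0" by auto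
    moreover have "lead_coeff P = lead_coeff g * lead_coeff Q" using Q(1) by (simp add: lead_coeff_mult)
    ultimately have "Q \<in> monics (m - degree g)" using assms g
      by (auto simp: monics_def degree_mult_eq)
    thus "P \<in> (*) g ` monics (m - degree g)" using Q by auto
  next
    fix P assume "P \<in> (*) g ` monics (m - degree g)"
    then obtain Q where Q: "P = g * Q" "Q \<in> monics (m - degree g)" by blast
    hence "monic Q" "degree Q = m - degree g" using Q(2) by (auto simp: monics_def)
    moreover from this have "Q \<noteq> 0" by auto
    moreover have "lead_coeff P = lead_coeff g * lead_coeff Q" using Q(1) by (simp add: lead_coeff_mult)
    ultimately show "P \<in> {P\<in>monics m. g dvd P}" using assms g True
      by (auto simp: monics_def degree_mult_eq Q(1))
  qed
  moreover have "inj_on ((*) g) (monics (m - degree g))" using g by (auto intro: inj_onI)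
  ultimately show ?thesis using card_monics[where 'a='a] True by (simp add: card_image)
next
  case False
  hence "{P\<in>monics m. g dvd P} = {}" by (auto simp: monics_def dest!: dvd_imp_degree_le)
  thus ?thesis using False by simp
qed

definition prime_powers_upto :: "nat \<Rightarrow> ('a::field_gcd poly \<times> nat) set" where
  "prime_powers_upto m = {(f, e). prime f \<and> e \<ge> 1 \<and> e * degree f \<le> m}"

definition prime_powers_of :: "nat \<Rightarrow> ('a::field_gcd poly \<times> nat) set" where
  "prime_powers_of m = {(f, e). prime f \<and> e \<ge> 1 \<and> e * degree f = m}"

lemma prime_powers_upto_subset:
  "prime_powers_upto m \<subseteq> (primes_upto_degree m :: 'a::field_gcd poly set) \<times> {1..m}"
proof
  fix x :: "'a poly \<times> nat"
  assume x: "x \<in> prime_powers_upto m"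
  obtain f e where [simp]: "x = (f, e)" by (cases x)
  have *: "prime f" "e \<ge> 1" "e * degree f \<le> m" using x by (auto simp: prime_powers_upto_def)
  hence "degree f \<ge> 1" using prime_poly_degree_pos by force
  hence "degree f \<le> e * degree f" "e \<le> e * degree f" using *(2) by simp_all
  hence "degree f \<le> m" "e \<le> m" using *(3) by linarith+
  thus "x \<in> primes_upto_degree m \<times> {1..m}"
    using * by (simp add: primes_upto_degree_def)
qed

lemma finite_prime_powers_upto [simp]: "finite (prime_powers_upto m :: ('a::{field_gcd,finite} poly \<times> nat) set)"
  by (rule finite_subset[OF prime_powers_upto_subset]) simp

lemma finite_prime_powers_of [simp]: "finite (prime_powers_of m :: ('a::{field_gcd,finite} poly \<times> nat) set)"
  by (rule finite_subset[OF _ finite_prime_powers_upto[of m]])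
     (auto simp: prime_powers_of_def prime_powers_upto_def)

lemma sum_prime_powers_upto:
  fixes h :: "'a::{field_gcd,finite} poly \<times> nat \<Rightarrow> 'b::comm_monoid_add"
  shows "sum h (prime_powers_upto m) = (\<Sum>k=1..m. sum h (prime_powers_of k))"
proof -
  have group: "(\<Sum>k=1..m. \<Sum>x\<in>{x\<in>prime_powers_upto m. snd x * degree (fst x) = k}. h x) = sum h (prime_powers_upto m)"
  proof (rule sum.group)
    have "e * degree f \<ge> 1" if "prime f" "e \<ge> 1" for f :: "'a poly" and e
      using prime_poly_degree_pos[OF that(1)] that(2) by simp
    thus "(\<lambda>x. snd x * degree (fst x)) ` (prime_powers_upto m :: ('a poly \<times> nat) set) \<subseteq> {1..m}"
      by (fastforce simp: prime_powers_upto_def)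
  qed auto
  have "{x\<in>prime_powers_upto m. snd x * degree (fst x) = k} = prime_powers_of k" if "k \<in> {1..m}" for k
    using that by (auto simp: prime_powers_of_def prime_powers_upto_def)
  hence eq: "(\<Sum>k=1..m. \<Sum>x\<in>{x\<in>prime_powers_upto m. snd x * degree (fst x) = k}. h x) =
      (\<Sum>k=1..m. sum h (prime_powers_of k))"
    by (intro sum.cong refl) simp_all
  thus ?thesis using group by simp
qed

text \<open>
  Weighting each power \<open>f ^ e\<close> of a prime by \<open>degree f\<close> gives the polynomial analogue of the
  von Mangoldt function. Its sum over fixed degree is found by computing the total degree of all
  monic polynomials of degree \<open>m\<close> from their factorizations.
\<close>

lemma sum_degree_prime_powers:
  fixes m :: nat
  assumes "m \<ge> 1"
  shows "(\<Sum>(f, e)\<in>(prime_powers_of m :: ('a::{field_gcd,finite} poly \<times> nat) set). degree f) = CARD('a) ^ m"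
  using assms
proof (induction m rule: less_induct)
  case (less m)
  define q where "q = CARD('a)"
  define W where "W k = (\<Sum>(f, e)\<in>(prime_powers_of k :: ('a poly \<times> nat) set). degree f)" for k
  let ?I = "primes_upto_degree m :: 'a poly set"
  have "m * q ^ m = (\<Sum>P\<in>(monics m :: 'a poly set). m)"
    using card_monics[where 'a='a, of m] by (simp add: q_def)
  also have "\<dots> = (\<Sum>P\<in>(monics m :: 'a poly set). \<Sum>f\<in>?I. \<Sum>e=1..m. degree f * of_bool (f ^ e dvd P))"
  proof (rule sum.cong[OF refl])
    fix P :: "'a poly" assume P: "P \<in> monics m"
    hence P': "P \<noteq> 0" "degree P = m" by (auto simp: monics_def)
    have "m = (\<Sum>f\<in>?I. degree f * multiplicity f P)"
      using degree_eq_sum_multiplicity[of P m] P' by simp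
    also have "\<dots> = (\<Sum>f\<in>?I. \<Sum>e=1..m. degree f * of_bool (f ^ e dvd P))"
      using P' by (intro sum.cong refl)
        (subst multiplicity_eq_sum[of _ _ m], auto simp: primes_upto_degree_def sum_distrib_left)
    finally show "m = \<dots>" .
  qed
  also have "\<dots> = (\<Sum>f\<in>?I. \<Sum>e=1..m. \<Sum>P\<in>(monics m :: 'a poly set). degree f * of_bool (f ^ e dvd P))"
    by (subst sum.swap, intro sum.cong refl, subst sum.swap, rule refl)
  also have "\<dots> = (\<Sum>f\<in>?I. \<Sum>e=1..m. if e * degree f \<le> m then degree f * q ^ (m - e * degree f) else 0)"
  proof (intro sum.cong refl)
    fix f :: "'a poly" and e assume "f \<in> ?I"
    hence f: "prime f" "f \<noteq> 0" by (auto simp: primes_upto_degree_def)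
    have "(\<Sum>P\<in>(monics m :: 'a poly set). degree f * of_bool (f ^ e dvd P)) = degree f * card {P\<in>monics m. f ^ e dvd P}"
      by (simp add: Int_def flip: sum_distrib_left)
    also have "card {P\<in>monics m. f ^ e dvd P} = (if e * degree f \<le> m then q ^ (m - e * degree f) else 0)"
      using card_monic_multiples[OF monic_power[OF prime_poly_monic[OF f(1)], of e], of m] f
      by (simp add: degree_power_eq q_def mult.commute)
    finally show "(\<Sum>P\<in>(monics m :: 'a poly set). degree f * of_bool (f ^ e dvd P)) =
      (if e * degree f \<le> m then degree f * q ^ (m - e * degree f) else 0)"
      by (cases "e * degree f \<le> m") (simp_all only: if_True if_False mult_0_right)
  qed
  also have "\<dots> = (\<Sum>(f, e)\<in>?I \<times> {1..m}. if e * degree f \<le> m then degree f * q ^ (m - e * degree f) else 0)"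
    by (rule sum.cartesian_product)
  also have "\<dots> = (\<Sum>(f, e)\<in>(prime_powers_upto m :: ('a poly \<times> nat) set). degree f * q ^ (m - e * degree f))"
  proof (rule sum.mono_neutral_cong_right)
    show "prime_powers_upto m \<subseteq> ?I \<times> {1..m}" by (rule prime_powers_upto_subset)
    show "finite (?I \<times> {1..m})" by simp
  qed (auto simp: prime_powers_upto_def primes_upto_degree_def split: if_splits)
  also have "\<dots> = (\<Sum>k=1..m. \<Sum>(f, e)\<in>(prime_powers_of k :: ('a poly \<times> nat) set). degree f * q ^ (m - e * degree f))"
    by (rule sum_prime_powers_upto)
  also have "\<dots> = (\<Sum>k=1..m. W k * q ^ (m - k))"
    unfolding W_def sum_distrib_right
    by (intro sum.cong refl) (auto simp: prime_powers_of_def)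
  \<comment> \<open>By induction \<open>W k = q ^ k\<close> for \<open>k < m\<close>, so each of the
    other \<open>m - 1\<close> terms equals \<open>q ^ m\<close>, and \<open>W m\<close> has to
    supply the missing \<open>q ^ m\<close>.\<close>
  also have "\<dots> = W m + (\<Sum>k=1..<m. W k * q ^ (m - k))"
    using less.prems by (simp add: sum.last_plus)
  also have "(\<Sum>k=1..<m. W k * q ^ (m - k)) = (\<Sum>k=1..<m. q ^ m)"
    by (intro sum.cong refl) (use less.IH in \<open>auto simp: W_def q_def simp flip: power_add\<close>)
  also have "\<dots> = (m - 1) * q ^ m" by simp
  finally have "m * q ^ m = W m + (m - 1) * q ^ m" .
  moreover have "m * q ^ m = q ^ m + (m - 1) * q ^ m"
    using less.prems by (cases m) auto
  ultimately show ?case by (simp add: W_def q_def)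
qed

section \<open>Hensel factorization\<close>

text \<open>A Bezout relation gives some \<open>a\<close> and \<open>b\<close>; reducing
  \<open>a\<close> modulo \<open>g\<close> fixes its degree, and then the degree of
  \<open>b * g = E - a * h\<close> controls that of \<open>b\<close>.\<close>

lemma hensel_step:
  fixes g h E :: "'p::prime_card mod_ring poly"
  assumes cop: "coprime g h" and g: "degree g = D" "g \<noteq> 0" and h: "degree h \<le> m - D"
    and E: "degree E \<le> m" and Dm: "D \<le> m" "D > 0"
  obtains a b where "degree a < D" "degree b \<le> m - D" "E = a * h + b * g"
proof -
  obtain s t where st: "s * g + t * h = 1"
    using cop by (metis bezout_coefficients_fst_snd coprime_imp_gcd_eq_1)
  define a where "a = (E * t) mod g"
  define b where "b = E * s + h * ((E * t) div g)"
  have "E = E * (s * g + t * h)" by (simp add: st)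
  also have "\<dots> = E * s * g + h * (E * t)" by (simp add: algebra_simps)
  also have "E * t = (E * t) div g * g + a" by (simp add: a_def)
  finally have eq: "E = a * h + b * g" by (simp add: b_def algebra_simps)
  have a: "degree a < D"
    using degree_mod_less[of g "E * t"] g Dm by (auto simp: a_def)
  have "degree (a * h) \<le> m"
    using degree_mult_le[of a h] a h Dm by linarith
  moreover have "b * g = E - a * h" using eq by simp
  ultimately have "degree (b * g) \<le> m" using E by (metis degree_diff_le)
  hence "degree b \<le> m - D" using g by (cases "b = 0") (auto simp: degree_mult_eq)
  thus thesis using a eq by (intro that)
qed

text \<open>Only \<open>g\<close> is monic. The degree of \<open>P\<close> may drop under reduction,
  and the lost degree goes to the cofactor, which is why the degrees of \<open>h\<close> and
  \<open>B\<close> are merely bounded.\<close>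

lemma hensel:
  fixes P :: "'p::prime_card padic_int poly"
  assumes P: "red_poly P = g * h" "degree P \<le> m" and cop: "coprime g h"
    and g: "monic g" "degree g > 0" and h: "degree h \<le> m - degree g" "degree g \<le> m"
  obtains A B where "P = A * B" "degree A = degree g" "degree B \<le> m - degree g"
proof -
  define D where "D = degree g"
  \<comment> \<open>A factorization modulo \<open>p ^ (k + 1)\<close>, so that the coefficientwise
    lifts of \<open>g\<close> and \<open>h\<close> are the start \<open>k = 0\<close>.\<close>
  define good where "good k A B \<longleftrightarrow> monic A \<and> degree A = D \<and> degree B \<le> m - D \<and>
      red_poly A = g \<and> red_poly B = h \<and> [:unif ^ Suc k:] dvd P - A * B"
    for k and A B :: "'p padic_int poly"
  have step: "\<exists>A' B'. good (Suc k) A' B' \<and> [:unif ^ k:] dvd A' - A \<and> [:unif ^ k:] dvd B' - B"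
    if AB: "good k A B" for k A B
  proof -
    from AB have AB': "monic A" "degree A = D" "degree B \<le> m - D" "red_poly A = g" "red_poly B = h"
      by (auto simp: good_def)
    define u :: "'p padic_int" where "u = unif ^ Suc k"
    have u: "u \<noteq> 0" "unif dvd u" "unif ^ k dvd u" "red u = 0"
      by (auto simp: u_def red.hom_mult)
    obtain E where E: "P - A * B = smult u E" using AB by (auto simp: good_def u_def elim!: dvdE)
    have "degree (A * B) \<le> m" using degree_mult_le[of A B] AB' h(2) unfolding D_def by linarith
    hence "degree (smult u E) \<le> m" using assms(2) by (metis E degree_diff_le)
    hence degE: "degree E \<le> m" using u by simp
    obtain a b where ab: "degree a < D" "degree b \<le> m - D" "red_poly E = a * h + b * g"
      using hensel_step[OF cop _ _ _ order_trans[OF degree_red_poly_le degE], of D] g h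
      unfolding D_def by (metis degree_0 less_numeral_extra(3))
    define A' where "A' = A + smult u (lift_poly a)"
    define B' where "B' = B + smult u (lift_poly b)"
    have dA: "degree (smult u (lift_poly a)) < degree A" using u ab AB' by simp
    have "degree A' = D" using dA AB' by (simp add: A'_def degree_add_eq_left)
    moreover have "monic A'" using lead_coeff_add_le[of "smult u (lift_poly a)" A] dA AB'
      by (simp add: A'_def add.commute)
    moreover have "degree B' \<le> m - D" unfolding B'_def using AB' ab u
      by (intro degree_add_le) simp_all
    moreover have "red_poly A' = g" "red_poly B' = h" using AB' u
      by (simp_all add: A'_def B'_def redp.hom_add red_poly_smult)
    moreover have "[:unif ^ Suc (Suc k):] dvd P - A' * B'"
    proof -
      \<comment> \<open>After division by \<open>u\<close> the error reduces to
        \<open>red_poly E - a * h - b * g\<close>, which vanishes by the choice of \<open>a\<close>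
        and \<open>b\<close>; the product of the two corrections still carries a factor
        \<open>u\<close>.\<close>
      have "P - A' * B' = smult u (E - lift_poly a * B - lift_poly b * A - smult u (lift_poly a * lift_poly b))"
        using E by (simp add: A'_def B'_def algebra_simps smult_diff_right smult_add_right)
      moreover have "red_poly (E - lift_poly a * B - lift_poly b * A - smult u (lift_poly a * lift_poly b)) = 0"
        using ab AB' u by (simp add: redp.hom_minus redp.hom_mult red_poly_smult)
      then obtain R where "E - lift_poly a * B - lift_poly b * A - smult u (lift_poly a * lift_poly b) = smult unif R"
        by (auto simp: red_poly_eq_0_iff elim!: dvdE)
      ultimately have "P - A' * B' = smult (unif ^ Suc (Suc k)) R" by (simp add: u_def mult.commute)
      thus ?thesis by (intro dvdI[of _ _ R]) simp
    qed
    moreover have "[:unif ^ k:] dvd A' - A" "[:unif ^ k:] dvd B' - B"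
      using u by (auto simp: A'_def B'_def const_poly_dvd_iff)
    ultimately show ?thesis unfolding good_def by blast
  qed
  have "good 0 (lift_poly g) (lift_poly h)"
    using g h P monic_lift_poly[of g]
    by (auto simp: good_def D_def redp.hom_minus redp.hom_mult simp flip: red_poly_eq_0_iff)
  then obtain F where F: "\<And>k. good k (fst (F k)) (snd (F k))"
    "\<And>k. [:unif ^ k:] dvd fst (F (Suc k)) - fst (F k) \<and> [:unif ^ k:] dvd snd (F (Suc k)) - snd (F k)"
    using dependent_nat_choice[of "\<lambda>k AB. good k (fst AB) (snd AB)"
      "\<lambda>k AB AB'. [:unif ^ k:] dvd fst AB' - fst AB \<and> [:unif ^ k:] dvd snd AB' - snd AB"] step
    by (metis (no_types, lifting) fst_conv snd_conv)
  obtain A where A: "degree A \<le> D" "\<And>k. [:unif ^ k:] dvd A - fst (F k)"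
    using poly_limit[of "\<lambda>k. fst (F k)" D] F by (auto simp: good_def)
  obtain B where B: "degree B \<le> m - D" "\<And>k. [:unif ^ k:] dvd B - snd (F k)"
    using poly_limit[of "\<lambda>k. snd (F k)" "m - D"] F by (auto simp: good_def)
  have "P - A * B = 0"
  proof (rule poly_eq_0I)
    fix k
    have "P - A * B = (P - fst (F k) * snd (F k)) - (A - fst (F k)) * B - fst (F k) * (B - snd (F k))"
      by (simp add: algebra_simps)
    moreover have "[:unif ^ k:] dvd P - fst (F k) * snd (F k)"
    proof (rule dvd_trans)
      show "[:unif ^ k:] dvd [:unif ^ Suc k :: 'p padic_int:]" by (simp add: const_poly_dvd_const_poly_iff)
    qed (use F(1)[of k] in \<open>auto simp: good_def\<close>)
    ultimately show "[:unif ^ k:] dvd P - A * B"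
      using A(2)[of k] B(2)[of k] by (metis dvd_diff dvd_mult dvd_mult2)
  qed
  hence PAB: "P = A * B" by simp
  \<comment> \<open>The limit only yields \<open>degree A\<close> at most \<open>D\<close>; equality
    follows because \<open>A\<close> still reduces to \<open>g\<close>.\<close>
  have "[:unif:] dvd A - fst (F 1)" using A(2)[of 1] by simp
  hence "red_poly A = red_poly (fst (F 1))"
    unfolding red_poly_eq_0_iff[symmetric] by (simp add: redp.hom_minus)
  hence "red_poly A = g" using F(1)[of 1] by (simp add: good_def)
  hence "degree A = degree g" using A(1) degree_red_poly_le[of A] by (simp add: D_def)
  thus thesis using that PAB B unfolding D_def by blast
qed

text \<open>For primitive polynomials this is irreducibility over Q_p, by Gauss's lemma; constant
  factors are harmless.\<close>

definition padic_irreducible :: "'p::prime_card padic_int poly \<Rightarrow> bool" where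
  "padic_irreducible P \<longleftrightarrow> red_poly P \<noteq> 0 \<and> degree P > 0 \<and>
     (\<forall>A B. P = A * B \<longrightarrow> degree A = 0 \<or> degree B = 0)"

text \<open>If \<open>f ^ e\<close> is the exact power of a prime \<open>f\<close> in the reduction,
  the coprime factorization into \<open>f ^ e\<close> and \<open>h\<close> lifts, and irreducibility
  forces the second factor to be constant. The reduction is then a constant times
  \<open>f ^ e\<close>, without loss of degree.\<close>

lemma padic_irreducible_reduction:
  fixes P :: "'p::prime_card padic_int poly"
  assumes P: "padic_irreducible P" and deg: "degree (red_poly P) > 0"
  obtains f where "prime f" "degree f * multiplicity f (red_poly P) = degree P"
    "degree (red_poly P) = degree P"
    "\<And>f'. prime f' \<Longrightarrow> f' \<noteq> f \<Longrightarrow> multiplicity f' (red_poly P) = 0"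
proof -
  define Q where "Q = red_poly P"
  have Q0: "Q \<noteq> 0" using P by (simp add: padic_irreducible_def Q_def)
  have "\<not> is_unit Q" using deg Q0 by (simp add: Q_def is_unit_iff_degree)
  then obtain f where f: "prime f" "f dvd Q" using Q0 prime_divisor_exists by blast
  define e where "e = multiplicity f Q"
  have nu: "\<not> is_unit f" "f \<noteq> 0" using f(1) prime_poly_degree_pos[OF f(1)] by auto
  obtain h where h: "Q = f ^ e * h" "\<not> f dvd h"
    unfolding e_def using multiplicity_decompose'[OF Q0 nu(1)] by blast
  have h0: "h \<noteq> 0" using h Q0 by auto
  have cop: "coprime (f ^ e) h" using f h
    by (simp add: prime_imp_coprime)
  have e: "e > 0" unfolding e_def using f Q0 nu prime_poly_degree_pos[OF f(1)]
    by (simp add: multiplicity_gt_zero_iff)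
  have dfe: "degree (f ^ e) = degree f * e" by (simp add: degree_power_eq nu mult.commute)
  have g: "monic (f ^ e)" by (rule monic_power[OF prime_poly_monic[OF f(1)]])
  have g': "degree (f ^ e) > 0" using dfe e prime_poly_degree_pos[OF f(1)] by simp
  have dQ: "degree Q = degree (f ^ e) + degree h" using h h0 nu by (simp add: degree_mult_eq)
  have QP: "degree Q \<le> degree P" by (simp add: Q_def degree_red_poly_le)
  have bounds: "degree h \<le> degree P - degree (f ^ e)" "degree (f ^ e) \<le> degree P"
    using dQ QP by linarith+
  obtain A B where AB: "P = A * B" "degree A = degree (f ^ e)" "degree B \<le> degree P - degree (f ^ e)"
    by (rule hensel[OF h(1)[unfolded Q_def] order.refl cop g g' bounds])
  have "\<forall>A B. P = A * B \<longrightarrow> degree A = 0 \<or> degree B = 0" using P unfolding padic_irreducible_def by (elim conjE)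
  hence "degree A = 0 \<or> degree B = 0" by (elim allE impE) (rule AB(1))
  hence "degree B = 0" using AB(2) g' by simp
  moreover have "P \<noteq> 0" using P by (auto simp: padic_irreducible_def)
  ultimately have dP: "degree P = degree (f ^ e)" using AB by (auto simp: degree_mult_eq)
  hence dh: "degree h = 0" "degree Q = degree P" using dQ QP by simp_all
  show thesis
  proof (rule that[of f])
    fix f' assume f': "prime f'" "f' \<noteq> f"
    have "\<not> f' dvd Q"
    proof
      assume "f' dvd Q"
      hence "f' dvd f ^ e \<or> f' dvd h" using h f'(1) by (simp add: prime_dvd_mult_iff)
      moreover have "\<not> f' dvd h"
        using dh(1) h0 prime_poly_degree_pos[OF f'(1)] dvd_imp_degree_le[of f' h] by auto
      ultimately have "f' dvd f" using f'(1) prime_dvd_power by blast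
      thus False using f' f(1) primes_dvd_imp_eq by blast
    qed
    thus "multiplicity f' (red_poly P) = 0" by (simp add: not_dvd_imp_multiplicity_0 Q_def)
  qed (use f dP dfe dh in \<open>auto simp: Q_def e_def\<close>)
qed

text \<open>The bounds on the blocks behave additively under products, so they need only be checked
  on constants and irreducible polynomials.\<close>

lemma padic_poly_factor_induct [consumes 1, case_names const irreducible mult]:
  fixes P :: "'p::prime_card padic_int poly"
  assumes "red_poly P \<noteq> 0"
    and "\<And>P. red_poly P \<noteq> 0 \<Longrightarrow> degree P = 0 \<Longrightarrow> Q P"
    and "\<And>P. padic_irreducible P \<Longrightarrow> Q P"
    and "\<And>A B. red_poly A \<noteq> 0 \<Longrightarrow> red_poly B \<noteq> 0 \<Longrightarrow> Q A \<Longrightarrow> Q B \<Longrightarrow> Q (A * B)"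
  shows "Q P"
  using assms(1)
proof (induction "degree P" arbitrary: P rule: less_induct)
  case less
  show ?case
  proof (cases "degree P = 0 \<or> padic_irreducible P")
    case True
    thus ?thesis using assms(2,3) less.prems by blast
  next
    case False
    then obtain A B where AB: "P = A * B" "degree A > 0" "degree B > 0"
      using less.prems by (auto simp: padic_irreducible_def)
    have nz: "red_poly A \<noteq> 0" "red_poly B \<noteq> 0"
      using less.prems AB by (auto simp: redp.hom_mult)
    hence "A \<noteq> 0" "B \<noteq> 0" by auto
    hence "degree A < degree P" "degree B < degree P" using AB by (auto simp: degree_mult_eq)
    thus ?thesis using less.hyps nz assms(4) AB(1) by blast
  qed
qed

section \<open>Roots in the algebraic closure\<close>

lemma inj_idom_hom_of_Zp: "inj_idom_hom (of_Zp :: 'p::prime_card padic_int \<Rightarrow> 'p padic alg_closure)"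
proof
  fix x y :: "'p padic_int"
  show "of_Zp (x + y) = of_Zp x + of_Zp y"
    by (simp add: of_Zp_def flip: to_ac_add)
  show "of_Zp (x * y) = of_Zp x * of_Zp y"
    by (simp add: of_Zp_def flip: to_ac_mult)
  show "x = 0" if "of_Zp x = 0"
    using that by (simp add: of_Zp_def eq_fract Zero_fract_def)
qed (simp_all add: of_Zp_def flip: Zero_fract_def One_fract_def)

interpretation of_Zp: inj_idom_hom "of_Zp :: 'p::prime_card padic_int \<Rightarrow> 'p padic alg_closure"
  by (rule inj_idom_hom_of_Zp)

interpretation of_Zp_poly: map_poly_inj_idom_hom "of_Zp :: 'p::prime_card padic_int \<Rightarrow> 'p padic alg_closure"
  by unfold_locales

definition ev :: "'p::prime_card padic_int poly \<Rightarrow> 'p padic alg_closure \<Rightarrow> 'p padic alg_closure" where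
  "ev P x = poly (map_poly of_Zp P) x"

lemma ev_simps [simp]:
  "ev 0 x = 0" "ev 1 x = 1" "ev (P + Q) x = ev P x + ev Q x" "ev (P - Q) x = ev P x - ev Q x"
  "ev (- P) x = - ev P x" "ev (P * Q) x = ev P x * ev Q x" "ev (smult c P) x = of_Zp c * ev P x"
  "ev (pCons c P) x = of_Zp c + x * ev P x" "ev (P ^ k) x = ev P x ^ k"
  by (simp_all add: ev_def of_Zp_poly.hom_add of_Zp_poly.hom_minus of_Zp_poly.hom_uminus
        of_Zp_poly.hom_mult of_Zp_poly.hom_power of_Zp.map_poly_hom_smult of_Zp.map_poly_pCons_hom)

lemma ev_monom [simp]: "ev (monom c k) x = of_Zp c * x ^ k"
  by (simp add: ev_def poly_monom)

lemma ev_sum: "ev (\<Sum>i\<in>A. P i) x = (\<Sum>i\<in>A. ev (P i) x)"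
  by (induction A rule: infinite_finite_induct) simp_all

lemma ev_pcompose: "ev (pcompose P Q) x = ev P (ev Q x)"
  by (simp add: ev_def of_Zp.map_poly_pcompose poly_pcompose)

lemma fract_cases_padic:
  obtains b c :: "'p::prime_card padic_int" where "c \<noteq> 0" "to_ac q = of_Zp b / of_Zp c"
proof -
  obtain b c where bc: "q = Fract b c" "c \<noteq> 0" by (cases q)
  hence "q = Fract b 1 / Fract c 1" by simp
  hence "to_ac q = of_Zp b / of_Zp c" unfolding of_Zp_def by (metis to_ac_divide)
  thus thesis using that bc by blast
qed

lemma of_Zp_quotient_in_Qp: "of_Zp b / of_Zp c \<in> Qp"
  unfolding of_Zp_def to_ac_divide[symmetric] by blast

lemma ex_annihilator: "\<exists>P. P \<noteq> 0 \<and> ev P (x :: 'p::prime_card padic alg_closure) = 0"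
proof -
  obtain p where p: "p \<noteq> 0" "poly (map_poly to_ac p) x = 0" by (rule alg_closure_algebraic)
  have "\<exists>P s. s \<noteq> 0 \<and> map_poly of_Zp P = smult (of_Zp s) (map_poly to_ac p)"
  proof (induction p)
    case 0
    thus ?case by (intro exI[of _ 0] exI[of _ 1]) simp
  next
    case (pCons a p)
    then obtain P s where Ps: "s \<noteq> 0" "map_poly of_Zp P = smult (of_Zp s) (map_poly to_ac p)" by blast
    obtain b c where bc: "c \<noteq> 0" "to_ac a = of_Zp b / of_Zp c" by (rule fract_cases_padic)
    have "map_poly to_ac (pCons a p) = pCons (to_ac a) (map_poly to_ac p)"
      by (rule map_poly_pCons) (use pCons.hyps in auto)
    hence "map_poly of_Zp (pCons (s * b) (smult c P)) = smult (of_Zp (s * c)) (map_poly to_ac (pCons a p))"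
      using Ps bc by (simp add: of_Zp.hom_mult of_Zp.map_poly_hom_smult of_Zp.map_poly_pCons_hom mult.commute)
    thus ?case using Ps bc by (intro exI[of _ "pCons (s * b) (smult c P)"] exI[of _ "s * c"]) simp
  qed
  then obtain P s where Ps: "s \<noteq> 0" "map_poly of_Zp P = smult (of_Zp s) (map_poly to_ac p)" by blast
  have "map_poly to_ac p \<noteq> 0" using p(1) by (subst map_poly_eq_0_iff) auto
  hence "P \<noteq> 0" using Ps by auto
  moreover have "ev P x = 0" using Ps p by (simp add: ev_def)
  ultimately show ?thesis by blast
qed

text \<open>The degree over Q_p: clearing denominators turns annihilators over Q_p into annihilators
  over Z_p of the same degree.\<close>

definition adeg :: "'p::prime_card padic alg_closure \<Rightarrow> nat" where
  "adeg x = (LEAST d. \<exists>P. P \<noteq> 0 \<and> degree P = d \<and> ev P x = 0)"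

lemma adeg_le: "P \<noteq> 0 \<Longrightarrow> ev P x = 0 \<Longrightarrow> adeg x \<le> degree P"
  unfolding adeg_def by (rule Least_le) blast

lemma ev_eq_0_imp: "ev P x = 0 \<Longrightarrow> degree P < adeg x \<Longrightarrow> P = 0"
  using adeg_le[of P x] by fastforce

lemma adeg_le_iff: "adeg x \<le> d \<longleftrightarrow> (\<exists>P. P \<noteq> 0 \<and> degree P \<le> d \<and> ev P x = 0)"
proof
  assume *: "adeg x \<le> d"
  have "\<exists>P. P \<noteq> 0 \<and> degree P = adeg x \<and> ev P x = 0"
    unfolding adeg_def by (rule LeastI_ex) (use ex_annihilator[of x] in blast)
  thus "\<exists>P. P \<noteq> 0 \<and> degree P \<le> d \<and> ev P x = 0" using * by auto
qed (use adeg_le le_trans in blast)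

lemma adeg_pos: "adeg x > 0"
proof (rule ccontr)
  assume "\<not> adeg x > 0"
  then obtain P where "P \<noteq> 0" "degree P = 0" "ev P x = 0" using adeg_le_iff[of x 0] by auto
  thus False by (auto elim!: degree_eq_zeroE)
qed

text \<open>A primitive polynomial over Z_p replaces the monic minimal polynomial over Q_p, because
  \<open>x\<close> need not be integral.\<close>

lemma ex_primitive_annihilator:
  obtains G where "red_poly G \<noteq> 0" "degree G = adeg x" "ev G x = 0"
proof -
  obtain P where P: "P \<noteq> 0" "degree P \<le> adeg x" "ev P x = 0" using adeg_le_iff[of x "adeg x"] by auto
  obtain k G where G: "P = smult (unif ^ k) G" "red_poly G \<noteq> 0"
    using poly_unif_power_decompose[OF P(1)] by blast
  have "degree G \<le> adeg x" "ev G x = 0" using P G by simp_all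
  moreover have "adeg x \<le> degree G" using G calculation(2) by (intro adeg_le) auto
  ultimately show thesis using that G by simp
qed

text \<open>Gauss's lemma enters through the fact that products of primitive polynomials are primitive.\<close>

lemma primitive_annihilator_dvd:
  fixes P :: "'p::prime_card padic_int poly"
  assumes G: "red_poly G \<noteq> 0" "degree G = adeg x" "ev G x = 0" and P: "ev P x = 0"
  shows "G dvd P"
proof (cases "P = 0")
  case False
  have G0: "G \<noteq> 0" using G by auto
  \<comment> \<open>Pseudo-division, since \<open>G\<close> need not be monic. The factor
    \<open>a\<close> is removed afterwards by comparing primitive parts: its power of
    \<open>unif\<close> goes into the contents and its unit part is inverted.\<close>
  obtain a Q where aQ: "a \<noteq> 0" "smult a P = G * Q + pseudo_mod P G" using pseudo_mod(1)[OF G0] by blast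
  have "ev (smult a P) x = ev (G * Q + pseudo_mod P G) x" using aQ(2) by (rule arg_cong)
  hence "ev (pseudo_mod P G) x = 0" using P G(3) by simp
  hence "pseudo_mod P G = 0"
    using pseudo_mod(2)[OF G0, of P] ev_eq_0_imp[of "pseudo_mod P G" x] G(2) by auto
  hence eq: "smult a P = G * Q" using aQ by simp
  hence "Q \<noteq> 0" using aQ(1) False by auto
  obtain i u where u: "a = unif ^ i * u" "red u \<noteq> 0" using padic_int_decompose[OF aQ(1)] .
  obtain j P0 where P0: "P = smult (unif ^ j) P0" "red_poly P0 \<noteq> 0" using poly_unif_power_decompose[OF False] .
  obtain k Q0 where Q0: "Q = smult (unif ^ k) Q0" "red_poly Q0 \<noteq> 0" using poly_unif_power_decompose[OF \<open>Q \<noteq> 0\<close>] .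
  have "smult (unif ^ (i + j)) (smult u P0) = smult (unif ^ k) (G * Q0)"
    using eq u P0 Q0 by (simp add: power_add mult_ac)
  moreover have "red_poly (smult u P0) \<noteq> 0" "red_poly (G * Q0) \<noteq> 0"
    using u P0 Q0 G by (simp_all add: red_poly_smult redp.hom_mult)
  ultimately have "smult u P0 = G * Q0" using primitive_smult_eq by blast
  moreover obtain v where "1 = u * v" using dvd_1_if_red_nonzero[OF u(2)] by (elim dvdE)
  ultimately have "P0 = G * smult v Q0"
    by (metis mult.commute mult_smult_right smult_1_left smult_smult)
  thus ?thesis using P0 by (simp add: dvd_smult)
qed simp

lemma adeg_root_irreducible:
  assumes "padic_irreducible P" "ev P x = 0"
  shows "adeg x = degree P"
proof -
  obtain G where G: "red_poly G \<noteq> 0" "degree G = adeg x" "ev G x = 0" by (rule ex_primitive_annihilator)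
  then obtain Q where Q: "P = G * Q" using primitive_annihilator_dvd assms by (metis dvdE)
  have "\<forall>A B. P = A * B \<longrightarrow> degree A = 0 \<or> degree B = 0"
    using assms(1) unfolding padic_irreducible_def by (elim conjE)
  hence "degree G = 0 \<or> degree Q = 0" by (elim allE impE) (rule Q)
  hence "degree Q = 0" using G(2) adeg_pos[of x] by simp
  moreover have "P \<noteq> 0" using assms(1) by (auto simp: padic_irreducible_def)
  ultimately show ?thesis using Q G by (auto simp: degree_mult_eq)
qed

section \<open>Root multisets and the number of roots of low degree\<close>

definition zeros :: "'p::prime_card padic_int poly \<Rightarrow> 'p padic alg_closure multiset" where
  "zeros P = proots (map_poly of_Zp P)"

lemma set_zeros: "P \<noteq> 0 \<Longrightarrow> set_mset (zeros P) = {x. ev P x = 0}"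
  by (simp add: zeros_def ev_def)

lemma zeros_mult: "P \<noteq> 0 \<Longrightarrow> Q \<noteq> 0 \<Longrightarrow> zeros (P * Q) = zeros P + zeros Q"
  by (simp add: zeros_def of_Zp_poly.hom_mult proots_mult)

lemma size_zeros:
  assumes "P \<noteq> 0"
  shows "size (zeros P) = degree P"
proof -
  let ?p = "map_poly of_Zp P"
  have p: "?p \<noteq> 0" using assms by simp
  obtain A where A: "size A = degree ?p" "?p = smult (lead_coeff ?p) (\<Prod>x\<in>#A. [:- x, 1:])"
    using alg_closed_imp_factorization[OF p] by blast
  have "proots ?p = proots (\<Prod>x\<in>#A. [:- x, 1:])"
    using p by (subst A(2)) (simp del: of_Zp.hom_lead_coeff)
  also have "\<dots> = A"
  proof (induction A)
    case (add x A)
    moreover have "(\<Prod>x\<in>#A. [:- x, 1:]) \<noteq> 0" by auto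
    ultimately show ?case by (simp add: proots_mult del: mult_pCons_left)
  qed simp
  finally show ?thesis using A by (simp add: zeros_def)
qed

definition low_zeros :: "nat \<Rightarrow> 'p::prime_card padic_int poly \<Rightarrow> nat" where
  "low_zeros r P = size (filter_mset (\<lambda>x. adeg x \<le> r) (zeros P))"

lemma low_zeros_mult:
  "P \<noteq> 0 \<Longrightarrow> Q \<noteq> 0 \<Longrightarrow> low_zeros r (P * Q) = low_zeros r P + low_zeros r Q"
  by (simp add: low_zeros_def zeros_mult)

lemma low_zeros_le_degree: "P \<noteq> 0 \<Longrightarrow> low_zeros r P \<le> degree P"
  unfolding low_zeros_def using size_filter_mset_lesseq[of _ "zeros P"] size_zeros[of P] by metis

lemma low_zeros_irreducible:
  assumes "padic_irreducible P"
  shows "low_zeros r P = (if degree P \<le> r then degree P else 0)"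
proof -
  have P: "P \<noteq> 0" using assms by (auto simp: padic_irreducible_def)
  have "adeg x = degree P" if "x \<in># zeros P" for x
    using that adeg_root_irreducible[OF assms] set_zeros[OF P] by auto
  hence "filter_mset (\<lambda>x. adeg x \<le> r) (zeros P) = filter_mset (\<lambda>x. degree P \<le> r) (zeros P)"
    by (intro filter_mset_cong) auto
  thus ?thesis by (simp add: low_zeros_def size_zeros[OF P])
qed

lemma multiplicity_red_poly_mult:
  assumes "red_poly A \<noteq> 0" "red_poly B \<noteq> 0" "prime f"
  shows "multiplicity f (red_poly (A * B)) = multiplicity f (red_poly A) + multiplicity f (red_poly B)"
  unfolding redp.hom_mult using assms by (intro prime_elem_multiplicity_mult_distrib) auto

text \<open>
  By Hensel, the roots of \<open>P\<close> fall into blocks, one of size \<open>degree f * multiplicity f (red_poly P)\<close> for each prime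
  \<open>f\<close> and one of size \<open>degree P - degree (red_poly P)\<close> for the roots reducing to infinity. In the block of
  \<open>f\<close> all roots have degree at least \<open>degree f\<close> and at most the size of the block.
\<close>

lemma low_zeros_upper:
  fixes P :: "'p::prime_card padic_int poly"
  assumes "red_poly P \<noteq> 0"
  shows "low_zeros r P \<le> (\<Sum>f\<in>primes_upto_degree r. degree f * multiplicity f (red_poly P))
           + (degree P - degree (red_poly P))"
  using assms
proof (induction P rule: padic_poly_factor_induct)
  case (const P)
  moreover have "P \<noteq> 0" using const by auto
  ultimately show ?case using low_zeros_le_degree[of P r] by simp
next
  case (irreducible P)
  show ?case
  proof (cases "degree P \<le> r \<and> degree (red_poly P) > 0")
    case True
    then obtain f where f: "prime f" "degree f * multiplicity f (red_poly P) = degree P"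
      using padic_irreducible_reduction[OF irreducible] by metis
    have "degree P > 0" using irreducible by (simp add: padic_irreducible_def)
    hence "multiplicity f (red_poly P) > 0" using f(2) by (metis gr0I mult_0_right)
    hence "degree f \<le> degree f * multiplicity f (red_poly P)" by simp
    hence "f \<in> primes_upto_degree r" using f True by (simp add: primes_upto_degree_def)
    hence "degree f * multiplicity f (red_poly P) \<le> (\<Sum>f\<in>primes_upto_degree r. degree f * multiplicity f (red_poly P))"
      by (intro member_le_sum) auto
    thus ?thesis using low_zeros_irreducible[OF irreducible, of r] f(2) True by simp
  qed (auto simp: low_zeros_irreducible[OF irreducible])
next
  case (mult A B)
  have nz: "A \<noteq> 0" "B \<noteq> 0" using mult.hyps by auto
  have "(\<Sum>f\<in>primes_upto_degree r. degree f * multiplicity f (red_poly (A * B))) =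
      (\<Sum>f\<in>primes_upto_degree r. degree f * multiplicity f (red_poly A)) +
      (\<Sum>f\<in>primes_upto_degree r. degree f * multiplicity f (red_poly B))"
    unfolding sum.distrib[symmetric]
    by (intro sum.cong refl) (simp add: multiplicity_red_poly_mult mult.hyps primes_upto_degree_def algebra_simps)
  moreover have "degree (A * B) - degree (red_poly (A * B)) =
      (degree A - degree (red_poly A)) + (degree B - degree (red_poly B))"
    using nz mult.hyps degree_red_poly_le[of A] degree_red_poly_le[of B]
    by (simp add: degree_mult_eq redp.hom_mult)
  ultimately show ?case using mult.IH low_zeros_mult[OF nz, of r] by simp
qed

text \<open>\<open>\<phi>\<close> retains the sizes of the blocks larger than \<open>r\<close>; a
  root of degree above \<open>r\<close> must lie in one of them. Multiplying polynomials adds block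
  sizes, and \<open>\<phi>\<close> is superadditive, so the inequality passes to products.\<close>

lemma low_zeros_lower:
  fixes P :: "'p::prime_card padic_int poly" and r n :: nat
  defines "\<phi> \<equiv> \<lambda>k. if k \<le> r then 0 else k"
  assumes "red_poly P \<noteq> 0" "degree P \<le> n"
  shows "degree P \<le> low_zeros r P + (\<Sum>f\<in>primes_upto_degree n. \<phi> (degree f * multiplicity f (red_poly P)))
           + \<phi> (degree P - degree (red_poly P))"
  using assms(2,3)
proof (induction P rule: padic_poly_factor_induct)
  case (irreducible P)
  show ?case
  proof (cases "degree P \<le> r")
    case False
    show ?thesis
    proof (cases "degree (red_poly P) > 0")
      case True
      then obtain f where f: "prime f" "degree f * multiplicity f (red_poly P) = degree P"
        using padic_irreducible_reduction[OF irreducible(1)] by metis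
      have "multiplicity f (red_poly P) > 0" using f(2) False by (metis gr0I mult_0_right le0)
      hence "degree f \<le> degree f * multiplicity f (red_poly P)" by simp
      hence "f \<in> primes_upto_degree n" using f irreducible(2) by (simp add: primes_upto_degree_def)
      hence "\<phi> (degree f * multiplicity f (red_poly P)) \<le>
          (\<Sum>f\<in>primes_upto_degree n. \<phi> (degree f * multiplicity f (red_poly P)))"
        by (intro member_le_sum) auto
      thus ?thesis using f False by (simp add: \<phi>_def)
    qed (use False in \<open>simp add: \<phi>_def\<close>)
  qed (simp add: low_zeros_irreducible irreducible)
next
  case (mult A B)
  have super: "\<phi> a + \<phi> b \<le> \<phi> (a + b)" for a b by (simp add: \<phi>_def)
  have nz: "A \<noteq> 0" "B \<noteq> 0" using mult.hyps by auto
  hence deg: "degree (A * B) = degree A + degree B" by (simp add: degree_mult_eq)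
  have "(\<Sum>f\<in>primes_upto_degree n. \<phi> (degree f * multiplicity f (red_poly A))) +
      (\<Sum>f\<in>primes_upto_degree n. \<phi> (degree f * multiplicity f (red_poly B))) \<le>
      (\<Sum>f\<in>primes_upto_degree n. \<phi> (degree f * multiplicity f (red_poly (A * B))))"
    unfolding sum.distrib[symmetric]
    by (intro sum_mono order_trans[OF super] eq_refl arg_cong[of _ _ \<phi>])
       (simp add: multiplicity_red_poly_mult mult.hyps primes_upto_degree_def algebra_simps)
  moreover have "degree (A * B) - degree (red_poly (A * B)) =
      (degree A - degree (red_poly A)) + (degree B - degree (red_poly B))"
    using nz mult.hyps degree_red_poly_le[of A] degree_red_poly_le[of B]
    by (simp add: degree_mult_eq redp.hom_mult)
  hence "\<phi> (degree A - degree (red_poly A)) + \<phi> (degree B - degree (red_poly B)) \<le>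
      \<phi> (degree (A * B) - degree (red_poly (A * B)))" using super by simp
  ultimately show ?case using mult.IH mult.prems low_zeros_mult[OF nz, of r] deg by simp
qed simp

section \<open>Simple extensions\<close>

lemma Qp_bar_simps [simp]:
  "carrier Qp_bar = UNIV" "x \<oplus>\<^bsub>Qp_bar\<^esub> y = x + y" "x \<otimes>\<^bsub>Qp_bar\<^esub> y = x * y"
  "\<zero>\<^bsub>Qp_bar\<^esub> = 0" "\<one>\<^bsub>Qp_bar\<^esub> = 1"
  by (simp_all add: ring_of_type_algebra_def)

interpretation Qp_bar: cring "Qp_bar :: 'p::prime_card padic alg_closure ring"
  by (rule cring_from_type_algebra)

lemma Qp_bar_uminus [simp]: "\<ominus>\<^bsub>Qp_bar\<^esub> x = - (x :: 'p::prime_card padic alg_closure)"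
proof -
  have "x + \<ominus>\<^bsub>Qp_bar\<^esub> x = 0" using Qp_bar.r_neg[of x] by simp
  thus ?thesis by (simp add: add_eq_0_iff)
qed

lemma Qp_bar_inverse: "x \<noteq> 0 \<Longrightarrow> inv\<^bsub>Qp_bar\<^esub> x = inverse (x :: 'p::prime_card padic alg_closure)"
  by (rule Qp_bar.comm_inv_char) simp_all

text \<open>With \<open>inverse 0 = 0\<close>, closure under inverses needs no exception for
  zero.\<close>

definition closed_field :: "'p::prime_card padic alg_closure set \<Rightarrow> bool" where
  "closed_field K \<longleftrightarrow> Qp \<subseteq> K \<and> (\<forall>x\<in>K. \<forall>y\<in>K. x + y \<in> K \<and> x * y \<in> K) \<and>
     (\<forall>x\<in>K. - x \<in> K \<and> inverse x \<in> K)"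

lemma Qp_0_1 [simp]: "0 \<in> Qp" "1 \<in> Qp"
  by (metis rangeI to_ac_0, metis rangeI to_ac_1)

lemma subfield_iff_closed:
  assumes "0 \<in> K" "1 \<in> K"
  shows "subfield K (Qp_bar :: 'p::prime_card padic alg_closure ring) \<longleftrightarrow>
    (\<forall>x\<in>K. \<forall>y\<in>K. x + y \<in> K \<and> x * y \<in> K) \<and> (\<forall>x\<in>K. - x \<in> K \<and> inverse x \<in> K)"
    (is "_ \<longleftrightarrow> ?R")
proof
  assume K: "subfield K Qp_bar"
  have sr: "subring K Qp_bar" by (rule subfieldE(1)[OF K])
  show ?R
  proof (intro conjI ballI)
    fix x y assume "x \<in> K" "y \<in> K"
    thus "x + y \<in> K" "x * y \<in> K" using subringE(6,7)[OF sr] by simp_all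
  next
    fix x assume x: "x \<in> K"
    show "- x \<in> K" using subringE(5)[OF sr x] by simp
    show "inverse x \<in> K"
      using Qp_bar.subfield_m_inv(1)[OF K, of x] x assms(1) by (cases "x = 0") (auto simp: Qp_bar_inverse)
  qed
next
  assume R: ?R
  show "subfield K Qp_bar"
  proof (rule field.subfieldI'[OF field_from_type_algebra])
    show "subring K Qp_bar" by (rule Qp_bar.subringI) (use R assms in auto)
    show "inv\<^bsub>Qp_bar\<^esub> k \<in> K" if "k \<in> K - {\<zero>\<^bsub>Qp_bar\<^esub>}" for k
      using that R by (simp add: Qp_bar_inverse)
  qed
qed

lemma extension_iff_closed_field: "extension K \<longleftrightarrow> closed_field K"
proof (cases "Qp \<subseteq> K")
  case True
  hence "0 \<in> K" "1 \<in> K" using Qp_0_1 by blast+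
  thus ?thesis using subfield_iff_closed[of K] True by (simp add: extension_def closed_field_def)
qed (simp add: extension_def closed_field_def)

lemma subfield_Qp: "subfield Qp (Qp_bar :: 'p::prime_card padic alg_closure ring)"
proof -
  have "x + y \<in> Qp \<and> x * y \<in> Qp" "- x \<in> Qp \<and> inverse x \<in> Qp"
    if "x \<in> Qp" "y \<in> Qp" for x y :: "'p padic alg_closure"
    using that by (auto simp flip: to_ac_add to_ac_mult to_ac_minus to_ac_inverse)
  thus ?thesis by (subst subfield_iff_closed) auto
qed

lemma closed_fieldD:
  assumes "closed_field K"
  shows "q \<in> Qp \<Longrightarrow> q \<in> K" "x \<in> K \<Longrightarrow> y \<in> K \<Longrightarrow> x + y \<in> K" "x \<in> K \<Longrightarrow> y \<in> K \<Longrightarrow> x * y \<in> K"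
    "x \<in> K \<Longrightarrow> - x \<in> K" "x \<in> K \<Longrightarrow> inverse x \<in> K" "of_Zp c \<in> K"
    "x \<in> K \<Longrightarrow> y \<in> K \<Longrightarrow> x - y \<in> K" "x \<in> K \<Longrightarrow> y \<in> K \<Longrightarrow> x / y \<in> K"
proof -
  show *: "q \<in> Qp \<Longrightarrow> q \<in> K" "x \<in> K \<Longrightarrow> y \<in> K \<Longrightarrow> x + y \<in> K" "x \<in> K \<Longrightarrow> y \<in> K \<Longrightarrow> x * y \<in> K"
    "x \<in> K \<Longrightarrow> - x \<in> K" "x \<in> K \<Longrightarrow> inverse x \<in> K" for q x y
    using assms unfolding closed_field_def by blast+
  show "of_Zp c \<in> K" by (rule *(1)) (simp add: of_Zp_def)
  show "x \<in> K \<Longrightarrow> y \<in> K \<Longrightarrow> x - y \<in> K" using *(2)[of x "- y"] *(4)[of y] by simp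
  show "x \<in> K \<Longrightarrow> y \<in> K \<Longrightarrow> x / y \<in> K" using *(3)[of x "inverse y"] *(5)[of y] by (simp add: divide_inverse)
qed

lemma ev_in_closed_field: "closed_field K \<Longrightarrow> x \<in> K \<Longrightarrow> ev A x \<in> K"
proof (induction A)
  case 0
  thus ?case using closed_fieldD(6)[of K 0] by simp
next
  case (pCons a A)
  thus ?case using closed_fieldD(2,3,6)[of K] by simp
qed

text \<open>Q_p[x], with all coefficients brought to one denominator in Z_p. It is the field Q_p(x),
  since \<open>x\<close> is algebraic.\<close>

definition adjoin :: "'p::prime_card padic alg_closure \<Rightarrow> 'p padic alg_closure set" where
  "adjoin x = {ev A x / of_Zp s | A s. s \<noteq> 0}"

lemma adjoinI: "s \<noteq> 0 \<Longrightarrow> y = ev A x / of_Zp s \<Longrightarrow> y \<in> adjoin x"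
  unfolding adjoin_def by blast

lemma adjoinE:
  assumes "y \<in> adjoin x"
  obtains A s where "s \<noteq> 0" "y = ev A x / of_Zp s"
  using assms unfolding adjoin_def by blast

lemma ev_in_adjoin: "ev A x \<in> adjoin x"
  by (rule adjoinI[of 1 _ A]) simp_all

lemma self_in_adjoin: "x \<in> adjoin x"
  using ev_in_adjoin[of "[:0, 1:]" x] by simp

text \<open>An annihilator \<open>c + X * H\<close> of \<open>z\<close> of minimal degree has
  \<open>c\<close> nonzero, as otherwise \<open>H\<close> would annihilate \<open>z\<close>; hence
  \<open>- ev H z / of_Zp c\<close> is the inverse of \<open>z\<close>.\<close>

lemma inverse_in_adjoin:
  fixes x :: "'p::prime_card padic alg_closure"
  assumes "y \<in> adjoin x"
  shows "inverse y \<in> adjoin x"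
proof (cases "y = 0")
  case True
  thus ?thesis using ev_in_adjoin[of 0 x] by simp
next
  case False
  obtain A s where As: "s \<noteq> 0" "y = ev A x / of_Zp s" using assms by (rule adjoinE)
  define z where "z = ev A x"
  obtain G where G: "red_poly G \<noteq> 0" "degree G = adeg z" "ev G z = 0" by (rule ex_primitive_annihilator)
  obtain c H where cH: "G = pCons c H" by (rule pCons_cases)
  have z: "z \<noteq> 0" using As False by (auto simp: z_def)
  have "c \<noteq> 0"
  proof
    assume "c = 0"
    hence "ev H z = 0" using G cH z by simp
    moreover have "H \<noteq> 0" using G(1) cH \<open>c = 0\<close> by auto
    hence "degree H < adeg z" using G(2) cH by simp
    ultimately show False using ev_eq_0_imp \<open>H \<noteq> 0\<close> by blast
  qed
  have "of_Zp c + z * ev H z = 0" using G(3) cH by simp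
  hence "z * (- ev H z / of_Zp c) = 1" using \<open>c \<noteq> 0\<close> by (simp add: field_simps add_eq_0_iff)
  hence "inverse z = - ev H z / of_Zp c" by (rule inverse_unique)
  hence "inverse y = ev (smult (- s) (pcompose H A)) x / of_Zp c"
    using As by (simp add: z_def ev_pcompose divide_inverse of_Zp.hom_uminus mult_ac)
  thus ?thesis by (rule adjoinI[OF \<open>c \<noteq> 0\<close>])
qed

lemma closed_field_adjoin:
  fixes x :: "'p::prime_card padic alg_closure"
  shows "closed_field (adjoin x)"
  unfolding closed_field_def
proof (intro conjI ballI)
  have "to_ac q \<in> adjoin x" for q
  proof -
    obtain b c where "c \<noteq> 0" "to_ac q = of_Zp b / of_Zp c" by (rule fract_cases_padic)
    thus ?thesis by (intro adjoinI[of c _ "[:b:]"]) simp_all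
  qed
  thus "Qp \<subseteq> adjoin x" by blast
next
  fix y z assume "y \<in> adjoin x" "z \<in> adjoin x"
  then obtain A s B t where *: "s \<noteq> 0" "y = ev A x / of_Zp s" "t \<noteq> 0" "z = ev B x / of_Zp t"
    by (elim adjoinE)
  show "y + z \<in> adjoin x"
    by (rule adjoinI[of "s * t" _ "smult t A + smult s B"]) (use * in \<open>simp_all add: of_Zp.hom_mult field_simps\<close>)
  show "y * z \<in> adjoin x"
    by (rule adjoinI[of "s * t" _ "A * B"]) (use * in \<open>simp_all add: of_Zp.hom_mult\<close>)
next
  fix y assume y: "y \<in> adjoin x"
  then obtain A s where *: "s \<noteq> 0" "y = ev A x / of_Zp s" by (rule adjoinE)
  show "- y \<in> adjoin x" by (rule adjoinI[of s _ "- A"]) (use * in simp_all)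
  show "inverse y \<in> adjoin x" by (rule inverse_in_adjoin[OF y])
qed

lemma adjoin_least: "closed_field K \<Longrightarrow> x \<in> K \<Longrightarrow> adjoin x \<subseteq> K"
  by (auto elim!: adjoinE intro: closed_fieldD ev_in_closed_field)

text \<open>\<open>adjoin x\<close> is the least extension containing \<open>x\<close>, so being new
  in \<open>K\<close> means generating \<open>K\<close>. Each \<open>x\<close> is therefore new in
  exactly one field.\<close>

lemma new_elements_eq:
  assumes "extension K"
  shows "new_elements K = {x. adjoin x = K}"
proof (rule equalityI; rule subsetI)
  fix x assume x: "x \<in> new_elements K"
  hence "adjoin x \<subseteq> K" using adjoin_least assms by (auto simp: new_elements_def extension_iff_closed_field)
  moreover have "extension (adjoin x)" by (simp add: extension_iff_closed_field closed_field_adjoin)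
  ultimately show "x \<in> {x. adjoin x = K}" using x self_in_adjoin[of x] by (auto simp: new_elements_def)
next
  fix x assume "x \<in> {x. adjoin x = K}"
  hence x: "adjoin x = K" by simp
  have "x \<notin> L" if "extension L" "L \<subset> K" for L
    using adjoin_least[of L x] that x by (auto simp: extension_iff_closed_field)
  thus "x \<in> new_elements K" using self_in_adjoin[of x] x by (auto simp: new_elements_def)
qed

lemma ex_reduced_representative:
  assumes "y \<in> adjoin x"
  obtains A s where "s \<noteq> 0" "y = ev A x / of_Zp s" "A \<in> polys_below (adeg x)"
proof -
  obtain A s where As: "s \<noteq> 0" "y = ev A x / of_Zp s" using assms by (rule adjoinE)
  obtain G where G: "red_poly G \<noteq> 0" "degree G = adeg x" "ev G x = 0" by (rule ex_primitive_annihilator)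
  hence G0: "G \<noteq> 0" by auto
  obtain a Q where aQ: "a \<noteq> 0" "smult a A = G * Q + pseudo_mod A G" using pseudo_mod(1)[OF G0] by blast
  have "ev (smult a A) x = ev (G * Q + pseudo_mod A G) x" using aQ(2) by (rule arg_cong)
  hence "ev (pseudo_mod A G) x = of_Zp a * ev A x" using G(3) by simp
  hence "y = ev (pseudo_mod A G) x / of_Zp (s * a)" using As aQ(1) by (simp add: of_Zp.hom_mult)
  moreover have "pseudo_mod A G \<in> polys_below (adeg x)"
    using pseudo_mod(2)[OF G0, of A] G(2) by (auto simp: polys_below_iff_degree)
  ultimately show thesis using that[of "s * a"] As(1) aQ(1) by simp
qed

lemma common_denominator:
  fixes k :: "nat \<Rightarrow> 'p::prime_card padic alg_closure"
  assumes "\<And>i. i < d \<Longrightarrow> k i \<in> Qp"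
  shows "\<exists>s A. s \<noteq> 0 \<and> A \<in> polys_below d \<and> (\<forall>i<d. k i = of_Zp (coeff A i) / of_Zp s)"
  using assms
proof (induction d)
  case 0
  show ?case by (intro exI[of _ 1] exI[of _ 0]) simp
next
  case (Suc d)
  then obtain s A where sA: "s \<noteq> 0" "A \<in> polys_below d" "\<forall>i<d. k i = of_Zp (coeff A i) / of_Zp s"
    by (meson less_SucI)
  obtain q where "k d = to_ac q" using Suc.prems[of d] by blast
  then obtain b c where bc: "c \<noteq> 0" "k d = of_Zp b / of_Zp c" using fract_cases_padic[of q] by metis
  have "smult c A + monom (s * b) d \<in> polys_below (Suc d)" using sA(2) by (auto simp: polys_below_def)
  moreover have "k i = of_Zp (coeff (smult c A + monom (s * b) d) i) / of_Zp (s * c)" if "i < Suc d" for i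
    using that sA bc by (cases "i = d") (auto simp: of_Zp.hom_mult polys_below_def field_simps)
  ultimately show ?case using sA(1) bc(1) by (intro exI[of _ "s * c"]) auto
qed

lemma ev_polys_below: "A \<in> polys_below d \<Longrightarrow> ev A x = (\<Sum>i<d. of_Zp (coeff A i) * x ^ i)"
proof -
  assume A: "A \<in> polys_below d"
  have "A = (\<Sum>i<d. monom (coeff A i) i)"
    using A by (intro poly_eqI) (auto simp: coeff_sum polys_below_def)
  thus ?thesis by (metis (no_types, lifting) ev_sum ev_monom sum.cong)
qed

text \<open>The basis of Q_p(x) that identifies \<open>adeg x\<close> with the dimension used in
  \<open>finite_extensions_upto\<close>.\<close>

definition power_list :: "'p::prime_card padic alg_closure \<Rightarrow> 'p padic alg_closure list" where
  "power_list x = map (\<lambda>i. x ^ i) [0..<adeg x]"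

lemma length_power_list [simp]: "length (power_list x) = adeg x"
  by (simp add: power_list_def)

lemma combine_eq_sum:
  "Qp_bar.combine Ks Us = (\<Sum>i<min (length Ks) (length Us). Ks ! i * Us ! i)"
proof (induction Ks Us rule: Qp_bar.combine.induct)
  case (1 k Ks u Us)
  thus ?case by (simp add: sum.lessThan_Suc_shift del: sum.lessThan_Suc)
qed auto

lemma combine_power_list:
  assumes "set Ks \<subseteq> Qp" "length Ks = adeg x"
  obtains s A where "s \<noteq> 0" "A \<in> polys_below (adeg x)" "Qp_bar.combine Ks (power_list x) = ev A x / of_Zp s"
    "\<And>i. i < adeg x \<Longrightarrow> Ks ! i = of_Zp (coeff A i) / of_Zp s"
proof -
  have "Ks ! i \<in> Qp" if "i < adeg x" for i using assms that nth_mem by (metis subsetD)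
  then obtain s A where sA: "s \<noteq> 0" "A \<in> polys_below (adeg x)" "\<forall>i<adeg x. Ks ! i = of_Zp (coeff A i) / of_Zp s"
    using common_denominator[of "adeg x" "\<lambda>i. Ks ! i"] by blast
  have "Qp_bar.combine Ks (power_list x) = (\<Sum>i<adeg x. of_Zp (coeff A i) / of_Zp s * x ^ i)"
    unfolding combine_eq_sum using assms(2) sA(3) by (auto intro!: sum.cong simp: power_list_def)
  also have "\<dots> = ev A x / of_Zp s" by (simp add: ev_polys_below[OF sA(2)] sum_divide_distrib)
  finally show thesis using that sA by blast
qed

lemma independent_power_list: "Qp_bar.independent Qp (power_list x)"
proof (rule Qp_bar.trivial_combine_imp_independent[OF subfield_Qp])
  fix Ks :: "'a padic alg_closure list" assume Ks: "set Ks \<subseteq> Qp" "Qp_bar.combine Ks (power_list x) = \<zero>\<^bsub>Qp_bar\<^esub>"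
  \<comment> \<open>\<open>combine\<close> stops at the end of the shorter list, so cutting or
    padding with zeros to length \<open>adeg x\<close> does not change its value.\<close>
  define Ls where "Ls = take (adeg x) Ks @ replicate (adeg x - length Ks) 0"
  have Ls: "set Ls \<subseteq> Qp" "length Ls = adeg x"
    using Ks(1) Qp_0_1(1) set_take_subset[of "adeg x" Ks] by (auto simp: Ls_def set_replicate_conv_if)
  have "Qp_bar.combine Ls (power_list x) = Qp_bar.combine Ks (power_list x)"
    unfolding combine_eq_sum Ls(2) length_power_list
    by (rule sum.mono_neutral_cong_right) (auto simp: Ls_def nth_append)
  hence "Qp_bar.combine Ls (power_list x) = 0" using Ks(2) by simp
  moreover obtain s A where sA: "s \<noteq> 0" "A \<in> polys_below (adeg x)" "Qp_bar.combine Ls (power_list x) = ev A x / of_Zp s"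
    "\<And>i. i < adeg x \<Longrightarrow> Ls ! i = of_Zp (coeff A i) / of_Zp s"
    using combine_power_list[OF Ls] by blast
  ultimately have "ev A x = 0" by simp
  hence "A = 0" using sA(2) ev_eq_0_imp[of A x] by (auto simp: polys_below_iff_degree)
  hence "Ls ! i = 0" if "i < adeg x" for i using sA(4)[OF that] by simp
  hence "set Ls \<subseteq> {0}" using Ls(2) by (auto simp: in_set_conv_nth)
  thus "set (take (length (power_list x)) Ks) \<subseteq> {\<zero>\<^bsub>Qp_bar\<^esub>}" by (simp add: Ls_def)
qed simp

lemma Span_power_list: "Qp_bar.Span Qp (power_list x) = adjoin x"
proof -
  have "Qp_bar.Span Qp (power_list x) =
      {Qp_bar.combine Ks (power_list x) | Ks. length Ks = length (power_list x) \<and> set Ks \<subseteq> Qp}"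
    by (rule Qp_bar.Span_eq_combine_set_length_version[OF subfield_Qp]) simp
  also have "\<dots> = adjoin x"
  proof (intro equalityI subsetI)
    fix y assume "y \<in> {Qp_bar.combine Ks (power_list x) | Ks. length Ks = length (power_list x) \<and> set Ks \<subseteq> Qp}"
    then obtain Ks where Ks: "set Ks \<subseteq> Qp" "length Ks = adeg x" "y = Qp_bar.combine Ks (power_list x)" by auto
    obtain s A where "s \<noteq> 0" "y = ev A x / of_Zp s" using combine_power_list[OF Ks(1,2)] Ks(3) by metis
    thus "y \<in> adjoin x" by (rule adjoinI)
  next
    fix y assume "y \<in> adjoin x"
    then obtain A s where As: "s \<noteq> 0" "y = ev A x / of_Zp s" "A \<in> polys_below (adeg x)"
      by (rule ex_reduced_representative)
    define Ks where "Ks = map (\<lambda>i. of_Zp (coeff A i) / of_Zp s) [0..<adeg x]"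
    have "Qp_bar.combine Ks (power_list x) = (\<Sum>i<adeg x. of_Zp (coeff A i) / of_Zp s * x ^ i)"
      unfolding combine_eq_sum by (auto intro!: sum.cong simp: power_list_def Ks_def)
    also have "\<dots> = y" by (simp add: ev_polys_below[OF As(3)] As(2) sum_divide_distrib)
    finally have "y = Qp_bar.combine Ks (power_list x)" ..
    moreover have "set Ks \<subseteq> Qp" by (auto simp: Ks_def of_Zp_quotient_in_Qp simp del: range_eqI)
    moreover have "length Ks = length (power_list x)" by (simp add: Ks_def)
    ultimately show "y \<in> {Qp_bar.combine Ks (power_list x) | Ks. length Ks = length (power_list x) \<and> set Ks \<subseteq> Qp}"
      by blast
  qed
  finally show ?thesis .
qed

lemma dimension_adjoin: "Qp_bar.dimension (adeg x) Qp (adjoin x)"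
  using Qp_bar.dimension_independent[OF independent_power_list, of x] unfolding Span_power_list by simp

text \<open>The first \<open>adeg y\<close> powers of \<open>y\<close> are independent in a space of
  dimension \<open>adeg x\<close>, so under the inequality they span it.\<close>

lemma adjoin_eqI:
  assumes "y \<in> adjoin x" "adeg x \<le> adeg y"
  shows "adjoin y = adjoin x"
proof -
  have sub: "adjoin y \<subseteq> adjoin x" by (rule adjoin_least[OF closed_field_adjoin assms(1)])
  have "y ^ i \<in> adjoin y" for i using ev_in_adjoin[of "monom 1 i" y] by simp
  hence pl: "set (power_list y) \<subseteq> adjoin x" using sub by (auto simp: power_list_def)
  have "adeg y \<le> adeg x"
    using Qp_bar.independent_length_le_dimension[OF subfield_Qp dimension_adjoin independent_power_list pl] by simp
  hence "Qp_bar.Span Qp (power_list y) = adjoin x"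
    using Qp_bar.independent_length_eq_dimension[OF subfield_Qp dimension_adjoin independent_power_list pl] assms(2)
    by simp
  thus ?thesis unfolding Span_power_list .
qed

lemma adeg_eq_if_adjoin_eq: "adjoin x = adjoin y \<Longrightarrow> adeg x = adeg y"
  using Qp_bar.dimension_is_inj[OF subfield_Qp dimension_adjoin] dimension_adjoin by metis

lemma adjoin_in_finite_extensions_upto: "adjoin x \<in> finite_extensions_upto r \<longleftrightarrow> adeg x \<le> r"
proof -
  have "Qp_bar.finite_dimension Qp (adjoin x)" by (rule Qp_bar.finite_dimensionI[OF dimension_adjoin])
  moreover have "Qp_bar.dim Qp (adjoin x) = adeg x"
    using Qp_bar.dimI[OF subfield_Qp dimension_adjoin, of x] by (simp add: over_def)
  ultimately show ?thesis
    by (simp add: finite_extensions_upto_def extension_iff_closed_field closed_field_adjoin)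
qed

section \<open>Newton iteration in a finite extension\<close>

abbreviation unif_ac :: "'p::prime_card padic alg_closure" where
  "unif_ac \<equiv> of_Zp unif"

text \<open>Monic of minimal degree: division by \<open>G\<close> creates no denominators, and this
  makes Z_p[u] free over Z_p on the powers of \<open>u\<close> below \<open>adeg u\<close>.\<close>

definition integral_generator :: "'p::prime_card padic alg_closure \<Rightarrow> bool" where
  "integral_generator u \<longleftrightarrow> (\<exists>G. monic G \<and> degree G = adeg u \<and> ev G u = 0)"

lemma adjoin_eq_adjoinI: "x \<in> adjoin y \<Longrightarrow> y \<in> adjoin x \<Longrightarrow> adjoin x = adjoin y"
  using adjoin_least[OF closed_field_adjoin] by blast

lemma ex_integral_generator:
  fixes x :: "'p::prime_card padic alg_closure"
  obtains u where "integral_generator u" "adjoin u = adjoin x"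
proof -
  define d where "d = adeg x"
  obtain G where G: "red_poly G \<noteq> 0" "degree G = d" "ev G x = 0"
    unfolding d_def by (rule ex_primitive_annihilator)
  define g where "g = lead_coeff G"
  have g: "g \<noteq> 0" using G by (auto simp: g_def)
  obtain d' where d: "d = Suc d'" using adeg_pos[of x] by (cases d) (auto simp: d_def)
  define u where "u = of_Zp g * x"
  \<comment> \<open>The monic polynomial with \<open>F(g X) = g ^ (d - 1) * G(X)\<close>, where
    \<open>d' = d - 1\<close>: scaling a root by the leading coefficient makes it integral.\<close>
  define F where "F = (\<Sum>i<d. monom (coeff G i * g ^ (d' - i)) i) + monom 1 d"
  have cF: "coeff F i = (if i < d then coeff G i * g ^ (d' - i) else if i = d then 1 else 0)" for i
    by (auto simp: F_def coeff_sum)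
  have dF: "degree F = d" by (rule antisym[OF degree_le le_degree]) (simp_all add: cF)
  have "ev F u = (\<Sum>i<d. of_Zp (coeff G i) * of_Zp g ^ (d' - i) * u ^ i) + u ^ d"
    by (simp add: F_def ev_sum of_Zp.hom_mult of_Zp.hom_power)
  also have "(\<Sum>i<d. of_Zp (coeff G i) * of_Zp g ^ (d' - i) * u ^ i) =
      (\<Sum>i<d. of_Zp g ^ d' * (of_Zp (coeff G i) * x ^ i))"
  proof (intro sum.cong refl)
    fix i assume "i \<in> {..<d}"
    hence "d' = (d' - i) + i" using d by simp
    hence "of_Zp g ^ d' = of_Zp g ^ (d' - i) * of_Zp g ^ i" by (metis power_add)
    thus "of_Zp (coeff G i) * of_Zp g ^ (d' - i) * u ^ i = of_Zp g ^ d' * (of_Zp (coeff G i) * x ^ i)"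
      by (simp add: u_def power_mult_distrib mult_ac)
  qed
  also have "u ^ d = of_Zp g ^ d' * (of_Zp (coeff G d) * x ^ d)"
    using G(2) d by (simp add: u_def g_def power_mult_distrib mult_ac)
  also have "(\<Sum>i<d. of_Zp g ^ d' * (of_Zp (coeff G i) * x ^ i)) + of_Zp g ^ d' * (of_Zp (coeff G d) * x ^ d) =
      of_Zp g ^ d' * (\<Sum>i<Suc d. of_Zp (coeff G i) * x ^ i)"
    by (simp add: sum_distrib_left distrib_left)
  also have "(\<Sum>i<Suc d. of_Zp (coeff G i) * x ^ i) = ev G x"
    using G(2) by (intro ev_polys_below[symmetric]) (simp add: polys_below_Suc_iff)
  finally have "ev F u = 0" using G(3) by simp
  have eq: "adjoin u = adjoin x"
  proof (rule adjoin_eq_adjoinI)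
    show "u \<in> adjoin x"
      unfolding u_def using closed_fieldD(3,6)[OF closed_field_adjoin] self_in_adjoin by blast
    have "x = u / of_Zp g" using g by (simp add: u_def)
    thus "x \<in> adjoin u" using closed_fieldD(6,8)[OF closed_field_adjoin] self_in_adjoin by metis
  qed
  hence "adeg u = d" using adeg_eq_if_adjoin_eq d_def by blast
  moreover have "monic F" by (simp add: dF cF)
  ultimately have "integral_generator u"
    unfolding integral_generator_def using \<open>ev F u = 0\<close> dF by blast
  thus thesis using that eq by blast
qed

definition zp_ring :: "'p::prime_card padic alg_closure \<Rightarrow> 'p padic alg_closure set" where
  "zp_ring u = range (\<lambda>A. ev A u)"

text \<open>The ideal generated by \<open>p ^ k\<close> in Z_p[u]; this filtration measures
  closeness in Q_p(u).\<close>

definition zp_multiples :: "'p::prime_card padic alg_closure \<Rightarrow> nat \<Rightarrow> 'p padic alg_closure set" where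
  "zp_multiples u k = (*) (unif_ac ^ k) ` zp_ring u"

lemma zp_ring_closed:
  "y \<in> zp_ring u \<Longrightarrow> z \<in> zp_ring u \<Longrightarrow> y + z \<in> zp_ring u"
  "y \<in> zp_ring u \<Longrightarrow> z \<in> zp_ring u \<Longrightarrow> y - z \<in> zp_ring u"
  "y \<in> zp_ring u \<Longrightarrow> z \<in> zp_ring u \<Longrightarrow> y * z \<in> zp_ring u"
  "y \<in> zp_ring u \<Longrightarrow> - y \<in> zp_ring u"
  "of_Zp c \<in> zp_ring u" "u \<in> zp_ring u" "1 \<in> zp_ring u" "0 \<in> zp_ring u"
  "y \<in> zp_ring u \<Longrightarrow> y ^ k \<in> zp_ring u"
proof -
  show "y + z \<in> zp_ring u" "y - z \<in> zp_ring u" "y * z \<in> zp_ring u" if yz: "y \<in> zp_ring u" "z \<in> zp_ring u"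
  proof -
    obtain A B where AB: "y = ev A u" "z = ev B u" using yz by (auto simp: zp_ring_def)
    show "y + z \<in> zp_ring u" "y - z \<in> zp_ring u" "y * z \<in> zp_ring u"
      unfolding AB ev_simps(3,4,6)[symmetric] zp_ring_def by (rule rangeI)+
  qed
  show "- y \<in> zp_ring u" "y ^ k \<in> zp_ring u" if y: "y \<in> zp_ring u"
  proof -
    obtain A where A: "y = ev A u" using y by (auto simp: zp_ring_def)
    show "- y \<in> zp_ring u" "y ^ k \<in> zp_ring u"
      unfolding A ev_simps(5,9)[symmetric] zp_ring_def by (rule rangeI)+
  qed
  have "of_Zp c = ev [:c:] u" for c by simp
  thus c: "of_Zp c \<in> zp_ring u" for c unfolding zp_ring_def by (metis rangeI)
  have "u = ev [:0, 1:] u" by simp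
  thus "u \<in> zp_ring u" unfolding zp_ring_def by (metis rangeI)
  show "1 \<in> zp_ring u" "0 \<in> zp_ring u" using c[of 1] c[of 0] by simp_all
qed

lemma ev_in_zp_ring: "v \<in> zp_ring u \<Longrightarrow> ev A v \<in> zp_ring u"
  by (induction A) (simp_all add: zp_ring_closed)

lemma zp_ring_subset_adjoin: "zp_ring u \<subseteq> adjoin u"
  by (auto simp: zp_ring_def ev_in_adjoin)

lemma zp_multiplesI: "z \<in> zp_ring u \<Longrightarrow> y = unif_ac ^ k * z \<Longrightarrow> y \<in> zp_multiples u k"
  by (auto simp: zp_multiples_def)

lemma zp_multiplesE:
  assumes "y \<in> zp_multiples u k"
  obtains z where "z \<in> zp_ring u" "y = unif_ac ^ k * z"
  using assms by (auto simp: zp_multiples_def)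

lemma zp_multiples_0 [simp]: "zp_multiples u 0 = zp_ring u"
  by (auto simp: zp_multiples_def)

lemma zp_multiples_add:
  assumes "y \<in> zp_multiples u k" "z \<in> zp_multiples u k"
  shows "y + z \<in> zp_multiples u k"
proof -
  obtain a b where "a \<in> zp_ring u" "y = unif_ac ^ k * a" "b \<in> zp_ring u" "z = unif_ac ^ k * b"
    using assms by (elim zp_multiplesE)
  thus ?thesis by (intro zp_multiplesI[of "a + b"]) (simp_all add: zp_ring_closed distrib_left)
qed

lemma zp_multiples_diff:
  assumes "y \<in> zp_multiples u k" "z \<in> zp_multiples u k"
  shows "y - z \<in> zp_multiples u k"
proof -
  obtain a b where "a \<in> zp_ring u" "y = unif_ac ^ k * a" "b \<in> zp_ring u" "z = unif_ac ^ k * b"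
    using assms by (elim zp_multiplesE)
  thus ?thesis by (intro zp_multiplesI[of "a - b"]) (simp_all add: zp_ring_closed right_diff_distrib)
qed

lemma zp_multiples_mult:
  assumes "y \<in> zp_multiples u k" "z \<in> zp_multiples u l"
  shows "y * z \<in> zp_multiples u (k + l)"
proof -
  obtain a b where "a \<in> zp_ring u" "y = unif_ac ^ k * a" "b \<in> zp_ring u" "z = unif_ac ^ l * b"
    using assms by (elim zp_multiplesE)
  thus ?thesis by (intro zp_multiplesI[of "a * b"]) (simp_all add: zp_ring_closed power_add)
qed

lemma zp_multiples_mult_ring: "y \<in> zp_multiples u k \<Longrightarrow> z \<in> zp_ring u \<Longrightarrow> y * z \<in> zp_multiples u k"
  using zp_multiples_mult[of y u k z 0] by simp

lemma zp_multiples_antimono: "k \<le> l \<Longrightarrow> zp_multiples u l \<subseteq> zp_multiples u k"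
proof
  fix y assume kl: "k \<le> l" and "y \<in> zp_multiples u l"
  then obtain z where z: "z \<in> zp_ring u" "y = unif_ac ^ l * z" by (elim zp_multiplesE)
  have "unif_ac ^ l = unif_ac ^ k * (unif_ac ^ (l - k) :: 'a padic alg_closure)"
    using kl by (simp flip: power_add)
  thus "y \<in> zp_multiples u k"
    using z by (intro zp_multiplesI[of "unif_ac ^ (l - k) * z"]) (simp_all add: zp_ring_closed mult.assoc)
qed

lemma zp_multiples_subset_ring: "zp_multiples u k \<subseteq> zp_ring u"
  using zp_multiples_antimono[of 0 k u] by simp

lemma zp_multiples_cancel: "unif_ac ^ k * y \<in> zp_multiples u (k + l) \<Longrightarrow> y \<in> zp_multiples u l"
  by (elim zp_multiplesE, rule zp_multiplesI) (auto simp: power_add)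

lemma zp_multiples_cancel': "unif_ac ^ m * y \<in> zp_multiples u s \<Longrightarrow> m + t \<le> s \<Longrightarrow> y \<in> zp_multiples u t"
  using zp_multiples_cancel[of m y u t] zp_multiples_antimono[of "m + t" s u] by blast

lemma zp_ring_reduced:
  assumes "integral_generator u" "y \<in> zp_ring u"
  obtains A where "y = ev A u" "A \<in> polys_below (adeg u)"
proof -
  obtain G where G: "monic G" "degree G = adeg u" "ev G u = 0"
    using assms(1) by (auto simp: integral_generator_def)
  have G0: "G \<noteq> 0" using G(1) by auto
  obtain B where B: "y = ev B u" using assms(2) by (auto simp: zp_ring_def)
  obtain Q R where QR: "pseudo_divmod B G = (Q, R)" by (meson surj_pair)
  have "B = G * Q + R" "R = 0 \<or> degree R < degree G"
    using pseudo_divmod[OF G0 QR] G(1) by simp_all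
  thus thesis using that[of R] B G by (auto simp: polys_below_iff_degree)
qed

lemma polys_below_diff: "A \<in> polys_below n \<Longrightarrow> B \<in> polys_below n \<Longrightarrow> A - B \<in> polys_below n"
  for A :: "'a::ab_group_add poly"
  by (simp add: polys_below_def)

lemma ev_polys_below_eq_0: "A \<in> polys_below (adeg u) \<Longrightarrow> ev A u = 0 \<Longrightarrow> A = 0"
  using ev_eq_0_imp[of A u] by (auto simp: polys_below_iff_degree)

text \<open>Reduced representations are unique, since no nonzero polynomial of degree below
  \<open>adeg u\<close> annihilates \<open>u\<close>. Divisibility by \<open>p ^ k\<close> in Z_p[u]
  can therefore be read off the coefficients.\<close>

lemma dvd_if_ev_in_zp_multiples:
  assumes "integral_generator u" "A \<in> polys_below (adeg u)" "ev A u \<in> zp_multiples u k"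
  shows "[:unif ^ k:] dvd A"
proof -
  obtain z where z: "z \<in> zp_ring u" "ev A u = unif_ac ^ k * z" using assms(3) by (rule zp_multiplesE)
  obtain B where B: "z = ev B u" "B \<in> polys_below (adeg u)" using zp_ring_reduced[OF assms(1) z(1)] .
  have "A - smult (unif ^ k) B \<in> polys_below (adeg u)"
    by (rule polys_below_diff[OF assms(2)]) (use B(2) in \<open>simp add: polys_below_def\<close>)
  moreover have "ev (A - smult (unif ^ k) B) u = 0" using z B by (simp add: of_Zp.hom_power)
  ultimately have "A - smult (unif ^ k) B = 0" by (rule ev_polys_below_eq_0)
  thus ?thesis by (simp add: const_poly_dvd_iff)
qed

lemma ev_in_zp_multiples:
  assumes "[:unif ^ k:] dvd A" "v \<in> zp_ring u"
  shows "ev A v \<in> zp_multiples u k"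
proof -
  obtain B where "A = [:unif ^ k:] * B" using assms(1) by (elim dvdE)
  thus ?thesis using ev_in_zp_ring[OF assms(2), of B]
    by (intro zp_multiplesI[of "ev B v"]) (simp_all add: of_Zp.hom_power)
qed

lemma zp_ring_eq_0I:
  assumes "integral_generator u" "\<And>k. y \<in> zp_multiples u k"
  shows "y = 0"
proof -
  have "y \<in> zp_ring u" using assms(2)[of 0] by simp
  then obtain A where A: "y = ev A u" "A \<in> polys_below (adeg u)" using zp_ring_reduced[OF assms(1)] by blast
  have "A = 0" by (rule poly_eq_0I, rule dvd_if_ev_in_zp_multiples[OF assms(1) A(2)]) (use A assms(2) in metis)
  thus ?thesis using A by simp
qed

lemma one_notin_zp_multiples:
  assumes "integral_generator u"
  shows "1 \<notin> zp_multiples u (Suc 0)"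
proof
  assume "1 \<in> zp_multiples u (Suc 0)"
  hence "ev 1 u \<in> zp_multiples u (Suc 0)" by simp
  moreover have "1 \<in> polys_below (adeg u)" using adeg_pos[of u] by (simp add: polys_below_iff_degree)
  ultimately have "[:unif:] dvd (1 :: 'a padic_int poly)" using dvd_if_ev_in_zp_multiples[OF assms] by fastforce
  hence "red_poly (1 :: 'a padic_int poly) = 0" by (simp only: red_poly_eq_0_iff)
  thus False by (simp only: redp.hom_one one_neq_zero)
qed

text \<open>Completeness is inherited from Z_p coefficientwise, through reduced
  representations.\<close>

lemma zp_ring_limit:
  assumes u: "integral_generator u" and v: "\<And>k. v k \<in> zp_ring u" "\<And>k. v (Suc k) - v k \<in> zp_multiples u k"
  obtains y where "y \<in> zp_ring u" "\<And>k. y - v k \<in> zp_multiples u k"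
proof -
  have "\<forall>k. \<exists>A. v k = ev A u \<and> A \<in> polys_below (adeg u)" using zp_ring_reduced[OF u v(1)] by metis
  then obtain A where A: "\<And>k. v k = ev (A k) u" "\<And>k. A k \<in> polys_below (adeg u)" by metis
  have "[:unif ^ k:] dvd A (Suc k) - A k" for k
    by (rule dvd_if_ev_in_zp_multiples[OF u polys_below_diff]) (use A v(2)[of k] in simp_all)
  moreover have "degree (A k) \<le> adeg u" for k using A(2)[of k] by (auto simp: polys_below_iff_degree)
  ultimately obtain L where L: "\<And>k. [:unif ^ k:] dvd L - A k" using poly_limit[of A] by metis
  have "ev (L - A k) u \<in> zp_multiples u k" for k by (rule ev_in_zp_multiples[OF L zp_ring_closed(6)])
  thus thesis using that[of "ev L u"] A by (simp add: zp_ring_def)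
qed

lemma ev_diff_multiple:
  assumes "v \<in> zp_ring u" "h \<in> zp_ring u"
  shows "\<exists>t\<in>zp_ring u. ev H (v + h) = ev H v + h * t"
proof (induction H)
  case 0
  show ?case by (intro bexI[of _ 0]) (simp_all add: zp_ring_closed)
next
  case (pCons a H)
  then obtain t where t: "t \<in> zp_ring u" "ev H (v + h) = ev H v + h * t" by blast
  show ?case
    by (rule bexI[of _ "v * t + ev H v + h * t"])
       (use t assms in \<open>simp_all add: zp_ring_closed ev_in_zp_ring algebra_simps\<close>)
qed

text \<open>Induction on the coefficients, rather than the formula with factorials, keeps the
  quadratic remainder inside Z_p[u].\<close>

lemma ev_taylor:
  assumes "v \<in> zp_ring u" "h \<in> zp_ring u"
  shows "\<exists>t\<in>zp_ring u. ev H (v + h) = ev H v + h * ev (pderiv H) v + h ^ 2 * t"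
proof (induction H)
  case 0
  show ?case by (intro bexI[of _ 0]) (simp_all add: zp_ring_closed)
next
  case (pCons a H)
  then obtain t where t: "t \<in> zp_ring u" "ev H (v + h) = ev H v + h * ev (pderiv H) v + h ^ 2 * t" by blast
  show ?case
    by (rule bexI[of _ "v * t + ev (pderiv H) v + h * t"])
       (use t assms in \<open>simp_all add: zp_ring_closed ev_in_zp_ring pderiv_pCons algebra_simps power2_eq_square\<close>)
qed

lemma ev_near:
  assumes "v \<in> zp_ring u" "y - v \<in> zp_multiples u k"
  shows "ev H y - ev H v \<in> zp_multiples u k"
proof -
  have "y - v \<in> zp_ring u" using assms(2) zp_multiples_subset_ring by blast
  then obtain t where "t \<in> zp_ring u" "ev H (v + (y - v)) = ev H v + (y - v) * t"
    using ev_diff_multiple[OF assms(1)] by blast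
  thus ?thesis using zp_multiples_mult_ring[OF assms(2), of t] by simp
qed

text \<open>\<open>w\<close> inverts the derivative up to the factor \<open>p ^ c\<close>, correct
  to one further digit. The condition \<open>c < s\<close> serves twice: every point within
  \<open>p ^ s\<close> of \<open>v\<close> shares this approximate inverse, and the quadratic Taylor
  term does not spoil the gain of one digit per step.\<close>

lemma newton:
  assumes u: "integral_generator u" and vw: "v \<in> zp_ring u" "w \<in> zp_ring u" and s: "c < s"
    and H: "ev H v \<in> zp_multiples u (s + c)"
    and H': "ev (pderiv H) v * w - unif_ac ^ c \<in> zp_multiples u (Suc c)"
  obtains y where "y \<in> zp_ring u" "y - v \<in> zp_multiples u s" "ev H y = 0" "ev (pderiv H) y \<noteq> 0"
proof -
  have near': "ev (pderiv H) y * w - unif_ac ^ c \<in> zp_multiples u (Suc c)" if y: "y - v \<in> zp_multiples u s" for y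
  proof -
    have "ev (pderiv H) y - ev (pderiv H) v \<in> zp_multiples u (Suc c)"
      using ev_near[OF vw(1) y] zp_multiples_antimono[of "Suc c" s u] s by auto
    from zp_multiples_add[OF zp_multiples_mult_ring[OF this vw(2)] H'] show ?thesis
      by (simp add: algebra_simps)
  qed
  define good where "good k y \<longleftrightarrow> y \<in> zp_ring u \<and> y - v \<in> zp_multiples u s \<and> ev H y \<in> zp_multiples u (s + c + k)"
    for k y
  have step: "\<exists>y'. good (Suc k) y' \<and> y' - y \<in> zp_multiples u (s + k)" if "good k y" for k y
  proof -
    from that have y: "y \<in> zp_ring u" "y - v \<in> zp_multiples u s" "ev H y \<in> zp_multiples u (s + c + k)"
      by (auto simp: good_def)
    obtain m where m: "m \<in> zp_ring u" "ev H y = unif_ac ^ (s + c + k) * m" using y(3) by (rule zp_multiplesE)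
    \<comment> \<open>The Newton correction, with the fixed \<open>w\<close> in place of the inverse
      derivative: as \<open>ev (pderiv H) y * w\<close> is \<open>p ^ c\<close> up to a multiple of
      \<open>p ^ (c + 1)\<close>, the linear term cancels \<open>ev H y\<close> up to one more
      digit.\<close>
    define h where "h = - (unif_ac ^ (s + k) * (w * m))"
    have h: "h \<in> zp_multiples u (s + k)"
      by (rule zp_multiplesI[of "- (w * m)"]) (use m vw in \<open>simp_all add: h_def zp_ring_closed\<close>)
    have h': "h \<in> zp_ring u" using h zp_multiples_subset_ring by blast
    obtain t where t: "t \<in> zp_ring u" "ev H (y + h) = ev H y + h * ev (pderiv H) y + h ^ 2 * t"
      using ev_taylor[OF y(1) h'] by blast
    have "ev H y + h * ev (pderiv H) y = - (unif_ac ^ (s + k) * m * (ev (pderiv H) y * w - unif_ac ^ c))"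
      by (simp add: m h_def power_add algebra_simps)
    moreover have "unif_ac ^ (s + k) * m * (ev (pderiv H) y * w - unif_ac ^ c) \<in> zp_multiples u ((s + k) + Suc c)"
      by (rule zp_multiples_mult[OF zp_multiplesI[OF m(1) refl] near'[OF y(2)]])
    moreover have "h * h * t \<in> zp_multiples u ((s + k) + (s + k))"
      by (rule zp_multiples_mult_ring[OF zp_multiples_mult[OF h h] t(1)])
    hence "h ^ 2 * t \<in> zp_multiples u ((s + k) + Suc c)"
      using zp_multiples_antimono[of "(s + k) + Suc c" "(s + k) + (s + k)" u] s
      by (auto simp: power2_eq_square)
    ultimately have "ev H (y + h) \<in> zp_multiples u ((s + k) + Suc c)"
      unfolding t(2) using zp_multiples_diff by fastforce
    hence "ev H (y + h) \<in> zp_multiples u (s + c + Suc k)" by (simp add: add_ac)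
    moreover have "(y - v) + h \<in> zp_multiples u s"
      using zp_multiples_add[OF y(2)] h zp_multiples_antimono[of s "s + k" u] by auto
    ultimately have "good (Suc k) (y + h)" using y h' by (simp add: good_def zp_ring_closed algebra_simps)
    thus ?thesis using h by (intro exI[of _ "y + h"]) simp
  qed
  have "good 0 v" using vw H by (simp add: good_def zp_multiplesI[of 0] zp_ring_closed)
  then obtain f where f: "\<And>k. good k (f k)" "\<And>k. f (Suc k) - f k \<in> zp_multiples u (s + k)"
    using dependent_nat_choice[of good "\<lambda>k y y'. y' - y \<in> zp_multiples u (s + k)"] step by metis
  have "f (Suc k) - f k \<in> zp_multiples u k" for k
    using f(2)[of k] zp_multiples_antimono[of k "s + k" u] by auto
  moreover have "f k \<in> zp_ring u" for k using f(1)[of k] by (simp add: good_def)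
  ultimately obtain y where y: "y \<in> zp_ring u" "\<And>k. y - f k \<in> zp_multiples u k"
    using zp_ring_limit[OF u, of f] by metis
  have yv: "y - v \<in> zp_multiples u s"
    using zp_multiples_add[OF y(2)[of s], of "f s - v"] f(1)[of s] by (simp add: good_def)
  have "ev H y \<in> zp_multiples u k" for k
  proof -
    have "ev H (f k) \<in> zp_multiples u k"
      using f(1)[of k] zp_multiples_antimono[of k "s + c + k" u] by (auto simp: good_def)
    moreover have "ev H y - ev H (f k) \<in> zp_multiples u k"
      by (rule ev_near[OF _ y(2)]) (use f(1)[of k] in \<open>simp add: good_def\<close>)
    ultimately show ?thesis using zp_multiples_add by fastforce
  qed
  hence "ev H y = 0" by (rule zp_ring_eq_0I[OF u])
  moreover have "ev (pderiv H) y \<noteq> 0"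
  proof
    assume "ev (pderiv H) y = 0"
    \<comment> \<open>A vanishing derivative would put \<open>p ^ c\<close> into the ideal of
      \<open>p ^ (c + 1)\<close>, and thus \<open>1\<close> into that of \<open>p\<close>.\<close>
    hence "- (unif_ac ^ c) \<in> zp_multiples u (c + Suc 0)" using near'[OF yv] by simp
    hence "unif_ac ^ c * (- 1) \<in> zp_multiples u (c + Suc 0)" by simp
    hence "- 1 \<in> zp_multiples u (Suc 0)" by (rule zp_multiples_cancel)
    hence "(- 1) * (- 1) \<in> zp_multiples u (Suc 0)"
      by (rule zp_multiples_mult_ring) (simp add: zp_ring_closed)
    thus False using one_notin_zp_multiples[OF u] by simp
  qed
  ultimately show thesis using that y(1) yv by blast
qed

section \<open>Stability of simple roots under perturbation\<close>

text \<open>The denominator is a power of \<open>unif\<close> times a unit of Z_p, and the unit can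
  be absorbed into the numerator.\<close>

lemma adjoin_scaled_ring:
  assumes "y \<in> adjoin u"
  obtains c w where "w \<in> zp_ring u" "unif_ac ^ c * y = w"
proof -
  obtain A s where As: "s \<noteq> 0" "y = ev A u / of_Zp s" using assms by (rule adjoinE)
  obtain c e where ce: "s = unif ^ c * e" "red e \<noteq> 0" using padic_int_decompose[OF As(1)] .
  obtain e' where e': "1 = e * e'" using dvd_1_if_red_nonzero[OF ce(2)] by (elim dvdE)
  hence ee: "of_Zp e * of_Zp e' = 1" by (metis of_Zp.hom_mult of_Zp.hom_one)
  hence "of_Zp e \<noteq> 0" by auto
  hence "unif_ac ^ c * y = ev A u / of_Zp e"
    using As(2) ce(1) by (simp add: of_Zp.hom_mult of_Zp.hom_power)
  also have "\<dots> = ev A u * of_Zp e'" using ee \<open>of_Zp e \<noteq> 0\<close> by (simp add: field_simps)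
  finally show thesis
    by (intro that[of "ev A u * of_Zp e'" c] zp_ring_closed(3,5)) (simp_all add: zp_ring_def)
qed

text \<open>A substitute for Krasner's lemma. If \<open>u + z\<close> had smaller degree, its
  primitive annihilator \<open>C\<close> would take at \<open>u\<close> a value divisible by
  \<open>p\<close>; as \<open>C\<close> has degree below \<open>adeg u\<close>, all its coefficients
  would be divisible by \<open>p\<close>.\<close>

lemma adjoin_perturbed_generator:
  assumes u: "integral_generator u" and z: "z \<in> zp_multiples u (Suc 0)"
  shows "adjoin (u + z) = adjoin u"
proof (rule adjoin_eqI)
  have z': "z \<in> zp_ring u" using z zp_multiples_subset_ring by blast
  show "u + z \<in> adjoin u"
    using zp_ring_closed(1)[OF zp_ring_closed(6) z'] zp_ring_subset_adjoin by blast
  show "adeg u \<le> adeg (u + z)"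
  proof (rule ccontr)
    assume "\<not> adeg u \<le> adeg (u + z)"
    obtain C where C: "red_poly C \<noteq> 0" "degree C = adeg (u + z)" "ev C (u + z) = 0"
      by (rule ex_primitive_annihilator)
    have "ev C (u + z) - ev C u \<in> zp_multiples u (Suc 0)"
      by (rule ev_near[OF zp_ring_closed(6)]) (use z in simp)
    hence "(ev C (u + z) - ev C u) * (- 1) \<in> zp_multiples u (Suc 0)"
      by (rule zp_multiples_mult_ring) (simp add: zp_ring_closed)
    hence "ev C u \<in> zp_multiples u (Suc 0)" using C(3) by simp
    moreover have "C \<in> polys_below (adeg u)"
      using C(2) \<open>\<not> adeg u \<le> adeg (u + z)\<close> by (simp add: polys_below_iff_degree)
    ultimately have "[:unif ^ Suc 0:] dvd C" by (intro dvd_if_ev_in_zp_multiples[OF u])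
    thus False using C(1) red_poly_eq_0_iff[of C] by simp
  qed
qed

text \<open>The polynomial \<open>p ^ (m n) * P(X / p ^ m)\<close>, whose roots are those of
  \<open>P\<close> times \<open>p ^ m\<close>. The degree bound \<open>n\<close> is a parameter so
  that \<open>P\<close> and its perturbations are scaled by the same linear map.\<close>

definition scale_poly :: "nat \<Rightarrow> nat \<Rightarrow> 'p::prime_card padic_int poly \<Rightarrow> 'p padic_int poly" where
  "scale_poly m n P = (\<Sum>i\<le>n. monom (coeff P i * unif ^ (m * (n - i))) i)"

lemma coeff_scale_poly: "coeff (scale_poly m n P) i = (if i \<le> n then coeff P i * unif ^ (m * (n - i)) else 0)"
  by (simp add: scale_poly_def coeff_sum)

lemma ev_scale_poly:
  assumes "degree P \<le> n"
  shows "ev (scale_poly m n P) (unif_ac ^ m * z) = unif_ac ^ (m * n) * ev P z"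
proof -
  have "ev (scale_poly m n P) (unif_ac ^ m * z) =
      (\<Sum>i\<le>n. of_Zp (coeff P i) * (unif_ac ^ (m * (n - i)) * unif_ac ^ (m * i)) * z ^ i)"
    by (simp add: scale_poly_def ev_sum of_Zp.hom_mult of_Zp.hom_power power_mult_distrib mult_ac flip: power_mult)
  also have "\<dots> = (\<Sum>i\<le>n. unif_ac ^ (m * n) * (of_Zp (coeff P i) * z ^ i))"
  proof (intro sum.cong refl)
    fix i assume "i \<in> {..n}"
    hence "m * n = m * (n - i) + m * i" by (simp flip: distrib_left)
    hence "unif_ac ^ (m * n) = unif_ac ^ (m * (n - i)) * (unif_ac ^ (m * i) :: 'a padic alg_closure)"
      by (metis power_add)
    thus "of_Zp (coeff P i) * (unif_ac ^ (m * (n - i)) * unif_ac ^ (m * i)) * z ^ i =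
      unif_ac ^ (m * n) * (of_Zp (coeff P i) * z ^ i)" by simp
  qed
  also have "\<dots> = unif_ac ^ (m * n) * (\<Sum>i<Suc n. of_Zp (coeff P i) * z ^ i)"
    by (simp add: sum_distrib_left lessThan_Suc_atMost)
  also have "(\<Sum>i<Suc n. of_Zp (coeff P i) * z ^ i) = ev P z"
    using assms by (intro ev_polys_below[symmetric]) (simp add: polys_below_Suc_iff)
  finally show ?thesis .
qed

lemma pderiv_scale_poly: "degree P \<le> n \<Longrightarrow> pderiv (scale_poly m n P) = scale_poly m (n - 1) (pderiv P)"
  by (rule poly_eqI) (auto simp: coeff_pderiv coeff_scale_poly coeff_eq_0 mult_ac Suc_le_eq)

lemma degree_pderiv_le: "degree (pderiv P) \<le> degree P - 1" for P :: "'a::idom poly"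
  by (rule degree_le) (auto simp: coeff_pderiv coeff_eq_0)

lemma scale_poly_diff_dvd:
  assumes "[:unif ^ N:] dvd H - P"
  shows "[:unif ^ N:] dvd scale_poly m n H - scale_poly m n P"
  using assms by (auto simp: const_poly_dvd_iff coeff_scale_poly simp flip: left_diff_distrib)

lemma pderiv_diff_dvd: "[:c:] dvd H - P \<Longrightarrow> [:c:] dvd pderiv H - pderiv P" for c :: "'a::idom"
  by (auto simp: const_poly_dvd_iff coeff_pderiv simp flip: right_diff_distrib)

text \<open>Scaling by \<open>p ^ m\<close> moves the root into Z_p[u], where Newton's method finds
  a nearby root of the perturbed polynomial. The field stays the same because \<open>u\<close> is a
  polynomial expression in the scaled root up to \<open>p ^ j\<close>: inserting the new root gives
  a small perturbation of \<open>u\<close>, which still generates the field.\<close>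

lemma simple_root_stable:
  fixes u :: "'p::prime_card padic alg_closure"
  assumes u: "integral_generator u" and x: "adjoin x = adjoin u"
    and P: "degree P \<le> n" "ev P x = 0" "ev (pderiv P) x \<noteq> 0"
  shows "\<exists>N. \<forall>H. degree H \<le> n \<longrightarrow> [:unif ^ N:] dvd H - P \<longrightarrow>
    (\<exists>y. adjoin y = adjoin u \<and> ev H y = 0 \<and> ev (pderiv H) y \<noteq> 0 \<and> y - x \<in> zp_multiples u t)"
proof -
  have nz: "unif_ac \<noteq> (0 :: 'p padic alg_closure)" by simp
  have xu: "x \<in> adjoin u" using self_in_adjoin[of x] x by simp
  obtain m v where v: "v \<in> zp_ring u" "unif_ac ^ m * x = v" using adjoin_scaled_ring[OF xu] .
  define P1 where "P1 = scale_poly m n P"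
  have P1: "ev P1 v = 0" "ev (pderiv P1) v \<noteq> 0"
    using ev_scale_poly[OF P(1), of m x] ev_scale_poly[of "pderiv P" "n - 1" m x] P
      order_trans[OF degree_pderiv_le, of P "n - 1"]
    by (simp_all add: P1_def v(2) pderiv_scale_poly)
  have adj_scale: "adjoin (unif_ac ^ m * y) = adjoin y" for y :: "'p padic alg_closure"
  proof (rule adjoin_eq_adjoinI)
    show "unif_ac ^ m * y \<in> adjoin y"
      using closed_fieldD(3,6)[OF closed_field_adjoin] self_in_adjoin by (metis of_Zp.hom_power)
    have "y = (unif_ac ^ m * y) / of_Zp (unif ^ m)" by (simp add: of_Zp.hom_power)
    thus "y \<in> adjoin (unif_ac ^ m * y)"
      using closed_fieldD(6,8)[OF closed_field_adjoin] self_in_adjoin by metis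
  qed
  have "ev (pderiv P1) v \<in> adjoin u" using ev_in_zp_ring[OF v(1)] zp_ring_subset_adjoin by blast
  hence "inverse (ev (pderiv P1) v) \<in> adjoin u" by (rule closed_fieldD(5)[OF closed_field_adjoin])
  \<comment> \<open>The inverse of the derivative may lie outside Z_p[u]; \<open>c\<close> is the
    power of \<open>p\<close> that brings it in.\<close>
  then obtain c w where w: "w \<in> zp_ring u" "unif_ac ^ c * inverse (ev (pderiv P1) v) = w"
    by (rule adjoin_scaled_ring)
  have w': "ev (pderiv P1) v * w = unif_ac ^ c" using P1(2) w(2)[symmetric] by simp
  have "u \<in> adjoin v" using self_in_adjoin[of u] adj_scale[of x] v(2) x by simp
  then obtain j b where b: "b \<in> zp_ring v" "unif_ac ^ j * u = b" by (rule adjoin_scaled_ring)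
  then obtain B where B: "unif_ac ^ j * u = ev B v" by (auto simp: zp_ring_def)
  \<comment> \<open>\<open>c\<close> for the hypothesis of Newton's method, \<open>m + t\<close> for
    closeness \<open>t\<close> after undoing the scaling, and \<open>j\<close> plus one for a
    perturbation of \<open>u\<close> divisible by \<open>p\<close>.\<close>
  define s where "s = Suc (c + t + m + j)"
  show ?thesis
  proof (intro exI[of _ "s + c"] allI impI)
    fix H :: "'p padic_int poly" assume H: "degree H \<le> n" "[:unif ^ (s + c):] dvd H - P"
    define H1 where "H1 = scale_poly m n H"
    have dvd: "[:unif ^ (s + c):] dvd H1 - P1" unfolding H1_def P1_def by (rule scale_poly_diff_dvd[OF H(2)])
    have 1: "ev H1 v \<in> zp_multiples u (s + c)" using ev_in_zp_multiples[OF dvd v(1)] P1 by simp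
    have "ev (pderiv H1) v - ev (pderiv P1) v \<in> zp_multiples u (s + c)"
      using ev_in_zp_multiples[OF pderiv_diff_dvd[OF dvd] v(1)] by simp
    hence "(ev (pderiv H1) v - ev (pderiv P1) v) * w \<in> zp_multiples u (s + c)"
      by (rule zp_multiples_mult_ring[OF _ w(1)])
    hence "ev (pderiv H1) v * w - unif_ac ^ c \<in> zp_multiples u (s + c)" by (simp add: left_diff_distrib w')
    hence 2: "ev (pderiv H1) v * w - unif_ac ^ c \<in> zp_multiples u (Suc c)"
      using zp_multiples_antimono[of "Suc c" "s + c" u] by (auto simp: s_def)
    have "c < s" by (simp add: s_def)
    then obtain y1 where y1: "y1 \<in> zp_ring u" "y1 - v \<in> zp_multiples u s" "ev H1 y1 = 0" "ev (pderiv H1) y1 \<noteq> 0"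
      using newton[OF u v(1) w(1) _ 1 2] by blast
    define y where "y = y1 / unif_ac ^ m"
    have yy: "unif_ac ^ m * y = y1" by (simp add: y_def)
    have "ev H y = 0" using ev_scale_poly[OF H(1), of m y] y1(3) by (simp add: H1_def yy)
    moreover have "ev (pderiv H) y \<noteq> 0"
      using ev_scale_poly[of "pderiv H" "n - 1" m y] y1(4) order_trans[OF degree_pderiv_le, of H "n - 1"] H(1)
      by (auto simp: H1_def yy pderiv_scale_poly)
    moreover have "y - x \<in> zp_multiples u t"
    proof (rule zp_multiples_cancel')
      show "unif_ac ^ m * (y - x) \<in> zp_multiples u s" using y1(2) by (simp add: right_diff_distrib yy v(2))
      show "m + t \<le> s" by (simp add: s_def)
    qed
    moreover have "adjoin y = adjoin u"
    proof -
      define z where "z = ev B y1 / unif_ac ^ j - u"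
      have "unif_ac ^ j * z = ev B y1 - ev B v" by (simp add: z_def right_diff_distrib B)
      hence "unif_ac ^ j * z \<in> zp_multiples u s" using ev_near[OF v(1) y1(2)] by simp
      hence "z \<in> zp_multiples u (Suc 0)" by (rule zp_multiples_cancel') (simp add: s_def)
      hence "adjoin (u + z) = adjoin u" by (rule adjoin_perturbed_generator[OF u])
      moreover have "u + z = ev B y1 / of_Zp (unif ^ j)" by (simp add: z_def of_Zp.hom_power)
      hence "u + z \<in> adjoin y1" by (intro adjoinI[of "unif ^ j"]) simp_all
      ultimately have "adjoin u \<subseteq> adjoin y1" using adjoin_least[OF closed_field_adjoin] by metis
      moreover have "adjoin y1 \<subseteq> adjoin u"
        using adjoin_least[OF closed_field_adjoin] y1(1) zp_ring_subset_adjoin by blast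
      ultimately show ?thesis using adj_scale[of y] yy by simp
    qed
    ultimately show "\<exists>y. adjoin y = adjoin u \<and> ev H y = 0 \<and> ev (pderiv H) y \<noteq> 0 \<and> y - x \<in> zp_multiples u t"
      by blast
  qed
qed

lemma adjoin_separated:
  assumes u: "integral_generator u" and "finite D" "D \<subseteq> adjoin u" "0 \<notin> D"
  shows "\<exists>t. D \<inter> zp_multiples u t = {}"
  using assms(2-)
proof (induction D rule: finite_induct)
  case (insert \<delta> D)
  then obtain t where t: "D \<inter> zp_multiples u t = {}" by auto
  have "\<exists>t. \<delta> \<notin> zp_multiples u t"
  proof (rule ccontr)
    assume "\<nexists>t. \<delta> \<notin> zp_multiples u t"
    hence "\<delta> = 0" using zp_ring_eq_0I[OF u] by blast
    thus False using insert.prems by simp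
  qed
  then obtain t' where t': "\<delta> \<notin> zp_multiples u t'" by blast
  have "insert \<delta> D \<inter> zp_multiples u (max t t') = {}"
    using t t' zp_multiples_antimono[of t "max t t'" u] zp_multiples_antimono[of t' "max t t'" u] by auto
  thus ?case by blast
qed simp

text \<open>\<open>S\<close> is any set of \<open>i\<close> such roots, not the set of all of them;
  the condition thus means at least \<open>i\<close>, and so is open.\<close>

definition simple_root_polys :: "'p::prime_card padic alg_closure set \<Rightarrow> nat \<Rightarrow> 'p padic_int poly set" where
  "simple_root_polys K i = {P. \<exists>S. finite S \<and> card S = i \<and> (\<forall>x\<in>S. adjoin x = K \<and> ev P x = 0 \<and> ev (pderiv P) x \<noteq> 0)}"

text \<open>Each root moves by less than the radius \<open>p ^ t\<close>, chosen so that no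
  difference of two distinct roots in \<open>S\<close> is divisible by \<open>p ^ t\<close>; hence
  the perturbed roots stay distinct.\<close>

lemma simple_root_polys_open:
  fixes P :: "'p::prime_card padic_int poly"
  assumes "P \<in> simple_root_polys K i" "degree P \<le> n"
  shows "\<exists>N. \<forall>H. degree H \<le> n \<longrightarrow> [:unif ^ N:] dvd H - P \<longrightarrow> H \<in> simple_root_polys K i"
proof -
  obtain S where S: "finite S" "card S = i" "\<And>x. x \<in> S \<Longrightarrow> adjoin x = K \<and> ev P x = 0 \<and> ev (pderiv P) x \<noteq> 0"
    using assms(1) by (auto simp: simple_root_polys_def)
  show ?thesis
  proof (cases "S = {}")
    case True
    hence "i = 0" using S(2) by simp
    hence "H \<in> simple_root_polys K i" for H by (auto simp: simple_root_polys_def intro!: exI[of _ "{}"])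
    thus ?thesis by blast
  next
    case False
    then obtain x0 where "x0 \<in> S" by blast
    then obtain u where u: "integral_generator u" "adjoin u = K"
      using ex_integral_generator[of x0] S(3) by metis
    define D where "D = (\<lambda>(x, y). x - y) ` {(x, y). x \<in> S \<and> y \<in> S \<and> x \<noteq> y}"
    have "finite {(x, y). x \<in> S \<and> y \<in> S \<and> x \<noteq> y}"
      by (rule finite_subset[of _ "S \<times> S"]) (use S(1) in auto)
    hence "finite D" by (simp add: D_def)
    moreover have "D \<subseteq> adjoin u"
    proof
      fix \<delta> assume "\<delta> \<in> D"
      then obtain x y where xy: "\<delta> = x - y" "x \<in> S" "y \<in> S" by (auto simp: D_def)
      have "x \<in> adjoin u" "y \<in> adjoin u"
        using S(3)[OF xy(2)] S(3)[OF xy(3)] u(2) self_in_adjoin[of x] self_in_adjoin[of y] by simp_all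
      thus "\<delta> \<in> adjoin u" unfolding xy(1) by (rule closed_fieldD(7)[OF closed_field_adjoin])
    qed
    moreover have "0 \<notin> D" by (auto simp: D_def)
    ultimately have "\<exists>t. D \<inter> zp_multiples u t = {}" by (rule adjoin_separated[OF u(1)])
    then obtain t where t: "D \<inter> zp_multiples u t = {}" by blast
    have "\<forall>x\<in>S. \<exists>N. \<forall>H. degree H \<le> n \<longrightarrow> [:unif ^ N:] dvd H - P \<longrightarrow>
      (\<exists>y. adjoin y = adjoin u \<and> ev H y = 0 \<and> ev (pderiv H) y \<noteq> 0 \<and> y - x \<in> zp_multiples u t)"
    proof
      fix x assume "x \<in> S"
      hence "adjoin x = adjoin u" "ev P x = 0" "ev (pderiv P) x \<noteq> 0" using S(3) u(2) by simp_all
      thus "\<exists>N. \<forall>H. degree H \<le> n \<longrightarrow> [:unif ^ N:] dvd H - P \<longrightarrow>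
        (\<exists>y. adjoin y = adjoin u \<and> ev H y = 0 \<and> ev (pderiv H) y \<noteq> 0 \<and> y - x \<in> zp_multiples u t)"
        by (rule simple_root_stable[OF u(1) _ assms(2)])
    qed
    then obtain N where N: "\<And>x H. x \<in> S \<Longrightarrow> degree H \<le> n \<Longrightarrow> [:unif ^ N x:] dvd H - P \<Longrightarrow>
      \<exists>y. adjoin y = adjoin u \<and> ev H y = 0 \<and> ev (pderiv H) y \<noteq> 0 \<and> y - x \<in> zp_multiples u t"
      by metis
    show ?thesis
    proof (intro exI[of _ "Max (N ` S)"] allI impI)
      fix H :: "'p padic_int poly" assume H: "degree H \<le> n" "[:unif ^ Max (N ` S):] dvd H - P"
      have "[:unif ^ N x:] dvd H - P" if "x \<in> S" for x
      proof (rule dvd_trans[OF _ H(2)])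
        have "N x \<le> Max (N ` S)" using S(1) that by simp
        thus "[:unif ^ N x:] dvd [:unif ^ Max (N ` S) :: 'p padic_int:]"
          by (simp add: const_poly_dvd_const_poly_iff le_imp_power_dvd)
      qed
      hence "\<forall>x\<in>S. \<exists>y. adjoin y = adjoin u \<and> ev H y = 0 \<and> ev (pderiv H) y \<noteq> 0 \<and> y - x \<in> zp_multiples u t"
        using N H(1) by blast
      then obtain f where f: "\<And>x. x \<in> S \<Longrightarrow> adjoin (f x) = adjoin u \<and> ev H (f x) = 0 \<and>
        ev (pderiv H) (f x) \<noteq> 0 \<and> f x - x \<in> zp_multiples u t" by metis
      have "inj_on f S"
      proof (rule inj_onI, rule ccontr)
        fix x y assume xy: "x \<in> S" "y \<in> S" "f x = f y" "x \<noteq> y"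
        have near: "f x - x \<in> zp_multiples u t" "f y - y \<in> zp_multiples u t"
          using f[OF xy(1)] f[OF xy(2)] by simp_all
        have "(f y - y) - (f x - x) \<in> zp_multiples u t" by (rule zp_multiples_diff[OF near(2,1)])
        hence "x - y \<in> zp_multiples u t" using xy by simp
        moreover have "x - y \<in> D" using xy by (force simp: D_def)
        ultimately show False using t by blast
      qed
      thus "H \<in> simple_root_polys K i"
        unfolding simple_root_polys_def using S(1,2) f u(2)
        by (intro CollectI exI[of _ "f ` S"]) (auto simp: card_image)
    qed
  qed
qed

text \<open>Characteristic zero: as \<open>k < p ^ k\<close>, the \<open>k\<close>-th residue of
  \<open>k\<close> is \<open>k\<close> itself.\<close>

lemma of_nat_padic_eq_0_iff [simp]: "(of_nat k :: 'p::prime_card padic_int) = 0 \<longleftrightarrow> k = 0"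
proof
  assume *: "(of_nat k :: 'p padic_int) = 0"
  have "int k < pp TYPE('p) k"
    using power_gt_expt[of "CARD('p)" k] p_gt_1[where 'p='p] by (simp flip: of_nat_power)
  moreover have "int k mod pp TYPE('p) k = 0"
    using residue_of_nat[of k k, where 'p='p] * by (simp add: residue_0)
  ultimately show "k = 0" by simp
qed simp

text \<open>Separability: in characteristic zero the derivative is nonzero and has smaller degree,
  so it cannot annihilate \<open>x\<close>.\<close>

lemma pderiv_min_annihilator:
  assumes "G \<noteq> 0" "degree G = adeg x" "ev G x = 0"
  shows "ev (pderiv G) x \<noteq> 0"
proof
  assume *: "ev (pderiv G) x = 0"
  obtain d where d: "degree G = Suc d" using adeg_pos[of x] assms(2) by (metis gr0_implies_Suc)
  have "coeff (pderiv G) d = of_nat (Suc d) * lead_coeff G" by (simp add: coeff_pderiv d)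
  hence "coeff (pderiv G) d \<noteq> 0" using assms(1) by (simp del: of_nat_Suc)
  hence "pderiv G \<noteq> 0" by auto
  hence "adeg x \<le> degree (pderiv G)" using * by (intro adeg_le)
  thus False using degree_pderiv_le[of G] d assms(2) by simp
qed

text \<open>A minimal annihilator has \<open>x\<close> as a simple root, so an approximation with
  integer coefficients has a root generating the same field. There are countably many such
  polynomials, and each nonzero one has finitely many roots.\<close>

lemma countable_adjoin: "countable (range (adjoin :: 'p::prime_card padic alg_closure \<Rightarrow> _))"
proof -
  define \<H> :: "'p padic_int poly set" where "\<H> = range (\<lambda>l :: int list. Poly (map of_int l))"
  have "range (adjoin :: 'p padic alg_closure \<Rightarrow> _) \<subseteq> (\<Union>H\<in>\<H> - {0}. adjoin ` {y. ev H y = 0})"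
  proof (rule subsetI, elim rangeE)
    fix K and x :: "'p padic alg_closure" assume K: "K = adjoin x"
    obtain G where G: "red_poly G \<noteq> 0" "degree G = adeg x" "ev G x = 0" by (rule ex_primitive_annihilator)
    have "G \<noteq> 0" using G(1) by auto
    hence "ev (pderiv G) x \<noteq> 0" by (rule pderiv_min_annihilator[OF _ G(2,3)])
    hence "G \<in> simple_root_polys K 1"
      unfolding simple_root_polys_def using G(3) K by (intro CollectI exI[of _ "{x}"]) simp
    then obtain N where N: "\<And>H. degree H \<le> degree G \<Longrightarrow> [:unif ^ N:] dvd H - G \<Longrightarrow> H \<in> simple_root_polys K 1"
      using simple_root_polys_open[of G K 1 "degree G"] by auto
    define l where "l = map (\<lambda>i. residue (coeff G i) N) [0..<Suc (degree G)]"
    define H where "H = (Poly (map of_int l) :: 'p padic_int poly)"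
    have cH: "coeff H i = (if i \<le> degree G then of_int (residue (coeff G i) N) else 0)" for i
      by (auto simp: H_def l_def nth_default_def simp del: upt_Suc)
    have "degree H \<le> degree G" by (rule degree_le) (simp add: cH)
    moreover have "[:unif ^ N:] dvd H - G"
      by (auto simp: const_poly_dvd_iff cH coeff_eq_0 unif_power_dvd_diff_iff residue_of_int simp del: of_nat_power)
    ultimately have "H \<in> simple_root_polys K 1" by (rule N)
    then obtain S where S: "card S = 1" "\<forall>y\<in>S. adjoin y = K \<and> ev H y = 0 \<and> ev (pderiv H) y \<noteq> 0"
      by (auto simp: simple_root_polys_def)
    then obtain y where y: "adjoin y = K" "ev H y = 0" "ev (pderiv H) y \<noteq> 0" by (auto simp: card_1_singleton_iff)
    have "H \<noteq> 0" using y(3) by auto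
    moreover have "H \<in> \<H>" by (simp add: \<H>_def H_def)
    ultimately show "K \<in> (\<Union>H\<in>\<H> - {0}. adjoin ` {y. ev H y = 0})" using y by blast
  qed
  moreover have "countable (\<Union>H\<in>\<H> - {0}. adjoin ` {y. ev H y = 0})"
  proof (intro countable_UN countable_image)
    show "countable (\<H> - {0})" unfolding \<H>_def by (intro countable_Diff countable_image) simp
    fix H assume "H \<in> \<H> - {0}"
    hence "{y. ev H y = 0} = set_mset (zeros H)" by (simp add: set_zeros)
    thus "countable {y. ev H y = 0}" by (simp add: countable_finite)
  qed
  ultimately show ?thesis by (rule countable_subset)
qed

section \<open>Measurability of root counts\<close>

lemma padic_open_iff: "open (U :: 'p::prime_card padic_int set) \<longleftrightarrow> (\<forall>x\<in>U. \<exists>n. cyl n (residue x n) \<subseteq> U)"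
  by (simp add: open_padic_int_def cyl_def subset_eq)

instance padic_int :: (prime_card) t2_space
proof
  fix x y :: "'a padic_int" assume "x \<noteq> y"
  then obtain n where n: "residue x n \<noteq> residue y n" using padic_int_eqI by blast
  show "\<exists>U V. open U \<and> open V \<and> x \<in> U \<and> y \<in> V \<and> U \<inter> V = {}"
    by (rule exI[of _ "cyl n (residue x n)"], rule exI[of _ "cyl n (residue y n)"])
       (use n in \<open>auto simp: open_cyl\<close>, auto simp: cyl_def)
qed

instance padic_int :: (prime_card) second_countable_topology
proof
  have "topological_basis (cyls :: 'a padic_int set set)"
  proof (rule topological_basisI)
    show "open B" if "B \<in> cyls" for B :: "'a padic_int set"
      using that by (auto simp: cyls_def open_cyl)
  next
    fix U :: "'a padic_int set" and x assume "open U" "x \<in> U"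
    then obtain n where "cyl n (residue x n) \<subseteq> U" by (auto simp: padic_open_iff)
    thus "\<exists>B\<in>cyls. x \<in> B \<and> B \<subseteq> U"
      by (intro bexI[of _ "cyl n (residue x n)"]) (auto simp: cyl_in_cyls, simp add: cyl_def)
  qed
  moreover have "countable (cyls :: 'a padic_int set set)" unfolding cyls_def by auto
  ultimately show "\<exists>B :: 'a padic_int set set. countable B \<and> open = generate_topology B"
    using topological_basis_imp_subbasis by blast
qed

text \<open>Koenig's argument: without a finite subcover there are nested cylinders, each without
  one, and the member of the cover containing their limit already contains one of these
  cylinders.\<close>

lemma compact_UNIV_padic: "compact (UNIV :: 'p::prime_card padic_int set)"
  unfolding compact_eq_Heine_Borel
proof (intro allI impI, elim conjE)
  fix \<C> :: "'p padic_int set set" assume \<C>: "\<forall>C\<in>\<C>. open C" "UNIV \<subseteq> \<Union>\<C>"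
  define good where "good S \<longleftrightarrow> (\<exists>\<D>\<subseteq>\<C>. finite \<D> \<and> S \<subseteq> \<Union>\<D>)" for S
  have good_UN: "good (\<Union>b\<in>B. S b)" if fin: "finite B" and B: "\<And>b. b \<in> B \<Longrightarrow> good (S b)" for B :: "int set" and S
  proof -
    obtain \<D> where "\<And>b. b \<in> B \<Longrightarrow> \<D> b \<subseteq> \<C> \<and> finite (\<D> b) \<and> S b \<subseteq> \<Union>(\<D> b)"
      using B unfolding good_def by metis
    hence \<D>: "\<And>b. b \<in> B \<Longrightarrow> \<D> b \<subseteq> \<C>" "\<And>b. b \<in> B \<Longrightarrow> finite (\<D> b)" "\<And>b. b \<in> B \<Longrightarrow> S b \<subseteq> \<Union>(\<D> b)"
      by simp_all
    show ?thesis unfolding good_def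
    proof (intro exI[of _ "\<Union>b\<in>B. \<D> b"] conjI)
      show "(\<Union>b\<in>B. \<D> b) \<subseteq> \<C>" using \<D>(1) by blast
      show "finite (\<Union>b\<in>B. \<D> b)" using \<D>(2) fin by simp
      show "(\<Union>b\<in>B. S b) \<subseteq> \<Union>(\<Union>b\<in>B. \<D> b)"
      proof
        fix x assume "x \<in> (\<Union>b\<in>B. S b)"
        then obtain b where b: "b \<in> B" "x \<in> S b" by blast
        thus "x \<in> \<Union>(\<Union>b\<in>B. \<D> b)" using \<D>(3)[OF b(1)] by blast
      qed
    qed
  qed
  have step: "\<exists>y :: 'p padic_int. \<not> good (cyl (Suc n) (residue y (Suc n))) \<and> residue y n = residue x n"
    if "\<not> good (cyl n (residue x n))" for n and x :: "'p padic_int"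
  proof (rule ccontr)
    assume "\<nexists>y :: 'p padic_int. \<not> good (cyl (Suc n) (residue y (Suc n))) \<and> residue y n = residue x n"
    hence g: "good (cyl (Suc n) (residue y (Suc n)))" if "residue y n = residue x n" for y :: "'p padic_int"
      using that by blast
    define B where "B = {residue y (Suc n) | y :: 'p padic_int. residue y n = residue x n}"
    have "B \<subseteq> {0..<pp TYPE('p) (Suc n)}"
    proof
      fix b assume "b \<in> B"
      then obtain y :: "'p padic_int" where "b = residue y (Suc n)" unfolding B_def by blast
      thus "b \<in> {0..<pp TYPE('p) (Suc n)}" using residue_range[of y "Suc n"] by (simp only: atLeastLessThan_iff)
    qed
    hence "finite B" by (rule finite_subset) simp
    hence "good (\<Union>b\<in>B. cyl (Suc n) b)" by (rule good_UN) (use g in \<open>auto simp: B_def\<close>)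
    moreover have "cyl n (residue x n) \<subseteq> (\<Union>b\<in>B. cyl (Suc n) b :: 'p padic_int set)" by (auto simp: cyl_def B_def)
    ultimately show False using that unfolding good_def by (meson order_trans)
  qed
  have "good UNIV"
  proof (rule ccontr)
    assume "\<not> good UNIV"
    moreover have "residue y 0 = 0" for y :: "'p padic_int" using residue_range[of y 0] by simp
    hence "cyl 0 (residue (0 :: 'p padic_int) 0) = (UNIV :: 'p padic_int set)" by (simp add: cyl_def)
    ultimately have "\<not> good (cyl 0 (residue (0 :: 'p padic_int) 0))" by simp
    then obtain f :: "nat \<Rightarrow> 'p padic_int" where f: "\<And>n. \<not> good (cyl n (residue (f n) n))" "\<And>n. residue (f (Suc n)) n = residue (f n) n"
      using dependent_nat_choice[of "\<lambda>n x. \<not> good (cyl n (residue x n))" "\<lambda>n x y. residue y n = residue x n"] step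
      by metis
    have "unif ^ k dvd f (Suc k) - f k" for k using f(2) by (simp add: unif_power_dvd_diff_iff)
    then obtain l where l0: "\<And>k. unif ^ k dvd l - f k" using padic_int_limit[of f] by blast
    have l: "residue l n = residue (f n) n" for n using l0[of n] by (simp add: unif_power_dvd_diff_iff)
    obtain C where C: "C \<in> \<C>" "l \<in> C" using \<C>(2) by blast
    obtain n where "cyl n (residue l n) \<subseteq> C" using \<C>(1) C unfolding padic_open_iff by blast
    hence "good (cyl n (residue (f n) n))" unfolding good_def using C(1) l by (intro exI[of _ "{C}"]) auto
    thus False using f(1) by blast
  qed
  thus "\<exists>\<D>\<subseteq>\<C>. finite \<D> \<and> UNIV \<subseteq> \<Union>\<D>" by (simp add: good_def)
qed

lemma tendsto_padic_iff:
  "(f \<longlongrightarrow> (l :: 'p::prime_card padic_int)) F \<longleftrightarrow> (\<forall>n. eventually (\<lambda>x. residue (f x) n = residue l n) F)"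
proof
  assume *: "(f \<longlongrightarrow> l) F"
  show "\<forall>n. eventually (\<lambda>x. residue (f x) n = residue l n) F"
  proof
    fix n
    have "eventually (\<lambda>x. f x \<in> cyl n (residue l n)) F"
      by (rule topological_tendstoD[OF * open_cyl]) (simp add: cyl_def)
    thus "eventually (\<lambda>x. residue (f x) n = residue l n) F" by (simp add: cyl_def)
  qed
next
  assume *: "\<forall>n. eventually (\<lambda>x. residue (f x) n = residue l n) F"
  show "(f \<longlongrightarrow> l) F"
  proof (rule topological_tendstoI)
    fix U :: "'p padic_int set" assume "open U" "l \<in> U"
    then obtain n where n: "cyl n (residue l n) \<subseteq> U" by (auto simp: padic_open_iff)
    show "eventually (\<lambda>x. f x \<in> U) F"
      using *[rule_format, of n] by eventually_elim (use n in \<open>auto simp: cyl_def\<close>)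
  qed
qed

lemma eventually_residue_fst_snd:
  "eventually (\<lambda>x. residue (fst x) n = residue a n \<and> residue (snd x) n = residue b n)
     (nhds (a :: 'p::prime_card padic_int) \<times>\<^sub>F nhds b)"
proof (rule eventually_conj)
  show "eventually (\<lambda>x. residue (fst x) n = residue a n) (nhds a \<times>\<^sub>F nhds b)"
    using filterlim_fst[of "nhds a" "nhds b"] tendsto_padic_iff by blast
  show "eventually (\<lambda>x. residue (snd x) n = residue b n) (nhds a \<times>\<^sub>F nhds b)"
    using filterlim_snd[of "nhds b" "nhds a"] tendsto_padic_iff by blast
qed

instance padic_int :: (prime_card) topological_comm_monoid_add
proof
  fix a b :: "'a padic_int"
  show "((\<lambda>x. fst x + snd x) \<longlongrightarrow> a + b) (nhds a \<times>\<^sub>F nhds b)"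
    unfolding tendsto_padic_iff
  proof
    fix n
    show "eventually (\<lambda>x. residue (fst x + snd x) n = residue (a + b) n) (nhds a \<times>\<^sub>F nhds b)"
      by (rule eventually_mono[OF eventually_residue_fst_snd[of n a b]]) (simp add: residue_add)
  qed
qed

instance padic_int :: (prime_card) topological_semigroup_mult
proof
  fix a b :: "'a padic_int"
  show "((\<lambda>x. fst x * snd x) \<longlongrightarrow> a * b) (nhds a \<times>\<^sub>F nhds b)"
    unfolding tendsto_padic_iff
  proof
    fix n
    show "eventually (\<lambda>x. residue (fst x * snd x) n = residue (a * b) n) (nhds a \<times>\<^sub>F nhds b)"
      by (rule eventually_mono[OF eventually_residue_fst_snd[of n a b]]) (simp add: residue_mult)
  qed
qed

lemma closed_cyl: "closed (cyl n a :: 'p::prime_card padic_int set)"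
proof -
  have "- cyl n a = (\<Union>b\<in>-{a}. cyl n b :: 'p padic_int set)" by (auto simp: cyl_def)
  thus ?thesis unfolding closed_def by (metis open_UN open_cyl)
qed

lemma compact_Pi:
  fixes C :: "nat \<Rightarrow> 'p::prime_card padic_int set"
  assumes "\<And>i. closed (C i)"
  shows "compact {b. \<forall>i. b i \<in> C i}"
proof -
  have "compact (C i)" for i
    using compact_Int_closed[OF compact_UNIV_padic assms[of i]] by simp
  hence "compactin (product_topology (\<lambda>i. euclidean) UNIV) (PiE UNIV C)"
    unfolding compactin_PiE by simp
  moreover have "PiE UNIV C = {b. \<forall>i. b i \<in> C i}" by auto
  ultimately show ?thesis by (simp add: euclidean_product_topology)
qed

lemma Hausdorff_space_padic: "Hausdorff_space (euclidean :: 'p::prime_card padic_int topology)"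
  unfolding Hausdorff_space_def disjnt_def
proof (intro allI impI)
  fix x y :: "'p padic_int"
  assume "x \<in> topspace euclidean \<and> y \<in> topspace euclidean \<and> x \<noteq> y"
  then obtain U V where "open U" "open V" "x \<in> U" "y \<in> V" "U \<inter> V = {}" using hausdorff by metis
  thus "\<exists>U V. openin euclidean U \<and> openin euclidean V \<and> x \<in> U \<and> y \<in> V \<and> U \<inter> V = {}"
    unfolding open_openin[symmetric] by blast
qed

lemma compact_imp_borel_padic_seq:
  assumes "compact (S :: (nat \<Rightarrow> 'p::prime_card padic_int) set)"
  shows "S \<in> sets borel"
proof -
  have "Hausdorff_space (product_topology (\<lambda>i::nat. euclidean :: 'p padic_int topology) UNIV)"
    unfolding Hausdorff_space_product_topology using Hausdorff_space_padic by blast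
  hence "closedin euclidean S" using assms
    by (intro compactin_imp_closedin) (simp_all add: euclidean_product_topology)
  thus ?thesis by (simp add: borel_closed)
qed

text \<open>Borel sets are not stable under continuous images, whereas countable unions of compact
  sets are. This matters for the multiplication of polynomials.\<close>

definition sigma_compact_polys :: "'p::prime_card padic_int poly set \<Rightarrow> bool" where
  "sigma_compact_polys S \<longleftrightarrow> (\<exists>\<F>. countable \<F> \<and> (\<forall>F\<in>\<F>. compact (coeff ` F)) \<and> S = \<Union>\<F>)"

lemma sigma_compact_polys_UN:
  assumes "countable I" "\<And>i. i \<in> I \<Longrightarrow> sigma_compact_polys (S i)"
  shows "sigma_compact_polys (\<Union>i\<in>I. S i)"
proof -
  obtain \<F> where "\<And>i. i \<in> I \<Longrightarrow> countable (\<F> i) \<and> (\<forall>F\<in>\<F> i. compact (coeff ` F)) \<and> S i = \<Union>(\<F> i)"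
    using assms(2) unfolding sigma_compact_polys_def by metis
  thus ?thesis unfolding sigma_compact_polys_def using assms(1)
    by (intro exI[of _ "\<Union>i\<in>I. \<F> i"]) auto
qed

lemma compact_coeff_mult:
  assumes "compact (coeff ` F)" "compact (coeff ` G)"
  shows "compact (coeff ` (\<lambda>(A, B). A * B) ` (F \<times> G :: ('p::prime_card padic_int poly \<times> _) set))"
proof -
  define conv :: "(nat \<Rightarrow> 'p padic_int) \<times> (nat \<Rightarrow> 'p padic_int) \<Rightarrow> nat \<Rightarrow> 'p padic_int"
    where "conv = (\<lambda>ab k. \<Sum>i\<le>k. fst ab i * snd ab (k - i))"
  have "continuous_on UNIV (\<lambda>ab :: (nat \<Rightarrow> 'p padic_int) \<times> (nat \<Rightarrow> 'p padic_int). fst ab i)"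
    "continuous_on UNIV (\<lambda>ab :: (nat \<Rightarrow> 'p padic_int) \<times> (nat \<Rightarrow> 'p padic_int). snd ab i)" for i
    by (rule continuous_on_product_then_coordinatewise, intro continuous_intros)+
  hence "continuous_on UNIV conv"
    unfolding conv_def
    by (intro continuous_on_coordinatewise_then_product continuous_on_sum continuous_on_mult')
  hence "compact (conv ` (coeff ` F \<times> coeff ` G))"
    by (intro compact_continuous_image compact_Times assms) (rule continuous_on_subset, auto)
  moreover have "conv (coeff A, coeff B) = coeff (A * B)" for A B :: "'p padic_int poly"
    by (auto simp: conv_def coeff_mult fun_eq_iff)
  hence "coeff ` (\<lambda>(A, B). A * B) ` (F \<times> G) = conv ` (coeff ` F \<times> coeff ` G)"
    by (force simp: image_iff)
  ultimately show ?thesis by simp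
qed

lemma sigma_compact_polys_mult:
  assumes "sigma_compact_polys S" "sigma_compact_polys T"
  shows "sigma_compact_polys ((\<lambda>(A, B). A * B) ` (S \<times> T))"
proof -
  obtain \<F> \<G> where \<F>: "countable \<F>" "\<And>F. F \<in> \<F> \<Longrightarrow> compact (coeff ` F)" "S = \<Union>\<F>"
    and \<G>: "countable \<G>" "\<And>G. G \<in> \<G> \<Longrightarrow> compact (coeff ` G)" "T = \<Union>\<G>"
    using assms unfolding sigma_compact_polys_def by metis
  have "countable ((\<lambda>(F, G). (\<lambda>(A, B). A * B) ` (F \<times> G)) ` (\<F> \<times> \<G>))" using \<F> \<G> by simp
  moreover have "compact (coeff ` H)" if H: "H \<in> (\<lambda>(F, G). (\<lambda>(A, B). A * B) ` (F \<times> G)) ` (\<F> \<times> \<G>)" for H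
  proof -
    obtain F G where "F \<in> \<F>" "G \<in> \<G>" "H = (\<lambda>(A, B). A * B) ` (F \<times> G)" using H by auto
    thus ?thesis using compact_coeff_mult[OF \<F>(2) \<G>(2)] by simp
  qed
  moreover have "(\<lambda>(A, B). A * B) ` (S \<times> T) = \<Union>((\<lambda>(F, G). (\<lambda>(A, B). A * B) ` (F \<times> G)) ` (\<F> \<times> \<G>))"
  proof (intro equalityI subsetI)
    fix P assume "P \<in> (\<lambda>(A, B). A * B) ` (S \<times> T)"
    then obtain A B where AB: "A \<in> S" "B \<in> T" "P = A * B" by auto
    then obtain F G where FG: "F \<in> \<F>" "A \<in> F" "G \<in> \<G>" "B \<in> G" using \<F>(3) \<G>(3) by blast
    have "P \<in> (\<lambda>(A, B). A * B) ` (F \<times> G)" using AB(3) FG by (intro image_eqI[of _ _ "(A, B)"]) auto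
    moreover have "(\<lambda>(A, B). A * B) ` (F \<times> G) \<in> (\<lambda>(F, G). (\<lambda>(A, B). A * B) ` (F \<times> G)) ` (\<F> \<times> \<G>)"
      using FG by (intro image_eqI[of _ _ "(F, G)"]) auto
    ultimately show "P \<in> \<Union>((\<lambda>(F, G). (\<lambda>(A, B). A * B) ` (F \<times> G)) ` (\<F> \<times> \<G>))" by (rule UnionI[rotated])
  next
    fix P assume "P \<in> \<Union>((\<lambda>(F, G). (\<lambda>(A, B). A * B) ` (F \<times> G)) ` (\<F> \<times> \<G>))"
    then obtain F G A B where "F \<in> \<F>" "G \<in> \<G>" "A \<in> F" "B \<in> G" "P = A * B" by auto
    thus "P \<in> (\<lambda>(A, B). A * B) ` (S \<times> T)" using \<F>(3) \<G>(3) by (intro image_eqI[of _ _ "(A, B)"]) auto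
  qed
  ultimately show ?thesis unfolding sigma_compact_polys_def by blast
qed

lemma sigma_compact_polys_borel: "sigma_compact_polys S \<Longrightarrow> coeff ` S \<in> sets borel"
proof -
  assume "sigma_compact_polys S"
  then obtain \<F> where \<F>: "countable \<F>" "\<And>F. F \<in> \<F> \<Longrightarrow> compact (coeff ` F)" "S = \<Union>\<F>"
    unfolding sigma_compact_polys_def by metis
  have "(\<Union>F\<in>\<F>. coeff ` F) \<in> sets borel"
    by (intro sets.countable_UN'' \<F>(1) compact_imp_borel_padic_seq \<F>(2))
  thus ?thesis by (simp add: \<F>(3) image_Union)
qed

text \<open>A ball is given by a precision and finitely many residues, so there are only countably
  many balls, and each is compact as a product of cylinders.\<close>

lemma sigma_compact_polys_open:
  fixes S :: "'p::prime_card padic_int poly set"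
  assumes "\<And>P. P \<in> S \<Longrightarrow> degree P \<le> n \<Longrightarrow>
    \<exists>N. \<forall>H. degree H \<le> n \<longrightarrow> [:unif ^ N:] dvd H - P \<longrightarrow> H \<in> S"
  shows "sigma_compact_polys {P\<in>S. degree P \<le> n}"
proof -
  define ball :: "nat \<times> int list \<Rightarrow> 'p padic_int poly set" where
    "ball = (\<lambda>(N, l). {H. degree H \<le> n \<and> (\<forall>i\<le>n. residue (coeff H i) N = l ! i)})"
  define \<F> where "\<F> = ball ` {Nl. ball Nl \<subseteq> S}"
  have "countable \<F>" unfolding \<F>_def by (intro countable_image) simp
  moreover have "compact (coeff ` F)" if F\<F>: "F \<in> \<F>" for F
  proof -
    obtain Nl where "F = ball Nl" using F\<F> by (auto simp: \<F>_def)
    then obtain N l where F: "F = ball (N, l)" by (metis surj_pair)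
    \<comment> \<open>Beyond \<open>n\<close> the factor is the single point \<open>0\<close>, so
      members of the product are coefficient sequences of polynomials of degree at most
      \<open>n\<close>.\<close>
    define C where "C i = (if i \<le> n then cyl N (l ! i) else {0 :: 'p padic_int})" for i
    have "compact {b. \<forall>i. b i \<in> C i}" by (rule compact_Pi) (simp add: C_def closed_cyl)
    moreover have "coeff ` F = {b. \<forall>i. b i \<in> C i}"
    proof (intro equalityI subsetI)
      fix b assume "b \<in> coeff ` F"
      thus "b \<in> {b. \<forall>i. b i \<in> C i}" by (auto simp: F ball_def C_def cyl_def coeff_eq_0)
    next
      fix b assume b: "b \<in> {b. \<forall>i. b i \<in> C i}"
      define H where "H = (\<Sum>i\<le>n. monom (b i) i)"
      have cH: "coeff H i = b i" for i
        using b[THEN CollectD, rule_format, of i] by (auto simp: H_def coeff_sum C_def split: if_splits)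
      have "b i = 0" if "i > n" for i using b[THEN CollectD, rule_format, of i] that by (simp add: C_def)
      hence "degree H \<le> n" by (intro degree_le) (simp add: cH)
      moreover have "residue (coeff H i) N = l ! i" if "i \<le> n" for i
        using b[THEN CollectD, rule_format, of i] that by (simp add: C_def cyl_def cH)
      ultimately have "H \<in> F" by (simp add: F ball_def)
      moreover have "b = coeff H" by (simp add: cH fun_eq_iff)
      ultimately show "b \<in> coeff ` F" by blast
    qed
    ultimately show ?thesis by simp
  qed
  moreover have "{P\<in>S. degree P \<le> n} = \<Union>\<F>"
  proof (intro equalityI subsetI)
    fix P assume "P \<in> {P\<in>S. degree P \<le> n}"
    hence P: "P \<in> S" "degree P \<le> n" by auto
    then obtain N where N: "\<And>H. degree H \<le> n \<Longrightarrow> [:unif ^ N:] dvd H - P \<Longrightarrow> H \<in> S" using assms by blast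
    define l where "l = map (\<lambda>i. residue (coeff P i) N) [0..<Suc n]"
    have l: "l ! i = residue (coeff P i) N" if "i \<le> n" for i using that by (simp add: l_def del: upt_Suc)
    have "ball (N, l) \<subseteq> S"
    proof
      fix H assume "H \<in> ball (N, l)"
      hence H: "degree H \<le> n" "\<And>i. i \<le> n \<Longrightarrow> residue (coeff H i) N = residue (coeff P i) N"
        by (auto simp: ball_def l)
      have "unif ^ N dvd coeff H i - coeff P i" for i
        using H P(2) by (cases "i \<le> n") (simp_all add: unif_power_dvd_diff_iff coeff_eq_0)
      hence "[:unif ^ N:] dvd H - P" by (simp add: const_poly_dvd_iff)
      thus "H \<in> S" using N H(1) by blast
    qed
    moreover have "P \<in> ball (N, l)" using P(2) by (simp add: ball_def l)
    ultimately show "P \<in> \<Union>\<F>" by (auto simp: \<F>_def)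
  qed (auto simp: \<F>_def ball_def)
  ultimately show ?thesis unfolding sigma_compact_polys_def by blast
qed

lemma sigma_compact_polys_open':
  fixes S :: "'p::prime_card padic_int poly set"
  assumes "\<And>P n. P \<in> S \<Longrightarrow> degree P \<le> n \<Longrightarrow>
    \<exists>N. \<forall>H. degree H \<le> n \<longrightarrow> [:unif ^ N:] dvd H - P \<longrightarrow> H \<in> S"
  shows "sigma_compact_polys S"
proof -
  have "S = (\<Union>n. {P\<in>S. degree P \<le> n})" by auto
  thus ?thesis using sigma_compact_polys_UN[of UNIV "\<lambda>n. {P\<in>S. degree P \<le> n}"]
      sigma_compact_polys_open[OF assms] by simp
qed

section \<open>Roots that generate a given field\<close>

definition field_zeros :: "'p::prime_card padic alg_closure set \<Rightarrow> 'p padic_int poly \<Rightarrow> nat" where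
  "field_zeros K P = size (filter_mset (\<lambda>x. adjoin x = K) (zeros P))"

lemma field_zeros_mult:
  "P \<noteq> 0 \<Longrightarrow> Q \<noteq> 0 \<Longrightarrow> field_zeros K (P * Q) = field_zeros K P + field_zeros K Q"
  by (simp add: field_zeros_def zeros_mult)

lemma simple_root_polys_imp_field_zeros:
  assumes "P \<in> simple_root_polys K i" "P \<noteq> 0"
  shows "i \<le> field_zeros K P"
proof -
  obtain S where S: "finite S" "card S = i" "\<forall>x\<in>S. adjoin x = K \<and> ev P x = 0"
    using assms(1) by (auto simp: simple_root_polys_def)
  let ?M = "filter_mset (\<lambda>x. adjoin x = K) (zeros P)"
  have "i \<le> card (set_mset ?M)"
    unfolding S(2)[symmetric] by (rule card_mono[OF finite_set_mset]) (use S set_zeros[OF assms(2)] in auto)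
  also have "\<dots> \<le> size ?M"
    using size_mset_mono[OF mset_set_set_mset_msubset[of ?M]] by simp
  finally show ?thesis by (simp add: field_zeros_def)
qed

lemma count_zeros_simple:
  assumes "P \<noteq> 0" "ev P x = 0" "ev (pderiv P) x \<noteq> 0"
  shows "count (zeros P) x = 1"
proof -
  let ?p = "map_poly of_Zp P"
  have p: "?p \<noteq> 0" "poly ?p x = 0" using assms by (simp_all add: ev_def)
  have "order x ?p > 0" using p order_root by blast
  moreover have "\<not> order x ?p \<ge> 2"
  proof
    assume "order x ?p \<ge> 2"
    hence "[:- x, 1:] ^ 2 dvd ?p" using p(1) by (simp add: order_divides)
    then obtain q where q: "?p = [:- x, 1:] ^ 2 * q" by (elim dvdE)
    define R where "R = [:- x, 1:] * q"
    have "?p = [:- x, 1:] * R" by (simp add: q R_def power2_eq_square mult.assoc del: mult_pCons_left)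
    moreover have "poly R x = 0" by (simp add: R_def)
    ultimately have "poly (pderiv ?p) x = 0" by (simp add: pderiv_mult del: mult_pCons_left)
    thus False using assms(3) by (simp add: ev_def of_Zp.map_poly_pderiv)
  qed
  ultimately show ?thesis using p(1) by (simp add: zeros_def)
qed

text \<open>The primitive minimal annihilator of a root is split off. Its own roots in
  \<open>K\<close> with the right field are simple, so on this factor multiplicities can be
  ignored.\<close>

lemma field_zeros_split:
  fixes P :: "'p::prime_card padic_int poly"
  assumes "P \<noteq> 0" "field_zeros K P > 0"
  obtains G Q where "P = G * Q" "G \<noteq> 0" "Q \<noteq> 0" "field_zeros K G > 0" "G \<in> simple_root_polys K (field_zeros K G)"
proof -
  have "filter_mset (\<lambda>x. adjoin x = K) (zeros P) \<noteq> {#}"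
  proof
    assume empty: "filter_mset (\<lambda>x. adjoin x = K) (zeros P) = {#}"
    show False using assms(2) unfolding field_zeros_def empty by simp
  qed
  then obtain x where "x \<in># filter_mset (\<lambda>x. adjoin x = K) (zeros P)" by (meson multiset_nonemptyE)
  hence x: "adjoin x = K" "ev P x = 0" using set_zeros[OF assms(1)] by auto
  obtain G where G: "red_poly G \<noteq> 0" "degree G = adeg x" "ev G x = 0" by (rule ex_primitive_annihilator)
  then obtain Q where Q: "P = G * Q" using primitive_annihilator_dvd x(2) by (metis dvdE)
  have nz: "G \<noteq> 0" "Q \<noteq> 0" using G(1) Q assms(1) by auto
  let ?S = "{y. adjoin y = K \<and> ev G y = 0}"
  \<comment> \<open>All generators of \<open>K\<close> have the same degree, so \<open>G\<close> is
    a minimal annihilator of each \<open>y\<close> in \<open>?S\<close>.\<close>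
  have simple: "ev (pderiv G) y \<noteq> 0" if "y \<in> ?S" for y
    using that pderiv_min_annihilator[of G y] nz(1) G(2) adeg_eq_if_adjoin_eq[of y x] x(1) by simp
  have S: "?S = set_mset (filter_mset (\<lambda>x. adjoin x = K) (zeros G))" using set_zeros[OF nz(1)] by auto
  hence fin: "finite ?S" by (metis finite_set_mset)
  have "filter_mset (\<lambda>x. adjoin x = K) (zeros G) = mset_set ?S"
  proof (rule multiset_eqI)
    fix y
    show "count (filter_mset (\<lambda>x. adjoin x = K) (zeros G)) y = count (mset_set ?S) y"
    proof (cases "y \<in> ?S")
      case True
      thus ?thesis using count_zeros_simple[OF nz(1) _ simple[OF True]] fin by simp
    next
      case False
      hence "y \<notin># filter_mset (\<lambda>x. adjoin x = K) (zeros G)" unfolding S .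
      hence "count (filter_mset (\<lambda>x. adjoin x = K) (zeros G)) y = 0" by (simp only: not_in_iff)
      thus ?thesis using count_mset_set(3)[OF False] by simp
    qed
  qed
  hence card: "field_zeros K G = card ?S" by (simp add: field_zeros_def)
  moreover have "x \<in> ?S" using x G(3) by simp
  hence "?S \<noteq> {}" by blast
  hence "card ?S > 0" using fin by (simp only: card_gt_0_iff simp_thms)
  moreover have "G \<in> simple_root_polys K (card ?S)"
    unfolding simple_root_polys_def using fin simple by (intro CollectI exI[of _ ?S]) auto
  ultimately show thesis using that Q nz by simp
qed

text \<open>For \<open>k > 0\<close> such polynomials are the products of some \<open>A\<close> with
  at least \<open>i\<close> simple roots generating \<open>K\<close> and some \<open>B\<close>
  counted at level \<open>k - i\<close>. The first condition is open, the second is covered by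
  induction since \<open>i\<close> is positive; for \<open>i\<close> at least \<open>k\<close> it
  only says that \<open>B\<close> is nonzero.\<close>

lemma sigma_compact_field_zeros:
  "sigma_compact_polys {P :: 'p::prime_card padic_int poly. P \<noteq> 0 \<and> field_zeros K P \<ge> k}"
proof (induction k rule: less_induct)
  case (less k)
  show ?case
  proof (cases "k = 0")
    case True
    have "\<exists>N. \<forall>H. degree H \<le> n \<longrightarrow> [:unif ^ N:] dvd H - P \<longrightarrow> H \<in> {P. P \<noteq> 0}"
      if "P \<in> {P. P \<noteq> 0}" for P :: "'p padic_int poly" and n
    proof -
      have "P \<noteq> 0" using that by simp
      then obtain N where N: "\<not> [:unif ^ N:] dvd P" using poly_eq_0I by blast
      have "H \<noteq> 0" if "[:unif ^ N:] dvd H - P" for H using that N by auto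
      thus ?thesis by blast
    qed
    hence "sigma_compact_polys {P :: 'p padic_int poly. P \<noteq> 0}" by (rule sigma_compact_polys_open')
    thus ?thesis using True by simp
  next
    case False
    let ?T = "\<lambda>k. {P :: 'p padic_int poly. P \<noteq> 0 \<and> field_zeros K P \<ge> k}"
    have nz: "P \<noteq> 0" if "P \<in> simple_root_polys K i" "i > 0" for P :: "'p padic_int poly" and i
      using that by (auto simp: simple_root_polys_def card_gt_0_iff)
    have "?T k = (\<Union>i\<in>{1..}. (\<lambda>(A, B). A * B) ` (simple_root_polys K i \<times> ?T (k - i)))"
    proof (intro equalityI subsetI)
      fix P assume P: "P \<in> ?T k"
      hence "P \<noteq> 0" "field_zeros K P > 0" using False by auto
      then obtain G Q where GQ: "P = G * Q" "G \<noteq> 0" "Q \<noteq> 0" "field_zeros K G > 0"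
        "G \<in> simple_root_polys K (field_zeros K G)" by (rule field_zeros_split)
      have "Q \<in> ?T (k - field_zeros K G)" using P GQ by (auto simp: field_zeros_mult)
      hence "P \<in> (\<lambda>(A, B). A * B) ` (simple_root_polys K (field_zeros K G) \<times> ?T (k - field_zeros K G))"
        using GQ by (intro image_eqI[of _ _ "(G, Q)"]) simp_all
      thus "P \<in> (\<Union>i\<in>{1..}. (\<lambda>(A, B). A * B) ` (simple_root_polys K i \<times> ?T (k - i)))"
        using GQ(4) by (intro UN_I[of "field_zeros K G"]) simp_all
    next
      fix P assume "P \<in> (\<Union>i\<in>{1..}. (\<lambda>(A, B). A * B) ` (simple_root_polys K i \<times> ?T (k - i)))"
      then obtain i A B where *: "i \<ge> 1" "A \<in> simple_root_polys K i" "B \<in> ?T (k - i)" "P = A * B" by auto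
      have A: "A \<noteq> 0" using nz * by auto
      have "i \<le> field_zeros K A" by (rule simple_root_polys_imp_field_zeros[OF *(2) A])
      thus "P \<in> ?T k" using * A by (auto simp: field_zeros_mult)
    qed
    moreover have "sigma_compact_polys (\<Union>i\<in>{1..}. (\<lambda>(A, B). A * B) ` (simple_root_polys K i \<times> ?T (k - i)))"
    proof (intro sigma_compact_polys_UN sigma_compact_polys_mult)
      show "sigma_compact_polys (simple_root_polys K i :: 'p padic_int poly set)" for i
        by (rule sigma_compact_polys_open') (rule simple_root_polys_open)
      show "sigma_compact_polys (?T (k - i))" if "i \<in> {1..}" for i
        by (rule less.IH) (use that False in auto)
    qed simp
    ultimately show ?thesis by simp
  qed
qed

lemma sets_haar [simp]: "sets haar = sets (borel :: 'p::prime_card padic_int measure)"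
  by (rule is_haar_prob_haar[unfolded is_haar_prob_def, THEN conjunct2, THEN conjunct1])

lemma coeff_poly_of_coeffs: "coeff (poly_of_coeffs n a) i = (if i \<le> n then a i else 0)"
  by (simp add: poly_of_coeffs_def coeff_sum)

lemma field_zeros_0 [simp]: "field_zeros K 0 = 0"
  by (simp add: field_zeros_def zeros_def)

lemma measurable_field_zeros [measurable]:
  "(\<lambda>a. field_zeros K (poly_of_coeffs n a)) \<in> measurable (\<Pi>\<^sub>M i\<in>{..n}. haar) (count_space UNIV)"
    (is "?f \<in> measurable ?M _")
proof -
  have phi: "(\<lambda>a. coeff (poly_of_coeffs n a)) \<in> measurable ?M (borel :: (nat \<Rightarrow> 'a padic_int) measure)"
  proof -
    have "(\<lambda>a i. coeff (poly_of_coeffs n a) i) \<in> measurable ?M (\<Pi>\<^sub>M i\<in>UNIV. (borel :: 'a padic_int measure))"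
    proof (rule measurable_PiM_single')
      fix i :: nat
      show "(\<lambda>a. coeff (poly_of_coeffs n a) i) \<in> measurable ?M (borel :: 'a padic_int measure)"
      proof (cases "i \<le> n")
        case True
        hence "(\<lambda>a. a i) \<in> measurable ?M (haar :: 'a padic_int measure)"
          by (intro measurable_component_singleton) simp
        hence "(\<lambda>a. a i) \<in> measurable ?M (borel :: 'a padic_int measure)"
          unfolding measurable_cong_sets[OF refl sets_haar] .
        thus ?thesis using True by (simp add: coeff_poly_of_coeffs)
      qed (simp add: coeff_poly_of_coeffs)
    qed auto
    thus ?thesis unfolding measurable_cong_sets[OF refl sets_PiM_equal_borel] .
  qed
  have level: "{a \<in> space ?M. field_zeros K (poly_of_coeffs n a) \<ge> k} \<in> sets ?M" for k
  proof (cases "k = 0")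
    case False
    have "{a \<in> space ?M. field_zeros K (poly_of_coeffs n a) \<ge> k} =
      (\<lambda>a. coeff (poly_of_coeffs n a)) -` (coeff ` {P. P \<noteq> 0 \<and> field_zeros K P \<ge> k}) \<inter> space ?M"
    proof (intro equalityI subsetI)
      fix a assume a: "a \<in> {a \<in> space ?M. field_zeros K (poly_of_coeffs n a) \<ge> k}"
      hence "poly_of_coeffs n a \<noteq> 0" using False by auto
      thus "a \<in> (\<lambda>a. coeff (poly_of_coeffs n a)) -` (coeff ` {P. P \<noteq> 0 \<and> field_zeros K P \<ge> k}) \<inter> space ?M"
        using a by simp
    next
      fix a assume "a \<in> (\<lambda>a. coeff (poly_of_coeffs n a)) -` (coeff ` {P. P \<noteq> 0 \<and> field_zeros K P \<ge> k}) \<inter> space ?M"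
      then obtain P where P: "coeff (poly_of_coeffs n a) = coeff P" "field_zeros K P \<ge> k" "a \<in> space ?M" by auto
      have "poly_of_coeffs n a = P" using P(1) by (simp add: coeff_inject)
      thus "a \<in> {a \<in> space ?M. field_zeros K (poly_of_coeffs n a) \<ge> k}" using P by simp
    qed
    also have "\<dots> \<in> sets ?M"
      by (rule measurable_sets[OF phi sigma_compact_polys_borel[OF sigma_compact_field_zeros]])
    finally show ?thesis .
  qed simp
  show ?thesis
  proof (rule measurable_count_space_eq2_countable[THEN iffD2], intro conjI ballI)
    fix k :: nat
    have "?f -` {k} \<inter> space ?M = {a \<in> space ?M. ?f a \<ge> k} - {a \<in> space ?M. ?f a \<ge> Suc k}" by auto
    thus "?f -` {k} \<inter> space ?M \<in> sets ?M" using level by simp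
  qed auto
qed

section \<open>The expected number of roots of low degree\<close>

lemma prob_space_haar: "prob_space (haar :: 'p::prime_card padic_int measure)"
  by (rule is_haar_prob_haar[unfolded is_haar_prob_def, THEN conjunct1])

lemma space_haar [simp]: "space (haar :: 'p::prime_card padic_int measure) = UNIV"
  using sets_eq_imp_space_eq[OF sets_haar] by simp

abbreviation coeff_space :: "nat \<Rightarrow> (nat \<Rightarrow> 'p::prime_card padic_int) measure" where
  "coeff_space n \<equiv> \<Pi>\<^sub>M i\<in>{..n}. haar"

lemma prob_space_coeff_space: "prob_space (coeff_space n)"
  by (rule prob_space_PiM) (rule prob_space_haar)

lemma emeasure_haar_cyl:
  assumes "0 \<le> a" "a < pp TYPE('p) k"
  shows "emeasure haar (cyl k a :: 'p::prime_card padic_int set) = ennreal (1 / real CARD('p) ^ k)"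
proof -
  interpret prob_space "haar :: 'p padic_int measure" by (rule prob_space_haar)
  show ?thesis using is_haar_prob_cyl[OF is_haar_prob_haar assms] by (simp add: emeasure_eq_measure)
qed

lemma to_int_mod_ring_of_int:
  assumes "0 \<le> k" "k < int CARD('p)"
  shows "to_int_mod_ring (of_int k :: 'p::prime_card mod_ring) = k"
  using assms by (simp add: of_int_of_int_mod_ring)

lemma red_vimage_eq_cyl: "{x :: 'p::prime_card padic_int. red x = a} = cyl 1 (to_int_mod_ring a)"
proof -
  have "red x = a \<longleftrightarrow> residue x 1 = to_int_mod_ring a" for x :: "'p padic_int"
  proof -
    have r: "to_int_mod_ring (red x) = residue x 1"
      using residue_range[of x 1] by (simp add: red_def to_int_mod_ring_of_int)
    show ?thesis unfolding r[symmetric] by (metis of_int_mod_ring_to_int_mod_ring)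
  qed
  thus ?thesis by (simp add: cyl_def)
qed

lemma emeasure_red_vimage: "emeasure haar {x :: 'p::prime_card padic_int. red x = a} = ennreal (1 / real CARD('p))"
proof -
  have "to_int_mod_ring a \<in> {0..<int CARD('p)}"
    using range_to_int_mod_ring[where 'a='p] by blast
  thus ?thesis using emeasure_haar_cyl[of "to_int_mod_ring a" 1, where 'p='p] by (simp add: red_vimage_eq_cyl)
qed

lemma sets_red_vimage: "{x :: 'p::prime_card padic_int. red x = a} \<in> sets haar"
  by (simp add: red_vimage_eq_cyl)

lemma red_poly_of_coeffs_event:
  fixes Q :: "'p::prime_card mod_ring poly"
  assumes "Q \<in> polys_below (Suc n)"
  shows "{a \<in> space (coeff_space n). red_poly (poly_of_coeffs n a) = Q} =
    {a \<in> space (coeff_space n). \<forall>i\<in>{..n}. a i \<in> {x. red x = coeff Q i}}"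
proof -
  have "red_poly (poly_of_coeffs n a) = Q \<longleftrightarrow> (\<forall>i\<in>{..n}. red (a i) = coeff Q i)" for a :: "nat \<Rightarrow> 'p padic_int"
    using assms by (auto simp: poly_eq_iff coeff_poly_of_coeffs polys_below_def)
  thus ?thesis by simp
qed

lemma prob_red_poly:
  fixes Q :: "'p::prime_card mod_ring poly"
  assumes "Q \<in> polys_below (Suc n)"
  shows "emeasure (coeff_space n) {a \<in> space (coeff_space n). red_poly (poly_of_coeffs n a) = Q} =
      ennreal (1 / real CARD('p) ^ Suc n)"
    and "{a \<in> space (coeff_space n). red_poly (poly_of_coeffs n a) = Q} \<in> sets (coeff_space n)"
proof -
  interpret product_prob_space "\<lambda>_ :: nat. haar :: 'p padic_int measure" "{..n}"
    by (intro product_prob_spaceI prob_space_haar)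
  have "emeasure (coeff_space n) {a \<in> space (coeff_space n). \<forall>i\<in>{..n}. a i \<in> {x. red x = coeff Q i}} =
      (\<Prod>i\<in>{..n}. emeasure haar {x :: 'p padic_int. red x = coeff Q i})"
    by (rule emeasure_PiM_Collect) (use sets_red_vimage in simp_all)
  also have "\<dots> = ennreal (1 / real CARD('p) ^ Suc n)"
    by (simp add: emeasure_red_vimage ennreal_power power_one_over del: power_Suc)
  finally show "emeasure (coeff_space n) {a \<in> space (coeff_space n). red_poly (poly_of_coeffs n a) = Q} =
      ennreal (1 / real CARD('p) ^ Suc n)"
    by (simp only: red_poly_of_coeffs_event[OF assms])
  have "{a \<in> space (coeff_space n). a i \<in> {x :: 'p padic_int. red x = coeff Q i}} \<in> sets (coeff_space n)"
    if "i \<in> {..n}" for i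
  proof -
    have "(\<lambda>a. a i) -` {x :: 'p padic_int. red x = coeff Q i} \<inter> space (coeff_space n) \<in> sets (coeff_space n)"
      by (rule measurable_sets[OF measurable_component_singleton[OF that] sets_red_vimage])
    thus ?thesis by (simp add: vimage_def Int_def conj_commute)
  qed
  thus "{a \<in> space (coeff_space n). red_poly (poly_of_coeffs n a) = Q} \<in> sets (coeff_space n)"
    unfolding red_poly_of_coeffs_event[OF assms] by (intro sets.sets_Collect_finite_All) simp_all
qed

lemma red_poly_of_coeffs_below: "red_poly (poly_of_coeffs n a) \<in> polys_below (Suc n)"
  by (simp add: polys_below_def coeff_poly_of_coeffs)

text \<open>The reduction is uniform on the finite set \<open>polys_below (Suc n)\<close>, so
  expectations become averages over polynomials over the residue field.\<close>

lemma nn_integral_red_poly: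
  fixes g :: "'p::prime_card mod_ring poly \<Rightarrow> real"
  assumes "\<And>Q. g Q \<ge> 0"
  shows "(\<integral>\<^sup>+a. ennreal (g (red_poly (poly_of_coeffs n a))) \<partial>coeff_space n) =
    ennreal ((\<Sum>Q\<in>polys_below (Suc n). g Q) / real CARD('p) ^ Suc n)"
proof -
  define E where "E Q = {a \<in> space (coeff_space n). red_poly (poly_of_coeffs n a) = Q}" for Q :: "'p mod_ring poly"
  have "(\<integral>\<^sup>+a. ennreal (g (red_poly (poly_of_coeffs n a))) \<partial>coeff_space n) =
      (\<integral>\<^sup>+a. (\<Sum>Q\<in>polys_below (Suc n). ennreal (g Q) * indicator (E Q) a) \<partial>coeff_space n)"
  proof (rule nn_integral_cong)
    fix a :: "nat \<Rightarrow> 'p padic_int" assume a: "a \<in> space (coeff_space n)"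
    have "(\<Sum>Q\<in>polys_below (Suc n). ennreal (g Q) * indicator (E Q) a) =
        (\<Sum>Q\<in>polys_below (Suc n). if Q = red_poly (poly_of_coeffs n a) then ennreal (g Q) else 0)"
      using a by (intro sum.cong refl) (auto simp: E_def indicator_def)
    also have "\<dots> = ennreal (g (red_poly (poly_of_coeffs n a)))"
      using red_poly_of_coeffs_below[of n a] by simp
    finally show "ennreal (g (red_poly (poly_of_coeffs n a))) = (\<Sum>Q\<in>polys_below (Suc n). ennreal (g Q) * indicator (E Q) a)" ..
  qed
  also have "\<dots> = (\<Sum>Q\<in>polys_below (Suc n). \<integral>\<^sup>+a. ennreal (g Q) * indicator (E Q) a \<partial>coeff_space n)"
  proof (rule nn_integral_sum)
    fix Q :: "'p mod_ring poly" assume Q: "Q \<in> polys_below (Suc n)"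
    have [measurable]: "E Q \<in> sets (coeff_space n)" using prob_red_poly(2)[OF Q] by (simp only: E_def)
    show "(\<lambda>a. ennreal (g Q) * indicator (E Q) a) \<in> borel_measurable (coeff_space n)" by measurable
  qed
  also have "\<dots> = (\<Sum>Q\<in>polys_below (Suc n). ennreal (g Q * (1 / real CARD('p) ^ Suc n)))"
  proof (rule sum.cong[OF refl])
    fix Q :: "'p mod_ring poly" assume Q: "Q \<in> polys_below (Suc n)"
    have "(\<integral>\<^sup>+a. ennreal (g Q) * indicator (E Q) a \<partial>coeff_space n) = ennreal (g Q) * emeasure (coeff_space n) (E Q)"
      using prob_red_poly(2)[OF Q] by (intro nn_integral_cmult_indicator) (simp only: E_def)
    also have "emeasure (coeff_space n) (E Q) = ennreal (1 / real CARD('p) ^ Suc n)"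
      unfolding E_def by (rule prob_red_poly(1)[OF Q])
    also have "ennreal (g Q) * \<dots> = ennreal (g Q * (1 / real CARD('p) ^ Suc n))"
      using assms by (intro ennreal_mult[symmetric]) auto
    finally show "(\<integral>\<^sup>+a. ennreal (g Q) * indicator (E Q) a \<partial>coeff_space n) =
      ennreal (g Q * (1 / real CARD('p) ^ Suc n))" .
  qed
  also have "\<dots> = ennreal (\<Sum>Q\<in>polys_below (Suc n). g Q * (1 / real CARD('p) ^ Suc n))"
    by (rule sum_ennreal) (use assms in auto)
  finally show ?thesis by (simp add: sum_divide_distrib)
qed

text \<open>A point lies in cylinders of arbitrarily small measure. The lower bound needs this,
  because it starts from exactly \<open>n\<close> roots.\<close>

lemma AE_leading_coeff_nonzero: "AE a in coeff_space n. a n \<noteq> (0 :: 'p::prime_card padic_int)"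
proof (rule AE_PiM_component)
  have "emeasure haar {0 :: 'p padic_int} \<le> ennreal (1 / real CARD('p) ^ k)" for k
  proof -
    have "{0 :: 'p padic_int} \<subseteq> cyl k 0" by (simp add: cyl_def residue_0)
    hence "emeasure haar {0 :: 'p padic_int} \<le> emeasure haar (cyl k 0 :: 'p padic_int set)"
      by (rule emeasure_mono) simp
    thus ?thesis using emeasure_haar_cyl[of 0 k, where 'p='p] by simp
  qed
  moreover have "(\<lambda>k. ennreal (1 / real CARD('p) ^ k)) \<longlonglongrightarrow> ennreal 0"
  proof (rule tendsto_ennrealI)
    have "real CARD('p) > 1" using p_gt_1[where 'p='p] by simp
    thus "(\<lambda>k. 1 / real CARD('p) ^ k) \<longlonglongrightarrow> 0"
      using LIMSEQ_realpow_zero[of "1 / real CARD('p)"] by (simp add: power_one_over)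
  qed
  ultimately have "emeasure haar {0 :: 'p padic_int} \<le> ennreal 0"
    by (intro LIMSEQ_le_const) auto
  moreover have "{0 :: 'p padic_int} \<in> sets haar" by simp
  ultimately have "{0 :: 'p padic_int} \<in> null_sets haar" by (auto simp: null_sets_def)
  thus "AE x in haar. x \<noteq> (0 :: 'p padic_int)" by (rule AE_I') auto
qed (simp_all add: prob_space_haar)

section \<open>Exchanging the sum over fields with the expectation\<close>

lemma sum_size_filter_adjoin:
  "finite \<K> \<Longrightarrow> (\<Sum>K\<in>\<K>. size (filter_mset (\<lambda>x. adjoin x = K) M)) = size (filter_mset (\<lambda>x. adjoin x \<in> \<K>) M)"
proof (induction M)
  case (add x M)
  have "(\<Sum>K\<in>\<K>. size (filter_mset (\<lambda>x. adjoin x = K) (add_mset x M))) =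
      (\<Sum>K\<in>\<K>. (if K = adjoin x then 1 else 0) + size (filter_mset (\<lambda>x. adjoin x = K) M))"
    by (intro sum.cong) auto
  thus ?case using add by (simp add: sum.distrib)
qed simp

lemma num_roots_le: "num_roots U (poly_of_coeffs n a) \<le> n"
proof (cases "poly_of_coeffs n a = 0")
  case False
  have "num_roots U (poly_of_coeffs n a) \<le> size (zeros (poly_of_coeffs n a))"
    unfolding num_roots_def zeros_def by (rule size_filter_mset_lesseq)
  also have "\<dots> = degree (poly_of_coeffs n a)" by (rule size_zeros[OF False])
  also have "\<dots> \<le> n" by (rule degree_le) (simp add: coeff_poly_of_coeffs)
  finally show ?thesis .
qed (simp add: num_roots_def)

lemma expected_roots_adjoin:
  assumes "K \<in> range adjoin"
  shows "ennreal (expected_roots n (new_elements K)) =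
    (\<integral>\<^sup>+a. ennreal (real (field_zeros K (poly_of_coeffs n a))) \<partial>coeff_space n)"
proof -
  interpret prob_space "coeff_space n :: (nat \<Rightarrow> 'a padic_int) measure" by (rule prob_space_coeff_space)
  have "extension K" using assms by (auto simp: extension_iff_closed_field closed_field_adjoin)
  hence eq: "num_roots (new_elements K) P = field_zeros K P" for P
    by (simp add: num_roots_def field_zeros_def zeros_def new_elements_eq)
  have "integrable (coeff_space n) (\<lambda>a. real (field_zeros K (poly_of_coeffs n a)))"
  proof (rule integrable_const_bound[of _ "real n"])
    show "AE a in coeff_space n. norm (real (field_zeros K (poly_of_coeffs n a))) \<le> real n"
      using num_roots_le[of "new_elements K" n] by (simp add: eq)
  qed measurable
  thus ?thesis unfolding expected_roots_def eq by (intro nn_integral_eq_integral[symmetric]) auto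
qed

text \<open>A field without a generator has no new elements, which settles such fields without the
  primitive element theorem.\<close>

lemma expected_roots_no_generator:
  assumes "extension K" "K \<notin> range adjoin"
  shows "expected_roots n (new_elements K) = 0"
proof -
  have "new_elements K = {}" using assms(2) by (auto simp: new_elements_eq[OF assms(1)])
  thus ?thesis by (simp add: expected_roots_def num_roots_def)
qed

text \<open>Fields without a generator contribute nothing; over the countably many others the sum is
  an integral for the counting measure, and Tonelli's theorem applies. For a fixed polynomial only
  finitely many fields occur.\<close>

lemma sum_expected_roots:
  fixes r n :: nat
  defines "S \<equiv> (\<Sum>\<^sub>\<infinity>K\<in>(finite_extensions_upto r :: 'p::prime_card padic alg_closure set set). expected_roots n (new_elements K))"
  shows "ennreal S = (\<integral>\<^sup>+a. ennreal (real (low_zeros r (poly_of_coeffs n (a :: nat \<Rightarrow> 'p padic_int)))) \<partial>coeff_space n)"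
    (is "_ = ?R") and "S \<ge> 0"
proof -
  interpret prob_space "coeff_space n :: (nat \<Rightarrow> 'p padic_int) measure" by (rule prob_space_coeff_space)
  let ?E = "\<lambda>K. expected_roots n (new_elements K)"
  define \<K> where "\<K> = adjoin ` {x :: 'p padic alg_closure. adeg x \<le> r}"
  have sub: "\<K> \<subseteq> finite_extensions_upto r" by (auto simp: \<K>_def adjoin_in_finite_extensions_upto)
  have cnt: "countable \<K>" by (rule countable_subset[OF _ countable_adjoin]) (auto simp: \<K>_def)
  have S: "S = (\<Sum>\<^sub>\<infinity>K\<in>\<K>. ?E K)"
    unfolding S_def
  proof (rule infsum_cong_neutral)
    fix K :: "'p padic alg_closure set" assume K: "K \<in> finite_extensions_upto r - \<K>"
    hence "K \<notin> range adjoin" by (auto simp: \<K>_def adjoin_in_finite_extensions_upto)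
    moreover have "extension K" using K by (simp add: finite_extensions_upto_def)
    ultimately show "?E K = 0" by (intro expected_roots_no_generator)
  qed (use sub in auto)
  have pointwise: "(\<integral>\<^sup>+K. ennreal (real (field_zeros K P)) \<partial>count_space \<K>) = ennreal (real (low_zeros r P))"
    for P :: "'p padic_int poly"
  proof -
    define F where "F = \<K> \<inter> adjoin ` set_mset (zeros P)"
    have F: "finite F" "F \<subseteq> \<K>" by (auto simp: F_def)
    have "field_zeros K P = 0" if "K \<in> \<K>" "K \<notin> F" for K
    proof -
      have ne: "adjoin x \<noteq> K" if "x \<in># zeros P" for x using that \<open>K \<in> \<K>\<close> \<open>K \<notin> F\<close> by (auto simp: F_def)
      have "filter_mset (\<lambda>x. adjoin x = K) (zeros P) = {#}"
      proof (rule multiset_eqI)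
        fix x
        show "count (filter_mset (\<lambda>x. adjoin x = K) (zeros P)) x = count {#} x"
          using ne[of x] by (cases "x \<in># zeros P") (auto simp: not_in_iff)
      qed
      thus ?thesis by (simp add: field_zeros_def)
    qed
    hence "(\<integral>\<^sup>+K. ennreal (real (field_zeros K P)) \<partial>count_space \<K>) = (\<Sum>K\<in>F. ennreal (real (field_zeros K P)))"
      using F by (intro nn_integral_count_space') auto
    also have "\<dots> = ennreal (real (\<Sum>K\<in>F. field_zeros K P))" by simp
    also have "(\<Sum>K\<in>F. field_zeros K P) = size (filter_mset (\<lambda>x. adjoin x \<in> F) (zeros P))"
      unfolding field_zeros_def by (rule sum_size_filter_adjoin[OF F(1)])
    also have "filter_mset (\<lambda>x. adjoin x \<in> F) (zeros P) = filter_mset (\<lambda>x. adeg x \<le> r) (zeros P)"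
    proof (rule filter_mset_cong)
      fix x assume "x \<in># zeros P"
      hence "adjoin x \<in> F \<longleftrightarrow> adjoin x \<in> \<K>" by (auto simp: F_def)
      also have "\<dots> \<longleftrightarrow> adeg x \<le> r"
      proof
        assume "adjoin x \<in> \<K>"
        then obtain y where y: "adjoin x = adjoin y" "adeg y \<le> r" unfolding \<K>_def by blast
        show "adeg x \<le> r" using adeg_eq_if_adjoin_eq[OF y(1)] y(2) by simp
      next
        assume "adeg x \<le> r"
        thus "adjoin x \<in> \<K>" unfolding \<K>_def by blast
      qed
      finally show "adjoin x \<in> F \<longleftrightarrow> adeg x \<le> r" .
    qed simp
    finally show ?thesis by (simp add: low_zeros_def)
  qed
  have "?R = (\<integral>\<^sup>+a. \<integral>\<^sup>+K. ennreal (real (field_zeros K (poly_of_coeffs n a))) \<partial>count_space \<K> \<partial>coeff_space n)"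
    by (simp only: pointwise)
  also have "\<dots> = (\<integral>\<^sup>+K. \<integral>\<^sup>+a. ennreal (real (field_zeros K (poly_of_coeffs n a))) \<partial>coeff_space n \<partial>count_space \<K>)"
    by (rule nn_integral_count_space_nn_integral[OF cnt]) measurable
  also have "\<dots> = (\<integral>\<^sup>+K. ennreal (?E K) \<partial>count_space \<K>)"
    by (intro nn_integral_cong expected_roots_adjoin[symmetric]) (auto simp: \<K>_def)
  finally have R: "?R = (\<integral>\<^sup>+K. ennreal (?E K) \<partial>count_space \<K>)" .
  have nonneg: "?E K \<ge> 0" for K :: "'p padic alg_closure set" by (simp add: expected_roots_def)
  \<comment> \<open>Finiteness matters: the infinite sum of a family that is not summable is
    \<open>0\<close> by convention, so summability has to be established.\<close>
  have "low_zeros r (poly_of_coeffs n a) \<le> n" for a :: "nat \<Rightarrow> 'p padic_int"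
    using num_roots_le[of "{x. adeg x \<le> r}" n a] by (simp add: num_roots_def low_zeros_def zeros_def)
  hence "?R \<le> (\<integral>\<^sup>+a. ennreal (real n) \<partial>(coeff_space n :: (nat \<Rightarrow> 'p padic_int) measure))"
    by (intro nn_integral_mono) (simp add: ennreal_leI)
  also have "\<dots> = ennreal (real n)" by (simp add: emeasure_space_1)
  finally have fin: "?R < \<infinity>" using ennreal_less_top le_less_trans by (metis infinity_ennreal_def)
  have "integrable (count_space \<K>) ?E"
    by (rule integrableI_nonneg) (use nonneg fin R in auto)
  hence sm: "Infinite_Set_Sum.abs_summable_on ?E \<K>" by (simp add: Infinite_Set_Sum.abs_summable_on_def)
  have "ennreal S = ennreal (infsetsum ?E \<K>)" unfolding S by (simp only: infsetsum_infsum[OF sm])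
  also have "\<dots> = ?R" unfolding R using nn_integral_conv_infsetsum[OF sm nonneg] by simp
  finally show "ennreal S = ?R" .
  show "S \<ge> 0" unfolding S_def by (rule infsum_nonneg) (rule nonneg)
qed

section \<open>Bounds by averages over reductions\<close>

lemma degree_poly_of_coeffs_le: "degree (poly_of_coeffs n a) \<le> n"
  by (rule degree_le) (simp add: coeff_poly_of_coeffs)

text \<open>If the reduction vanishes, the blocks say nothing and the trivial bound \<open>n\<close>
  is used; this happens with probability \<open>p ^ (-(n + 1))\<close>.\<close>

lemma sum_expected_roots_upper:
  fixes r n :: nat
  defines "g \<equiv> \<lambda>Q :: 'p::prime_card mod_ring poly. if Q = 0 then n else
    (\<Sum>f\<in>primes_upto_degree r. degree f * multiplicity f Q) + (n - degree Q)"
  shows "(\<Sum>\<^sub>\<infinity>K\<in>(finite_extensions_upto r :: 'p padic alg_closure set set). expected_roots n (new_elements K))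
    \<le> real (\<Sum>Q\<in>polys_below (Suc n). g Q) / real CARD('p) ^ Suc n" (is "?S \<le> ?R")
proof -
  have "low_zeros r (poly_of_coeffs n a) \<le> g (red_poly (poly_of_coeffs n a))" for a :: "nat \<Rightarrow> 'p padic_int"
  proof (cases "red_poly (poly_of_coeffs n a) = 0")
    case True
    thus ?thesis
      using num_roots_le[of "{x. adeg x \<le> r}" n a] by (simp add: num_roots_def low_zeros_def zeros_def g_def)
  next
    case False
    thus ?thesis
      using low_zeros_upper[OF False, of r] degree_poly_of_coeffs_le[of n a] by (simp add: g_def)
  qed
  hence "(\<integral>\<^sup>+a. ennreal (real (low_zeros r (poly_of_coeffs n (a :: nat \<Rightarrow> 'p padic_int)))) \<partial>coeff_space n) \<le>
    (\<integral>\<^sup>+a. ennreal (real (g (red_poly (poly_of_coeffs n a)))) \<partial>coeff_space n)"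
    by (intro nn_integral_mono ennreal_leI) simp
  also have "\<dots> = ennreal ?R" by (subst nn_integral_red_poly) simp_all
  finally have "ennreal ?S \<le> ennreal ?R" by (simp only: sum_expected_roots)
  thus ?thesis by (subst (asm) ennreal_le_iff) (simp_all add: sum_nonneg)
qed

text \<open>Almost surely there are \<open>n\<close> roots, and the block sizes add up to
  \<open>n\<close>. Subtracting the blocks larger than \<open>r\<close>, which contain all roots of
  degree above \<open>r\<close>, leaves the blocks retained by \<open>\<psi>\<close>.\<close>

lemma sum_expected_roots_lower:
  fixes r n :: nat
  defines "\<psi> \<equiv> \<lambda>k. if k \<le> r then k else (0 :: nat)"
  defines "g \<equiv> \<lambda>Q :: 'p::prime_card mod_ring poly. if Q = 0 then 0 else
    (\<Sum>f\<in>primes_upto_degree n. \<psi> (degree f * multiplicity f Q)) + \<psi> (n - degree Q)"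
  shows "real (\<Sum>Q\<in>polys_below (Suc n). g Q) / real CARD('p) ^ Suc n \<le>
    (\<Sum>\<^sub>\<infinity>K\<in>(finite_extensions_upto r :: 'p padic alg_closure set set). expected_roots n (new_elements K))"
    (is "?R \<le> ?S")
proof -
  define \<phi> where "\<phi> k = (if k \<le> r then 0 else k)" for k
  have split: "k = \<psi> k + \<phi> k" for k by (simp add: \<phi>_def \<psi>_def)
  have "g (red_poly (poly_of_coeffs n a)) \<le> low_zeros r (poly_of_coeffs n a)" if "a n \<noteq> 0" for a :: "nat \<Rightarrow> 'p padic_int"
  proof (cases "red_poly (poly_of_coeffs n a) = 0")
    case False
    define P where "P = poly_of_coeffs n a"
    define Q where "Q = red_poly P"
    have dP: "degree P = n"
      unfolding P_def by (rule antisym[OF degree_poly_of_coeffs_le le_degree]) (simp add: coeff_poly_of_coeffs that)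
    have nzP: "red_poly P \<noteq> 0" using False by (simp add: P_def)
    have Q: "Q \<noteq> 0" "degree Q \<le> n" using False degree_red_poly_le[of P] dP by (simp_all add: Q_def P_def)
    let ?I = "primes_upto_degree n :: 'p mod_ring poly set"
    have "degree Q = (\<Sum>f\<in>?I. degree f * multiplicity f Q)" by (rule degree_eq_sum_multiplicity[OF Q]) simp
    also have "\<dots> = (\<Sum>f\<in>?I. \<psi> (degree f * multiplicity f Q)) + (\<Sum>f\<in>?I. \<phi> (degree f * multiplicity f Q))"
      unfolding sum.distrib[symmetric] by (intro sum.cong refl split)
    finally have "degree Q = \<dots>" .
    moreover have "n \<le> low_zeros r P + (\<Sum>f\<in>?I. \<phi> (degree f * multiplicity f Q)) + \<phi> (n - degree Q)"
      using low_zeros_lower[OF nzP, of n r] unfolding \<phi>_def Q_def dP by simp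
    moreover have "n = degree Q + (\<psi> (n - degree Q) + \<phi> (n - degree Q))"
      using Q(2) split[of "n - degree Q"] by linarith
    ultimately show ?thesis using Q(1) by (simp add: g_def flip: P_def Q_def)
  qed (simp add: g_def)
  hence "AE a in coeff_space n. ennreal (real (g (red_poly (poly_of_coeffs n a)))) \<le>
      ennreal (real (low_zeros r (poly_of_coeffs n (a :: nat \<Rightarrow> 'p padic_int))))"
    using AE_leading_coeff_nonzero[of n] by (auto elim!: eventually_mono intro: ennreal_leI)
  hence "(\<integral>\<^sup>+a. ennreal (real (g (red_poly (poly_of_coeffs n a)))) \<partial>coeff_space n) \<le>
    (\<integral>\<^sup>+a. ennreal (real (low_zeros r (poly_of_coeffs n (a :: nat \<Rightarrow> 'p padic_int)))) \<partial>coeff_space n)"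
    by (rule nn_integral_mono_AE)
  also have "\<dots> = ennreal ?S" by (simp only: sum_expected_roots)
  finally have "ennreal ?R \<le> ennreal ?S" by (subst (asm) nn_integral_red_poly) simp_all
  thus ?thesis using sum_expected_roots(2) by (subst (asm) ennreal_le_iff) simp_all
qed

section \<open>Averages over polynomials of bounded degree\<close>

lemma card_field_ge_2: "real CARD('a::{field_gcd,finite}) \<ge> 2"
proof -
  have "card {0, 1 :: 'a} \<le> CARD('a)" by (rule card_mono) auto
  thus ?thesis by simp
qed

lemma sum_degree_primes_upto:
  "(\<Sum>f\<in>(primes_upto_degree m :: 'a::{field_gcd,finite} poly set). degree f) \<le> m * CARD('a) ^ m"
proof -
  have "(\<Sum>f\<in>(primes_upto_degree m :: 'a poly set). degree f) = (\<Sum>x\<in>(\<lambda>f. (f, 1 :: nat)) ` (primes_upto_degree m :: 'a poly set). degree (fst x))"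
    by (subst sum.reindex) (auto intro: inj_onI)
  also have "\<dots> \<le> (\<Sum>x\<in>(prime_powers_upto m :: ('a poly \<times> nat) set). degree (fst x))"
  proof (rule sum_mono2)
    show "(\<lambda>f. (f, 1)) ` primes_upto_degree m \<subseteq> prime_powers_upto m"
      by (auto simp: primes_upto_degree_def prime_powers_upto_def)
  qed simp_all
  also have "\<dots> = (\<Sum>k=1..m. \<Sum>x\<in>(prime_powers_of k :: ('a poly \<times> nat) set). degree (fst x))"
    by (rule sum_prime_powers_upto)
  also have "\<dots> = (\<Sum>k=1..m. CARD('a) ^ k)"
    using sum_degree_prime_powers[where 'a='a] by (intro sum.cong refl) (auto simp: case_prod_unfold)
  also have "\<dots> \<le> (\<Sum>k=1..m. CARD('a) ^ m)"
    by (intro sum_mono power_increasing) (auto simp: Suc_le_eq)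
  finally show ?thesis by simp
qed

text \<open>For \<open>e\<close> at least \<open>2\<close> the base has degree at most
  \<open>k / 2\<close>, and it determines \<open>e\<close>, so a crude bound on the primes up to
  that degree gives the square root saving.\<close>

lemma sum_degree_proper_powers:
  "real (\<Sum>x\<in>{x\<in>(prime_powers_of k :: ('a::{field_gcd,finite} poly \<times> nat) set). snd x \<ge> 2}. degree (fst x))
    \<le> real k * sqrt (real CARD('a)) ^ k"
proof -
  let ?T = "{x\<in>(prime_powers_of k :: ('a poly \<times> nat) set). snd x \<ge> 2}"
  have inj: "inj_on fst ?T"
  proof (rule inj_onI)
    fix x y assume xy: "x \<in> ?T" "y \<in> ?T" "fst x = fst y"
    hence "snd x * degree (fst x) = snd y * degree (fst x)" "prime (fst x)"
      by (auto simp: prime_powers_of_def case_prod_unfold)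
    moreover from this have "degree (fst x) > 0" using prime_poly_degree_pos by blast
    ultimately show "x = y" using xy(3) by (simp add: prod_eq_iff)
  qed
  have sub: "fst ` ?T \<subseteq> primes_upto_degree (k div 2)"
  proof
    fix f assume "f \<in> fst ` ?T"
    then obtain e where "(f, e) \<in> prime_powers_of k" and e2: "e \<ge> 2" by force
    hence e: "prime f" "e * degree f = k" "e \<ge> 2" by (auto simp: prime_powers_of_def)
    have "2 * degree f \<le> e * degree f" using e(3) by (rule mult_right_mono) simp
    thus "f \<in> primes_upto_degree (k div 2)" using e by (simp add: primes_upto_degree_def)
  qed
  have "(\<Sum>x\<in>?T. degree (fst x)) = (\<Sum>f\<in>fst ` ?T. degree f)"
    by (simp add: sum.reindex[OF inj])
  also have "\<dots> \<le> (\<Sum>f\<in>(primes_upto_degree (k div 2) :: 'a poly set). degree f)"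
    by (rule sum_mono2[OF _ sub]) auto
  also have "\<dots> \<le> k div 2 * CARD('a) ^ (k div 2)" by (rule sum_degree_primes_upto)
  finally have "real (\<Sum>x\<in>?T. degree (fst x)) \<le> real (k div 2 * CARD('a) ^ (k div 2))"
    by (simp only: of_nat_le_iff)
  also have "\<dots> = real (k div 2) * real CARD('a) ^ (k div 2)" by simp
  also have "\<dots> \<le> real k * sqrt (real CARD('a)) ^ k"
  proof (rule mult_mono)
    have "real CARD('a) ^ (k div 2) = sqrt (real CARD('a)) ^ (2 * (k div 2))"
      by (simp add: power_mult)
    also have "\<dots> \<le> sqrt (real CARD('a)) ^ k"
      by (rule power_increasing) (use card_field_ge_2[where 'a='a] in auto)
    finally show "real CARD('a) ^ (k div 2) \<le> sqrt (real CARD('a)) ^ k" .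
  qed simp_all
  finally show ?thesis .
qed

lemma real_power_minus_1:
  fixes c :: nat
  assumes "c > 0" "k \<le> m"
  shows "real (c ^ (m - k) - 1) = real c ^ m / real c ^ k - 1"
proof -
  have "real (c ^ (m - k) - 1) = real c ^ (m - k) - 1" using assms(1) by (simp add: of_nat_diff Suc_leI)
  also have "real c ^ (m - k) = real c ^ m / real c ^ k" using assms by (intro power_diff) simp_all
  finally show ?thesis .
qed

text \<open>The \<open>- 1\<close> stands for the zero polynomial. At
  \<open>e * degree f = Suc n\<close> the exact formula gives \<open>0\<close>, in agreement with
  the last claim.\<close>

lemma card_nonzero_multiples:
  fixes f :: "'a::{field_gcd,finite} poly"
  assumes "prime f"
  shows "real (card {Q\<in>polys_below (Suc n) - {0}. f ^ e dvd Q}) \<le> real CARD('a) ^ Suc n / real CARD('a) ^ (e * degree f)"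
    and "e * degree f \<le> Suc n \<Longrightarrow> real (card {Q\<in>polys_below (Suc n) - {0}. f ^ e dvd Q}) =
      real CARD('a) ^ Suc n / real CARD('a) ^ (e * degree f) - 1"
    and "e * degree f > n \<Longrightarrow> card {Q\<in>polys_below (Suc n) - {0}. f ^ e dvd Q} = 0"
proof -
  let ?q = "real CARD('a)"
  have f: "f \<noteq> 0" using assms by auto
  have "{Q\<in>polys_below (Suc n) - {0}. f ^ e dvd Q} = {Q\<in>polys_below (Suc n). f ^ e dvd Q} - {0}" by auto
  hence "card {Q\<in>polys_below (Suc n) - {0}. f ^ e dvd Q} = card {Q\<in>polys_below (Suc n). f ^ e dvd Q} - 1"
    by (simp add: card_Diff_singleton)
  also have "card {Q\<in>polys_below (Suc n). f ^ e dvd Q} = CARD('a) ^ (Suc n - e * degree f)"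
    using f by (subst card_multiples_below) (simp_all add: degree_power_eq mult.commute)
  finally have c: "card {Q\<in>polys_below (Suc n) - {0}. f ^ e dvd Q} = CARD('a) ^ (Suc n - e * degree f) - 1" .
  show *: "real (card {Q\<in>polys_below (Suc n) - {0}. f ^ e dvd Q}) = ?q ^ Suc n / ?q ^ (e * degree f) - 1"
    if "e * degree f \<le> Suc n"
    unfolding c by (rule real_power_minus_1[OF _ that]) simp
  show **: "card {Q\<in>polys_below (Suc n) - {0}. f ^ e dvd Q} = 0" if "e * degree f > n"
    unfolding c using that by simp
  show "real (card {Q\<in>polys_below (Suc n) - {0}. f ^ e dvd Q}) \<le> ?q ^ Suc n / ?q ^ (e * degree f)"
  proof (cases "e * degree f \<le> Suc n")
    case True
    thus ?thesis using *[OF True] by linarith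
  next
    case False
    hence c0: "card {Q\<in>polys_below (Suc n) - {0}. f ^ e dvd Q} = 0" by (intro **) simp
    show ?thesis unfolding c0 by simp
  qed
qed

lemma card_nonzero_low_degree:
  assumes "e \<le> Suc n"
  shows "real (card {Q\<in>polys_below (Suc n) - {0} :: 'a::{field_gcd,finite} poly set. degree Q + e \<le> n}) =
    real CARD('a) ^ Suc n / real CARD('a) ^ e - 1"
proof -
  have "{Q\<in>polys_below (Suc n) - {0} :: 'a poly set. degree Q + e \<le> n} = polys_below (Suc n - e) - {0}"
    using assms by (auto simp: polys_below_iff_degree)
  hence "card {Q\<in>polys_below (Suc n) - {0} :: 'a poly set. degree Q + e \<le> n} = CARD('a) ^ (Suc n - e) - 1"
    using card_polys_below[where 'a='a] by (simp add: card_Diff_singleton)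
  thus ?thesis using real_power_minus_1[of "CARD('a)", OF _ assms] by simp
qed

lemma sum_geometric_inverse:
  fixes q :: real
  assumes "q > 1"
  shows "(\<Sum>e=1..n. 1 / q ^ e) = 1 / (q - 1) - 1 / ((q - 1) * q ^ n)"
proof (induction n)
  case (Suc n)
  have "1 / ((q - 1) * q ^ n) = q / ((q - 1) * q ^ Suc n)" using assms by simp
  moreover have "1 / q ^ Suc n = (q - 1) / ((q - 1) * q ^ Suc n)" using assms by simp
  ultimately show ?case using Suc
    by (simp add: sum.nat_ivl_Suc' diff_divide_distrib del: power_Suc)
qed simp

text \<open>Bounds the proper powers of degree \<open>k\<close>: one factor \<open>k\<close> comes
  from the weight allowed in \<open>proper_powers_le_tail_term\<close>, the rest from
  \<open>sum_degree_proper_powers\<close> divided by \<open>q ^ k\<close>.\<close>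

definition tail_term :: "real \<Rightarrow> nat \<Rightarrow> real" where
  "tail_term q k = real k ^ 2 / sqrt q ^ k"

lemma tail_term_nonneg: "q \<ge> 0 \<Longrightarrow> tail_term q k \<ge> 0"
  by (simp add: tail_term_def)

lemma proper_powers_le_tail_term:
  fixes h :: "'a::{field_gcd,finite} poly \<times> nat \<Rightarrow> real"
  assumes "\<And>f e. (f, e) \<in> prime_powers_of k \<Longrightarrow> h (f, e) \<le> (if e \<ge> 2 then real k * real (degree f) / real CARD('a) ^ k else 0)"
  shows "sum h (prime_powers_of k) \<le> tail_term (real CARD('a)) k"
proof -
  let ?q = "real CARD('a)"
  have q: "?q \<ge> 2" by (rule card_field_ge_2)
  have "sum h (prime_powers_of k) \<le> (\<Sum>x\<in>(prime_powers_of k :: ('a poly \<times> nat) set). if snd x \<ge> 2 then real k * real (degree (fst x)) / ?q ^ k else 0)"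
  proof (rule sum_mono)
    fix x assume "x \<in> (prime_powers_of k :: ('a poly \<times> nat) set)"
    thus "h x \<le> (if snd x \<ge> 2 then real k * real (degree (fst x)) / ?q ^ k else 0)"
      using assms[of "fst x" "snd x"] by simp
  qed
  also have "\<dots> = (\<Sum>x\<in>{x\<in>(prime_powers_of k :: ('a poly \<times> nat) set). snd x \<ge> 2}. real k * real (degree (fst x)) / ?q ^ k)"
    by (rule sum.inter_filter[symmetric]) simp
  also have "\<dots> = real k / ?q ^ k * real (\<Sum>x\<in>{x\<in>(prime_powers_of k :: ('a poly \<times> nat) set). snd x \<ge> 2}. degree (fst x))"
    by (simp add: sum_distrib_left)
  also have "\<dots> \<le> real k / ?q ^ k * (real k * sqrt ?q ^ k)"
    by (intro mult_left_mono sum_degree_proper_powers) simp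
  also have "?q ^ k = sqrt ?q ^ k * sqrt ?q ^ k" by (simp flip: power_mult_distrib)
  also have "real k / (sqrt ?q ^ k * sqrt ?q ^ k) * (real k * sqrt ?q ^ k) = tail_term ?q k"
    using q by (simp add: tail_term_def power2_eq_square)
  finally show ?thesis .
qed

lemma prime_powers_of_nonzero:
  assumes "(f, e) \<in> (prime_powers_of k :: ('a::field_gcd poly \<times> nat) set)"
  shows "prime f" "e \<ge> 1" "e * degree f = k" "degree f \<ge> 1" "degree f \<le> k"
proof -
  show *: "prime f" "e \<ge> 1" "e * degree f = k" using assms by (auto simp: prime_powers_of_def)
  show "degree f \<ge> 1" using prime_poly_degree_pos[OF *(1)] by simp
  have "degree f \<le> e * degree f" using *(2) by simp
  thus "degree f \<le> k" using *(3) by simp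
qed

lemma sum_prime_powers_of_degree:
  assumes "k \<ge> 1"
  shows "(\<Sum>x\<in>(prime_powers_of k :: ('a::{field_gcd,finite} poly \<times> nat) set). real (degree (fst x)) / real CARD('a) ^ k) = 1"
proof -
  have "(\<Sum>x\<in>(prime_powers_of k :: ('a poly \<times> nat) set). real (degree (fst x)) / real CARD('a) ^ k) =
      real (\<Sum>(f, e)\<in>(prime_powers_of k :: ('a poly \<times> nat) set). degree f) / real CARD('a) ^ k"
    by (simp add: sum_divide_distrib case_prod_unfold)
  thus ?thesis using sum_degree_prime_powers[OF assms, where 'a='a] by simp
qed

text \<open>On average a pair \<open>(f, e)\<close> contributes at most
  \<open>degree f / q ^ (e * degree f)\<close>. Grouped by \<open>k = e * degree f\<close>, each
  \<open>k\<close> up to \<open>r\<close> gives at most \<open>1\<close> by the prime polynomial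
  theorem.\<close>

lemma average_upper:
  fixes r n :: nat
  defines "g \<equiv> \<lambda>Q :: 'a::{field_gcd,finite} poly. if Q = 0 then n else
    (\<Sum>f\<in>primes_upto_degree r. degree f * multiplicity f Q) + (n - degree Q)"
  defines "q \<equiv> real CARD('a)"
  assumes "r \<le> n"
  shows "real (\<Sum>Q\<in>polys_below (Suc n). g Q) / q ^ Suc n \<le>
    real r + 1 / (q - 1) + (\<Sum>k=Suc r..n. tail_term q k) + real n / q ^ Suc n"
proof -
  define N where "N = q ^ Suc n"
  have q: "q \<ge> 2" unfolding q_def by (rule card_field_ge_2)
  hence N: "N > 0" by (simp add: N_def)
  let ?O = "polys_below (Suc n) - {0} :: 'a poly set"
  let ?I = "primes_upto_degree r :: 'a poly set"
  have deg: "Q \<noteq> 0" "degree Q \<le> n" if "Q \<in> ?O" for Q :: "'a poly"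
    using that by (auto simp: polys_below_Suc_iff)
  have "(\<Sum>Q\<in>polys_below (Suc n). g Q) = n + (\<Sum>Q\<in>?O. g Q)"
    by (subst sum.remove[of _ 0]) (simp_all add: g_def)
  also have "(\<Sum>Q\<in>?O. g Q) = (\<Sum>Q\<in>?O. \<Sum>f\<in>?I. degree f * multiplicity f Q) + (\<Sum>Q\<in>?O. n - degree Q)"
    unfolding sum.distrib[symmetric] by (intro sum.cong refl) (simp add: g_def)
  finally have g: "real (\<Sum>Q\<in>polys_below (Suc n). g Q) =
      real n + (real (\<Sum>Q\<in>?O. \<Sum>f\<in>?I. degree f * multiplicity f Q) + real (\<Sum>Q\<in>?O. n - degree Q))" by simp

  have "(\<Sum>Q\<in>?O. \<Sum>f\<in>?I. degree f * multiplicity f Q) =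
      (\<Sum>Q\<in>?O. \<Sum>f\<in>?I. \<Sum>e=1..n. degree f * of_bool (f ^ e dvd Q))"
    by (intro sum.cong refl, subst multiplicity_eq_sum[of _ _ n])
       (use deg in \<open>auto simp: primes_upto_degree_def sum_distrib_left\<close>)
  also have "\<dots> = (\<Sum>f\<in>?I. \<Sum>e=1..n. \<Sum>Q\<in>?O. degree f * of_bool (f ^ e dvd Q))"
    by (subst sum.swap, intro sum.cong refl, subst sum.swap, rule refl)
  also have "\<dots> = (\<Sum>f\<in>?I. \<Sum>e=1..n. degree f * card {Q\<in>?O. f ^ e dvd Q})"
    by (intro sum.cong refl) (simp add: Int_def flip: sum_distrib_left)
  finally have "real (\<Sum>Q\<in>?O. \<Sum>f\<in>?I. degree f * multiplicity f Q) =
      (\<Sum>f\<in>?I. \<Sum>e=1..n. real (degree f) * real (card {Q\<in>?O. f ^ e dvd Q}))" by simp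
  also have "\<dots> = (\<Sum>(f, e)\<in>?I \<times> {1..n}. real (degree f) * real (card {Q\<in>?O. f ^ e dvd Q}))"
    by (rule sum.cartesian_product)
  also have "\<dots> \<le> (\<Sum>(f, e)\<in>?I \<times> {1..n}. if (f, e) \<in> prime_powers_upto n then real (degree f) * (N / q ^ (e * degree f)) else 0)"
  proof (rule sum_mono, clarify)
    fix f :: "'a poly" and e assume fe: "f \<in> ?I" "e \<in> {1..n}"
    hence f: "prime f" by (simp add: primes_upto_degree_def)
    show "real (degree f) * real (card {Q\<in>?O. f ^ e dvd Q}) \<le>
      (if (f, e) \<in> prime_powers_upto n then real (degree f) * (N / q ^ (e * degree f)) else 0)"
    proof (cases "(f, e) \<in> prime_powers_upto n")
      case True
      thus ?thesis using mult_left_mono[OF card_nonzero_multiples(1)[OF f, of n e], of "real (degree f)"]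
        by (simp add: N_def q_def del: power_Suc)
    next
      case False
      hence "e * degree f > n" using f fe by (simp add: prime_powers_upto_def)
      hence "card {Q\<in>?O. f ^ e dvd Q} = 0" by (rule card_nonzero_multiples(3)[OF f])
      thus ?thesis using False by (simp only: if_False of_nat_0 mult_zero_right order.refl)
    qed
  qed
  also have "\<dots> = (\<Sum>x\<in>{x\<in>?I \<times> {1..n}. x \<in> prime_powers_upto n}. real (degree (fst x)) * (N / q ^ (snd x * degree (fst x))))"
    by (subst sum.inter_filter) (auto simp: case_prod_unfold)
  also have "\<dots> = (\<Sum>x\<in>{x\<in>?I \<times> {1..n}. x \<in> prime_powers_upto n}. if degree (fst x) \<le> r then real (degree (fst x)) * (N / q ^ (snd x * degree (fst x))) else 0)"
    by (intro sum.cong refl) (auto simp: primes_upto_degree_def)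
  also have "\<dots> \<le> (\<Sum>x\<in>(prime_powers_upto n :: ('a poly \<times> nat) set). if degree (fst x) \<le> r then real (degree (fst x)) * (N / q ^ (snd x * degree (fst x))) else 0)"
    by (rule sum_mono2) (use q N in auto)
  also have "\<dots> = (\<Sum>k=1..n. \<Sum>x\<in>(prime_powers_of k :: ('a poly \<times> nat) set). if degree (fst x) \<le> r then real (degree (fst x)) * (N / q ^ (snd x * degree (fst x))) else 0)"
    by (rule sum_prime_powers_upto)
  also have "\<dots> = (\<Sum>k=1..n. N * (\<Sum>x\<in>(prime_powers_of k :: ('a poly \<times> nat) set). if degree (fst x) \<le> r then real (degree (fst x)) / q ^ k else 0))"
    unfolding sum_distrib_left by (intro sum.cong refl) (auto simp: prime_powers_of_def)
  \<comment> \<open>For \<open>k > r\<close> a base of degree at most \<open>r\<close> forces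
    \<open>e\<close> to be at least \<open>2\<close>, so only proper powers remain.\<close>
  also have "\<dots> \<le> (\<Sum>k=1..n. N * (if k \<le> r then 1 else tail_term q k))"
  proof (intro sum_mono mult_left_mono)
    fix k assume k: "k \<in> {1..n}"
    show "(\<Sum>x\<in>(prime_powers_of k :: ('a poly \<times> nat) set). if degree (fst x) \<le> r then real (degree (fst x)) / q ^ k else 0) \<le> (if k \<le> r then 1 else tail_term q k)"
    proof (cases "k \<le> r")
      case True
      have "(\<Sum>x\<in>(prime_powers_of k :: ('a poly \<times> nat) set). if degree (fst x) \<le> r then real (degree (fst x)) / q ^ k else 0) \<le>
        (\<Sum>x\<in>(prime_powers_of k :: ('a poly \<times> nat) set). real (degree (fst x)) / q ^ k)"
        by (rule sum_mono) (use q in auto)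
      also have "\<dots> = 1" unfolding q_def by (rule sum_prime_powers_of_degree) (use k in simp)
      finally show ?thesis using True by simp
    next
      case False
      have "(\<Sum>x\<in>(prime_powers_of k :: ('a poly \<times> nat) set). if degree (fst x) \<le> r then real (degree (fst x)) / q ^ k else 0) \<le> tail_term q k"
        unfolding q_def
      proof (rule proper_powers_le_tail_term)
        fix f :: "'a poly" and e assume fe: "(f, e) \<in> prime_powers_of k"
        note * = prime_powers_of_nonzero[OF fe]
        have "e \<ge> 2" if "degree f \<le> r"
        proof (rule ccontr)
          assume "\<not> e \<ge> 2"
          hence "e = 1" using *(2) by simp
          thus False using *(3) that False by simp
        qed
        moreover have "real (degree f) \<le> real k * real (degree f)" using k mult_right_mono[of 1 "real k" "real (degree f)"] by simp
        ultimately show "(if degree (fst (f, e)) \<le> r then real (degree (fst (f, e))) / real CARD('a) ^ k else 0)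
            \<le> (if e \<ge> 2 then real k * real (degree f) / real CARD('a) ^ k else 0)"
          by (auto intro: divide_right_mono)
      qed
      thus ?thesis using False by simp
    qed
  qed (use N in simp)
  also have "\<dots> = N * (real r + (\<Sum>k=Suc r..n. tail_term q k))"
  proof -
    have "(\<Sum>k=1..n. if k \<le> r then 1 else tail_term q k) =
        (\<Sum>k=1..r. if k \<le> r then 1 else tail_term q k) + (\<Sum>k=Suc r..n. if k \<le> r then 1 else tail_term q k)"
      using sum.ub_add_nat[of 1 r "\<lambda>k. if k \<le> r then 1 else tail_term q k" "n - r"] assms(3) by simp
    thus ?thesis by (simp flip: sum_distrib_left)
  qed
  finally have T1: "real (\<Sum>Q\<in>?O. \<Sum>f\<in>?I. degree f * multiplicity f Q) \<le> N * (real r + (\<Sum>k=Suc r..n. tail_term q k))" .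

  \<comment> \<open>The loss of degree is summed layer by layer as well: a loss of at least
    \<open>e\<close> has probability below \<open>q ^ (-e)\<close>, and the geometric series gives
    \<open>1 / (q - 1)\<close>.\<close>
  have "(\<Sum>Q\<in>?O. n - degree Q) = (\<Sum>Q\<in>?O. \<Sum>e=1..n. of_bool (degree Q + e \<le> n))"
  proof (intro sum.cong refl)
    fix Q :: "'a poly"
    have "{1..n} \<inter> {e. degree Q + e \<le> n} = {1..n - degree Q}" by auto
    thus "n - degree Q = (\<Sum>e=1..n. of_bool (degree Q + e \<le> n))" by simp
  qed
  also have "\<dots> = (\<Sum>e=1..n. card {Q\<in>?O. degree Q + e \<le> n})"
    by (subst sum.swap) (simp add: Int_def)
  finally have "real (\<Sum>Q\<in>?O. n - degree Q) = (\<Sum>e=1..n. real (card {Q\<in>?O. degree Q + e \<le> n}))" by simp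
  also have "\<dots> \<le> (\<Sum>e=1..n. N * (1 / q ^ e))"
    by (rule sum_mono, subst card_nonzero_low_degree) (auto simp: N_def q_def simp del: power_Suc)
  also have "\<dots> \<le> N * (1 / (q - 1))"
    unfolding sum_distrib_left[symmetric]
  proof (rule mult_left_mono)
    show "(\<Sum>e=1..n. 1 / q ^ e) \<le> 1 / (q - 1)"
      using q by (subst sum_geometric_inverse) simp_all
  qed (use N in simp)
  finally have T2: "real (\<Sum>Q\<in>?O. n - degree Q) \<le> N * (1 / (q - 1))" .
  have "real (\<Sum>Q\<in>polys_below (Suc n). g Q) \<le> real n + (N * (real r + (\<Sum>k=Suc r..n. tail_term q k)) + N * (1 / (q - 1)))"
    unfolding g using T1 T2 by simp
  hence "real (\<Sum>Q\<in>polys_below (Suc n). g Q) / N \<le>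
      (real n + (N * (real r + (\<Sum>k=Suc r..n. tail_term q k)) + N * (1 / (q - 1)))) / N"
    using N by (intro divide_right_mono) simp_all
  also have "\<dots> = real r + 1 / (q - 1) + (\<Sum>k=Suc r..n. tail_term q k) + real n / N"
    using N by (simp add: add_divide_distrib)
  finally show ?thesis by (simp add: N_def)
qed

lemma sum_powers_le:
  fixes q :: real
  assumes "q \<ge> 2"
  shows "(\<Sum>k=1..r. q ^ k) \<le> q ^ Suc r"
proof (induction r)
  case (Suc r)
  have "(\<Sum>k=1..Suc r. q ^ k) \<le> q ^ Suc r + q ^ Suc r" using Suc by simp
  also have "\<dots> = 2 * q ^ Suc r" by simp
  also have "\<dots> \<le> q * q ^ Suc r" using assms by (intro mult_right_mono) simp_all
  finally show ?case by simp
qed (use assms in simp)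

text \<open>The largest multiplicity whose block fits into \<open>r\<close> is
  \<open>r div d\<close>. The left side is \<open>d * m\<close> up to that point and
  \<open>0\<close> beyond it, but it is linear in the events \<open>e \<le> m\<close>, whose
  frequencies are known.\<close>

lemma truncated_count:
  fixes d m r :: nat
  assumes "d > 0"
  shows "real d * ((\<Sum>e=1..r div d. of_bool (e \<le> m)) - real (r div d) * of_bool (Suc (r div d) \<le> m)) \<le>
    real (if d * m \<le> r then d * m else 0)"
proof (cases "m \<le> r div d")
  case True
  have "(\<Sum>e=1..r div d. of_bool (e \<le> m) :: real) = real (card ({1..r div d} \<inter> {e. e \<le> m}))" by simp
  also have "{1..r div d} \<inter> {e. e \<le> m} = {1..m}" using True by auto
  finally have "(\<Sum>e=1..r div d. of_bool (e \<le> m) :: real) = real m" by simp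
  moreover have "m * d \<le> r" using True assms by (simp add: less_eq_div_iff_mult_less_eq)
  ultimately show ?thesis using True by (simp add: mult.commute)
next
  case False
  have "(\<Sum>e=1..r div d. of_bool (e \<le> m) :: real) = (\<Sum>e=1..r div d. 1)"
    by (intro sum.cong refl) (use False in auto)
  thus ?thesis using False by simp
qed

text \<open>Counting multiplicities only up to \<open>E f\<close> yields exactly \<open>r\<close>.
  From this are subtracted the zero polynomial, which every count has to exclude, and the blocks
  that overflow \<open>r\<close>; the block at infinity is treated in the same way.\<close>

lemma average_lower:
  fixes r n :: nat
  defines "\<psi> \<equiv> \<lambda>k. if k \<le> r then k else (0 :: nat)"
  defines "g \<equiv> \<lambda>Q :: 'a::{field_gcd,finite} poly. if Q = 0 then 0 else
    (\<Sum>f\<in>primes_upto_degree n. \<psi> (degree f * multiplicity f Q)) + \<psi> (n - degree Q)"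
  defines "q \<equiv> real CARD('a)"
  assumes "r \<le> n"
  shows "real r + 1 / (q - 1) - (\<Sum>k=Suc r..2 * r. tail_term q k) - (1 + real r) / q ^ r
      - (real r + q ^ Suc r) / q ^ Suc n \<le> real (\<Sum>Q\<in>polys_below (Suc n). g Q) / q ^ Suc n"
proof -
  define N where "N = q ^ Suc n"
  have q: "q \<ge> 2" unfolding q_def by (rule card_field_ge_2)
  hence N: "N > 0" by (simp add: N_def)
  let ?O = "polys_below (Suc n) - {0} :: 'a poly set"
  let ?I = "primes_upto_degree r :: 'a poly set"
  define E where "E f = r div degree f" for f :: "'a poly"
  define cnt where "cnt f e = real (card {Q\<in>?O. f ^ e dvd Q})" for f e
  have deg: "Q \<noteq> 0" "degree Q \<le> n" if "Q \<in> ?O" for Q :: "'a poly"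
    using that by (auto simp: polys_below_Suc_iff)
  have I: "prime f" "degree f > 0" if "f \<in> ?I" for f
    using that prime_poly_degree_pos by (auto simp: primes_upto_degree_def)
  have "(\<Sum>Q\<in>polys_below (Suc n). g Q) = (\<Sum>Q\<in>?O. g Q)"
    by (subst sum.remove[of _ 0]) (simp_all add: g_def)
  hence g: "real (\<Sum>Q\<in>polys_below (Suc n). g Q) = (\<Sum>Q\<in>?O. real (g Q))" by simp

  \<comment> \<open>The truncation at \<open>E f\<close> selects precisely the prime powers of
    degree at most \<open>r\<close>, which is why \<open>A1\<close> is an equality.\<close>
  have upto: "(SIGMA f:?I. {1..E f}) = prime_powers_upto r"
  proof (intro equalityI subsetI)
    fix x :: "'a poly \<times> nat" assume x: "x \<in> (SIGMA f:?I. {1..E f})"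
    then obtain f e where [simp]: "x = (f, e)" and fe: "f \<in> ?I" "1 \<le> e" "e \<le> E f" by auto
    thus "x \<in> prime_powers_upto r" using I[OF fe(1)]
      by (simp add: prime_powers_upto_def E_def less_eq_div_iff_mult_less_eq)
  next
    fix x :: "'a poly \<times> nat" assume x: "x \<in> prime_powers_upto r"
    obtain f e where [simp]: "x = (f, e)" by (cases x)
    have "prime f" "1 \<le> e" "e * degree f \<le> r" "f \<in> ?I"
      using x prime_powers_upto_subset[of r] by (auto simp: prime_powers_upto_def)
    thus "x \<in> (SIGMA f:?I. {1..E f})" using I[of f]
      by (simp add: E_def less_eq_div_iff_mult_less_eq)
  qed
  have sum_upto: "(\<Sum>f\<in>?I. \<Sum>e=1..E f. h f e) = (\<Sum>k=1..r. \<Sum>x\<in>prime_powers_of k. h (fst x) (snd x))"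
    for h :: "'a poly \<Rightarrow> nat \<Rightarrow> real"
    unfolding sum_prime_powers_upto[symmetric] upto[symmetric]
    by (subst sum.Sigma) (simp_all add: case_prod_unfold)

  have A1: "(\<Sum>f\<in>?I. \<Sum>e=1..E f. real (degree f) * (N / q ^ (e * degree f))) = N * real r"
  proof -
    have "(\<Sum>f\<in>?I. \<Sum>e=1..E f. real (degree f) * (N / q ^ (e * degree f))) =
        (\<Sum>k=1..r. \<Sum>x\<in>(prime_powers_of k :: ('a poly \<times> nat) set). real (degree (fst x)) * (N / q ^ (snd x * degree (fst x))))"
      by (rule sum_upto)
    also have "\<dots> = (\<Sum>k=1..r. N * (\<Sum>x\<in>(prime_powers_of k :: ('a poly \<times> nat) set). real (degree (fst x)) / q ^ k))"
      unfolding sum_distrib_left by (intro sum.cong refl) (auto simp: prime_powers_of_def)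
    also have "\<dots> = (\<Sum>k=1..r. N * 1)"
      unfolding q_def by (intro sum.cong refl arg_cong2[of _ _ _ _ "(*)"] sum_prime_powers_of_degree) simp
    finally show ?thesis by simp
  qed
  \<comment> \<open>The total cost of the \<open>- 1\<close> in the counts of nonzero multiples.
    Divided by \<open>N\<close> it is \<open>q ^ (r - n)\<close>, hence the need for
    \<open>n - r\<close> to tend to infinity.\<close>
  have A2: "(\<Sum>f\<in>?I. \<Sum>e=1..E f. real (degree f)) \<le> q ^ Suc r"
  proof -
    have "(\<Sum>f\<in>?I. \<Sum>e=1..E f. real (degree f)) =
        (\<Sum>k=1..r. \<Sum>x\<in>(prime_powers_of k :: ('a poly \<times> nat) set). real (degree (fst x)))"
      by (rule sum_upto)
    also have "\<dots> = (\<Sum>k=1..r. real (\<Sum>(f, e)\<in>(prime_powers_of k :: ('a poly \<times> nat) set). degree f))"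
      by (simp add: case_prod_unfold)
    also have "\<dots> = (\<Sum>k=1..r. q ^ k)"
      by (intro sum.cong refl) (simp add: sum_degree_prime_powers[where 'a='a] q_def)
    also have "\<dots> \<le> q ^ Suc r" by (rule sum_powers_le[OF q])
    finally show ?thesis .
  qed
  \<comment> \<open>Overflow means divisibility by \<open>f ^ Suc (E f)\<close>. This is a proper
    power, since \<open>E f\<close> is at least \<open>1\<close>, and its degree lies above
    \<open>r\<close> and is at most \<open>2 * r\<close>.\<close>
  have A3: "(\<Sum>f\<in>?I. real (degree f) * (real (E f) * (N / q ^ (Suc (E f) * degree f)))) \<le>
      N * (\<Sum>k=Suc r..2 * r. tail_term q k)"
  proof -
    \<comment> \<open>The factor \<open>E f\<close> is enlarged to the degree of the power, so that
      the weight depends on the pair alone and the sum may run over all proper powers.\<close>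
    define h where "h x = (if snd x \<ge> 2 \<and> snd x * degree (fst x) > r then
      real (snd x * degree (fst x)) * real (degree (fst x)) / q ^ (snd x * degree (fst x)) else 0)" for x :: "'a poly \<times> nat"
    have h0: "h x \<ge> 0" for x using q by (simp add: h_def)
    have pair: "(f, Suc (E f)) \<in> prime_powers_upto (2 * r) \<and>
        real (degree f) * (real (E f) * (1 / q ^ (Suc (E f) * degree f))) \<le> h (f, Suc (E f))" if f: "f \<in> ?I" for f
    proof -
      have "degree f \<le> r" using f by (simp add: primes_upto_degree_def)
      have 1: "E f * degree f \<le> r" by (simp add: E_def)
      have 2: "r < Suc (E f) * degree f"
        using I[OF f] dividend_less_div_times[of "degree f" r] by (simp add: E_def add.commute)
      have "E f \<ge> 1" using I[OF f] \<open>degree f \<le> r\<close> by (simp add: E_def Suc_le_eq div_greater_zero_iff)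
      moreover have "Suc (E f) * degree f \<le> 2 * r" using 1 \<open>degree f \<le> r\<close> by simp
      moreover have "real (E f) \<le> real (Suc (E f) * degree f)"
        using I[OF f] by (intro of_nat_mono) (simp add: trans_le_add2)
      hence "real (degree f) * (real (E f) * (1 / q ^ (Suc (E f) * degree f))) \<le>
          real (degree f) * (real (Suc (E f) * degree f) * (1 / q ^ (Suc (E f) * degree f)))"
        using q by (intro mult_left_mono mult_right_mono) simp_all
      ultimately show ?thesis using I[OF f] 2
        by (auto simp: h_def prime_powers_upto_def mult_ac simp del: mult_Suc)
    qed
    have "(\<Sum>f\<in>?I. real (degree f) * (real (E f) * (1 / q ^ (Suc (E f) * degree f)))) \<le> (\<Sum>f\<in>?I. h (f, Suc (E f)))"
      by (rule sum_mono) (use pair in blast)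
    also have "\<dots> = sum h ((\<lambda>f. (f, Suc (E f))) ` ?I)"
      by (subst sum.reindex) (auto intro: inj_onI)
    also have "\<dots> \<le> sum h (prime_powers_upto (2 * r))"
      by (rule sum_mono2) (use pair h0 in auto)
    also have "\<dots> = (\<Sum>k=1..2 * r. sum h (prime_powers_of k))" by (rule sum_prime_powers_upto)
    also have "\<dots> = (\<Sum>k=Suc r..2 * r. sum h (prime_powers_of k))"
    proof (rule sum.mono_neutral_right)
      show "\<forall>k\<in>{1..2 * r} - {Suc r..2 * r}. sum h (prime_powers_of k) = 0"
      proof
        fix k assume "k \<in> {1..2 * r} - {Suc r..2 * r}"
        hence "k \<le> r" by auto
        thus "sum h (prime_powers_of k) = 0" by (intro sum.neutral) (auto simp: h_def prime_powers_of_def)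
      qed
    qed auto
    also have "\<dots> \<le> (\<Sum>k=Suc r..2 * r. tail_term q k)"
    proof (rule sum_mono)
      fix k
      show "sum h (prime_powers_of k) \<le> tail_term q k"
        unfolding q_def by (rule proper_powers_le_tail_term) (auto simp: h_def prime_powers_of_def q_def)
    qed
    finally have "N * (\<Sum>f\<in>?I. real (degree f) * (real (E f) * (1 / q ^ (Suc (E f) * degree f)))) \<le>
        N * (\<Sum>k=Suc r..2 * r. tail_term q k)" using N by (intro mult_left_mono) simp_all
    thus ?thesis by (simp add: sum_distrib_left mult_ac)
  qed

  define B where "B f = real (degree f) * ((\<Sum>e=1..E f. cnt f e) - real (E f) * cnt f (Suc (E f)))" for f
  have B: "(\<Sum>e=1..E f. real (degree f) * (N / q ^ (e * degree f))) - (\<Sum>e=1..E f. real (degree f)) -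
      real (degree f) * (real (E f) * (N / q ^ (Suc (E f) * degree f))) \<le> B f" if f: "f \<in> ?I" for f
  proof -
    have "cnt f e = N / q ^ (e * degree f) - 1" if "e \<in> {1..E f}" for e
    proof -
      have "e \<le> r div degree f" using that by (simp add: E_def)
      hence "e * degree f \<le> r" using I[OF f] by (simp add: less_eq_div_iff_mult_less_eq)
      hence "e * degree f \<le> Suc n" using assms(4) by simp
      thus ?thesis unfolding cnt_def N_def q_def by (rule card_nonzero_multiples(2)[OF I(1)[OF f]])
    qed
    hence "(\<Sum>e=1..E f. cnt f e) = (\<Sum>e=1..E f. N / q ^ (e * degree f) - 1)" by (rule sum.cong[OF refl])
    moreover have "cnt f (Suc (E f)) \<le> N / q ^ (Suc (E f) * degree f)"
      unfolding cnt_def N_def q_def by (rule card_nonzero_multiples(1)[OF I(1)[OF f]])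
    hence "real (E f) * cnt f (Suc (E f)) \<le> real (E f) * (N / q ^ (Suc (E f) * degree f))"
      by (intro mult_left_mono) simp_all
    ultimately have "(\<Sum>e=1..E f. N / q ^ (e * degree f) - 1) - real (E f) * (N / q ^ (Suc (E f) * degree f)) \<le>
        (\<Sum>e=1..E f. cnt f e) - real (E f) * cnt f (Suc (E f))" by simp
    hence "real (degree f) * ((\<Sum>e=1..E f. N / q ^ (e * degree f) - 1) - real (E f) * (N / q ^ (Suc (E f) * degree f))) \<le> B f"
      unfolding B_def by (rule mult_left_mono) simp
    thus ?thesis
      by (simp add: sum_subtractf right_diff_distrib sum_distrib_left
            mult.commute[of "real (E f)" "real (degree f)"] del: mult_Suc)
  qed
  have "N * real r - q ^ Suc r - N * (\<Sum>k=Suc r..2 * r. tail_term q k) \<le> sum B ?I"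
  proof -
    have "(\<Sum>f\<in>?I. (\<Sum>e=1..E f. real (degree f) * (N / q ^ (e * degree f))) - (\<Sum>e=1..E f. real (degree f)) -
        real (degree f) * (real (E f) * (N / q ^ (Suc (E f) * degree f)))) \<le> sum B ?I"
      by (rule sum_mono) (rule B)
    thus ?thesis unfolding sum_subtractf using A1 A2 A3 by linarith
  qed
  also have "sum B ?I = (\<Sum>Q\<in>?O. \<Sum>f\<in>?I. real (degree f) *
      ((\<Sum>e=1..E f. of_bool (e \<le> multiplicity f Q)) - real (E f) * of_bool (Suc (E f) \<le> multiplicity f Q)))"
  proof -
    have cnt: "cnt f e = (\<Sum>Q\<in>?O. of_bool (e \<le> multiplicity f Q))" if "f \<in> ?I" for f e
    proof -
      have "(\<Sum>Q\<in>?O. of_bool (e \<le> multiplicity f Q) :: real) = (\<Sum>Q\<in>?O. of_bool (f ^ e dvd Q))"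
        by (intro sum.cong refl) (use deg I(1)[OF that] in \<open>simp add: power_dvd_iff_le_mult\<close>)
      also have "\<dots> = cnt f e" by (simp add: cnt_def Int_def)
      finally show ?thesis ..
    qed
    have "B f = (\<Sum>Q\<in>?O. real (degree f) * ((\<Sum>e=1..E f. of_bool (e \<le> multiplicity f Q)) -
        real (E f) * of_bool (Suc (E f) \<le> multiplicity f Q)))" if f: "f \<in> ?I" for f
      unfolding B_def cnt[OF f] by (subst sum.swap) (simp only: sum_subtractf[symmetric] sum_distrib_left)
    thus ?thesis by (subst sum.swap) simp
  qed
  also have "\<dots> \<le> (\<Sum>Q\<in>?O. \<Sum>f\<in>?I. real (\<psi> (degree f * multiplicity f Q)))"
    unfolding \<psi>_def E_def by (intro sum_mono truncated_count I(2))
  also have "\<dots> \<le> (\<Sum>Q\<in>?O. \<Sum>f\<in>primes_upto_degree n. real (\<psi> (degree f * multiplicity f Q)))"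
    by (intro sum_mono sum_mono2 finite_primes_upto_degree) (use assms(4) in \<open>auto simp: primes_upto_degree_def\<close>)
  finally have T1: "N * real r - q ^ Suc r - N * (\<Sum>k=Suc r..2 * r. tail_term q k) \<le>
      (\<Sum>Q\<in>?O. \<Sum>f\<in>primes_upto_degree n. real (\<psi> (degree f * multiplicity f Q)))" .

  define c where "c e = real (card {Q\<in>?O. degree Q + e \<le> n})" for e
  have c: "c e = N / q ^ e - 1" if "e \<le> Suc n" for e
    unfolding c_def N_def q_def by (rule card_nonzero_low_degree[OF that])
  have csum: "c e = (\<Sum>Q\<in>?O. of_bool (e \<le> n - degree Q))" for e
  proof -
    have "c e = (\<Sum>Q\<in>?O. of_bool (degree Q + e \<le> n))" by (simp add: c_def Int_def)
    also have "\<dots> = (\<Sum>Q\<in>?O. of_bool (e \<le> n - degree Q))"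
    proof (intro sum.cong refl)
      fix Q :: "'a poly" assume "Q \<in> ?O"
      hence "degree Q + e \<le> n \<longleftrightarrow> e \<le> n - degree Q" using deg(2)[of Q] by linarith
      thus "(of_bool (degree Q + e \<le> n) :: real) = of_bool (e \<le> n - degree Q)" by simp
    qed
    finally show ?thesis .
  qed
  \<comment> \<open>The block at infinity has size \<open>n - degree Q\<close> and is truncated like
    a prime of degree \<open>1\<close>.\<close>
  have "(\<Sum>e=1..r. c e) - real r * c (Suc r) = (\<Sum>Q\<in>?O. (\<Sum>e=1..r. of_bool (e \<le> n - degree Q)) - real r * of_bool (Suc r \<le> n - degree Q))"
    unfolding csum by (subst sum.swap) (simp only: sum_subtractf sum_distrib_left)
  also have "\<dots> \<le> (\<Sum>Q\<in>?O. real (\<psi> (n - degree Q)))"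
  proof (rule sum_mono)
    fix Q :: "'a poly"
    show "(\<Sum>e=1..r. of_bool (e \<le> n - degree Q)) - real r * of_bool (Suc r \<le> n - degree Q) \<le> real (\<psi> (n - degree Q))"
      using truncated_count[OF zero_less_one, of "n - degree Q" r]
      by (simp only: \<psi>_def div_by_1 mult_1 of_nat_1)
  qed
  finally have "(\<Sum>e=1..r. c e) - real r * c (Suc r) \<le> (\<Sum>Q\<in>?O. real (\<psi> (n - degree Q)))" .
  moreover have "(\<Sum>e=1..r. c e) = N * (1 / (q - 1) - 1 / ((q - 1) * q ^ r)) - real r"
  proof -
    have "(\<Sum>e=1..r. c e) = (\<Sum>e=1..r. N * (1 / q ^ e) - 1)"
      by (intro sum.cong refl) (use c assms(4) in simp)
    also have "\<dots> = N * (\<Sum>e=1..r. 1 / q ^ e) - real r" by (simp add: sum_subtractf sum_distrib_left)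
    also have "(\<Sum>e=1..r. 1 / q ^ e) = 1 / (q - 1) - 1 / ((q - 1) * q ^ r)"
      by (rule sum_geometric_inverse) (use q in simp)
    finally show ?thesis .
  qed
  moreover have "real r * c (Suc r) \<le> N * (real r / q ^ r)"
  proof -
    have "c (Suc r) \<le> N / q ^ Suc r" using c[of "Suc r"] assms(4) by simp
    also have "\<dots> \<le> N / q ^ r"
      using q N by (intro divide_left_mono power_increasing) auto
    finally show ?thesis by (simp add: mult_left_mono mult.commute[of N] flip: times_divide_eq_right)
  qed
  moreover have "N * (1 / ((q - 1) * q ^ r)) \<le> N * (1 / q ^ r)"
  proof (intro mult_left_mono divide_left_mono)
    show "q ^ r \<le> (q - 1) * q ^ r" using q mult_right_mono[of 1 "q - 1" "q ^ r"] by simp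
  qed (use q N in auto)
  ultimately have T2: "N * (1 / (q - 1)) - N * (1 / q ^ r) - real r - N * (real r / q ^ r) \<le> (\<Sum>Q\<in>?O. real (\<psi> (n - degree Q)))"
    by (simp add: right_diff_distrib)
  have "(\<Sum>Q\<in>?O. real (g Q)) =
      (\<Sum>Q\<in>?O. \<Sum>f\<in>primes_upto_degree n. real (\<psi> (degree f * multiplicity f Q))) + (\<Sum>Q\<in>?O. real (\<psi> (n - degree Q)))"
    unfolding sum.distrib[symmetric] by (intro sum.cong refl) (simp add: g_def)
  hence "N * real r - q ^ Suc r - N * (\<Sum>k=Suc r..2 * r. tail_term q k) +
      (N * (1 / (q - 1)) - N * (1 / q ^ r) - real r - N * (real r / q ^ r)) \<le> real (\<Sum>Q\<in>polys_below (Suc n). g Q)"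
    unfolding g using T1 T2 by linarith
  hence "(N * real r - q ^ Suc r - N * (\<Sum>k=Suc r..2 * r. tail_term q k) +
      (N * (1 / (q - 1)) - N * (1 / q ^ r) - real r - N * (real r / q ^ r))) / N \<le> real (\<Sum>Q\<in>polys_below (Suc n). g Q) / N"
    using N by (intro divide_right_mono) simp_all
  moreover have "(N * real r - q ^ Suc r - N * (\<Sum>k=Suc r..2 * r. tail_term q k) +
      (N * (1 / (q - 1)) - N * (1 / q ^ r) - real r - N * (real r / q ^ r))) / N =
      real r + 1 / (q - 1) - (\<Sum>k=Suc r..2 * r. tail_term q k) - (1 + real r) / q ^ r - (real r + q ^ Suc r) / N"
    using N by (simp add: add_divide_distrib diff_divide_distrib)
  ultimately show ?thesis by (simp add: N_def)
qed

section \<open>Asymptotics\<close>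

text \<open>Comparison with the second derivative of the geometric series at
  \<open>1 / sqrt q\<close>, obtained from two formal differentiations.\<close>

lemma summable_tail_term:
  assumes "q > 1"
  shows "summable (tail_term q)"
proof -
  define s where "s = 1 / sqrt q"
  have s: "0 < s" "s < 1" using assms by (simp_all add: s_def)
  have "summable (\<lambda>n. diffs (\<lambda>_. 1) n * x ^ n)" if "norm x < 1" for x :: real
    by (rule termdiff_converges[OF that]) (simp add: summable_geometric)
  hence "summable (\<lambda>n. diffs (diffs (\<lambda>_. 1)) n * s ^ n)"
    using s by (intro termdiff_converges[of s 1]) simp_all
  hence sm: "summable (\<lambda>n. real (Suc n) * real (Suc (Suc n)) * s ^ n)"
    by (simp add: diffs_def)
  show ?thesis
  proof (rule summable_comparison_test'[OF sm])
    fix n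
    have "real n ^ 2 \<le> real (Suc n) * real (Suc (Suc n))"
      unfolding power2_eq_square by (intro mult_mono) simp_all
    hence "real n ^ 2 * s ^ n \<le> real (Suc n) * real (Suc (Suc n)) * s ^ n"
      using s by (intro mult_right_mono) simp_all
    thus "norm (tail_term q n) \<le> real (Suc n) * real (Suc (Suc n)) * s ^ n"
      using assms by (simp add: tail_term_def s_def power_one_over)
  qed
qed

lemma linear_over_power_le_tail_term:
  assumes "q \<ge> 1" "k \<ge> 1"
  shows "real k / q ^ k \<le> tail_term q k"
proof -
  have "real k * 1 \<le> real k * real k" using assms(2) by (intro mult_left_mono) simp_all
  moreover have "sqrt q * 1 \<le> sqrt q * sqrt q" using assms(1) by (intro mult_left_mono) simp_all
  hence "sqrt q \<le> q" using assms(1) by simp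
  hence "sqrt q ^ k \<le> q ^ k" using assms(1) by (intro power_mono) simp_all
  moreover have "sqrt q ^ k > 0" using assms(1) by simp
  ultimately show ?thesis unfolding tail_term_def power2_eq_square by (intro frac_le) simp_all
qed

definition tail_sum :: "real \<Rightarrow> nat \<Rightarrow> real" where
  "tail_sum q m = suminf (tail_term q) - (\<Sum>k<Suc m. tail_term q k)"

lemma sum_le_tail_sum:
  assumes "q > 1"
  shows "(\<Sum>k=Suc m..M. tail_term q k) \<le> tail_sum q m"
proof -
  have "(\<Sum>k<Suc m. tail_term q k) + (\<Sum>k=Suc m..M. tail_term q k) = sum (tail_term q) ({..<Suc m} \<union> {Suc m..M})"
    by (rule sum.union_disjoint[symmetric]) auto
  also have "\<dots> \<le> suminf (tail_term q)"
    using assms by (intro sum_le_suminf summable_tail_term) (auto simp: tail_term_nonneg)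
  finally show ?thesis by (simp add: tail_sum_def)
qed

lemma tendsto_tail_sum:
  assumes "q > 1"
  shows "tail_sum q \<longlonglongrightarrow> 0"
proof -
  have "(\<lambda>m. \<Sum>k<Suc m. tail_term q k) \<longlonglongrightarrow> suminf (tail_term q)"
    by (rule LIMSEQ_Suc[OF summable_LIMSEQ[OF summable_tail_term[OF assms]]])
  hence "(\<lambda>m. suminf (tail_term q) - (\<Sum>k<Suc m. tail_term q k)) \<longlonglongrightarrow> suminf (tail_term q) - suminf (tail_term q)"
    by (intro tendsto_intros)
  thus ?thesis by (simp add: tail_sum_def[abs_def])
qed

text \<open>One bound serves both sides. The term \<open>(1 / q) ^ (n - r)\<close> and the terms in
  \<open>tail_term q r\<close> stem from the lower estimate; \<open>tail_sum q r\<close> covers the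
  proper powers in both.\<close>

lemma sum_expected_roots_error:
  fixes r n :: nat
  defines "q \<equiv> real CARD('p::prime_card)"
  assumes rn: "1 \<le> r" "r \<le> n"
  shows "\<bar>(\<Sum>\<^sub>\<infinity>K\<in>(finite_extensions_upto r :: 'p padic alg_closure set set). expected_roots n (new_elements K))
      - (real r + 1 / (q - 1))\<bar> \<le> tail_sum q r + 2 * tail_term q r + 2 * tail_term q n + (1 / q) ^ (n - r)"
    (is "\<bar>?S - _\<bar> \<le> _")
proof -
  have q: "q \<ge> 2" using card_field_ge_2[where 'a="'p mod_ring"] by (simp add: q_def)
  hence q1: "q > 1" by simp
  have tail_r: "real r / q ^ r \<le> tail_term q r" and tail_n: "real n / q ^ n \<le> tail_term q n"
    using linear_over_power_le_tail_term q rn by simp_all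
  have pow: "q ^ n \<le> q ^ Suc n" by (rule power_increasing) (use q in simp_all)
  have qn: "q ^ n > 0" using q by simp
  have n_term: "real n / q ^ Suc n \<le> tail_term q n"
    by (rule order_trans[OF _ tail_n], rule divide_left_mono[OF pow]) (use q in simp_all)
  have "real r / q ^ Suc n \<le> real n / q ^ Suc n" using q rn by (intro divide_right_mono) simp_all
  hence r_term: "real r / q ^ Suc n \<le> tail_term q n" using n_term by simp
  have "(1 + real r) / q ^ r \<le> (2 * real r) / q ^ r" using q rn by (intro divide_right_mono) simp_all
  also have "\<dots> = 2 * (real r / q ^ r)" by simp
  finally have lin: "(1 + real r) / q ^ r \<le> 2 * tail_term q r" using tail_r by simp
  have "q ^ n = q ^ r * q ^ (n - r)" using rn by (simp flip: power_add)
  hence pow_quot: "q ^ Suc r / q ^ Suc n = (1 / q) ^ (n - r)" using q by (simp add: power_one_over)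
  have tail_nonneg: "tail_term q k \<ge> 0" for k by (rule tail_term_nonneg) (use q in simp)

  have "?S \<le> real r + 1 / (q - 1) + (\<Sum>k=Suc r..n. tail_term q k) + real n / q ^ Suc n"
    using order_trans[OF sum_expected_roots_upper[where r = r and n = n and 'p = 'p]
      average_upper[OF rn(2), where 'a="'p mod_ring", unfolded CARD_mod_ring]] by (simp only: q_def)
  moreover have "(\<Sum>k=Suc r..n. tail_term q k) \<le> tail_sum q r" by (rule sum_le_tail_sum[OF q1])
  moreover have "(1 / q) ^ (n - r) \<ge> 0" using q by simp
  ultimately have upper: "?S - (real r + 1 / (q - 1)) \<le> tail_sum q r + 2 * tail_term q r + 2 * tail_term q n + (1 / q) ^ (n - r)"
    using n_term tail_nonneg[of r] tail_nonneg[of n] by linarith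

  have "real r + 1 / (q - 1) - (\<Sum>k=Suc r..2 * r. tail_term q k) - (1 + real r) / q ^ r
      - (real r + q ^ Suc r) / q ^ Suc n \<le> ?S"
    using order_trans[OF average_lower[OF rn(2), where 'a="'p mod_ring", unfolded CARD_mod_ring]
      sum_expected_roots_lower[where r = r and n = n and 'p = 'p]] by (simp only: q_def)
  moreover have "(\<Sum>k=Suc r..2 * r. tail_term q k) \<le> tail_sum q r" by (rule sum_le_tail_sum[OF q1])
  moreover have "(real r + q ^ Suc r) / q ^ Suc n \<le> tail_term q n + (1 / q) ^ (n - r)"
    unfolding add_divide_distrib pow_quot using r_term by simp
  ultimately have lower: "real r + 1 / (q - 1) - ?S \<le> tail_sum q r + 2 * tail_term q r + 2 * tail_term q n + (1 / q) ^ (n - r)"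
    using lin tail_nonneg[of n] by linarith
  show ?thesis using upper lower by (intro abs_leI) simp_all
qed

theorem theorem1p5:
  fixes r :: "nat \<Rightarrow> nat"
  assumes "\<And>n. n \<ge> 1 \<Longrightarrow> r n > 0"
    and "filterlim r at_top sequentially"
    and "filterlim (\<lambda>n. int n - int (r n)) at_top sequentially"
  shows "(\<lambda>n. (\<Sum>\<^sub>\<infinity>K\<in>(finite_extensions_upto (r n) :: 'p::prime_card padic alg_closure set set).
                  expected_roots n (new_elements K))
              - (real (r n) + 1 / (real CARD('p) - 1))) \<in> o(\<lambda>_. 1)"
proof -
  define q where "q = real CARD('p)"
  have q: "q > 1" using card_field_ge_2[where 'a="'p mod_ring"] by (simp add: q_def)
  let ?S = "\<lambda>n. \<Sum>\<^sub>\<infinity>K\<in>(finite_extensions_upto (r n) :: 'p padic alg_closure set set). expected_roots n (new_elements K)"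
  define err where "err n = tail_sum q (r n) + 2 * tail_term q (r n) + 2 * tail_term q n + (1 / q) ^ (n - r n)" for n
  \<comment> \<open>The difference in \<open>int\<close> is not truncated, so its divergence also
    yields \<open>r n \<le> n\<close> eventually, as the error bound requires.\<close>
  have "eventually (\<lambda>n. int n - int (r n) \<ge> 0) sequentially"
    using assms(3) unfolding filterlim_at_top by (rule spec)
  hence "eventually (\<lambda>n. norm (?S n - (real (r n) + 1 / (q - 1))) \<le> err n) sequentially"
    using eventually_ge_at_top[of 1]
  proof eventually_elim
    case (elim n)
    hence "1 \<le> r n" "r n \<le> n" using assms(1)[of n] by simp_all
    thus ?case using sum_expected_roots_error[of "r n" n, where 'p='p] by (simp add: err_def q_def)
  qed
  moreover have "err \<longlonglongrightarrow> 0"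
  proof -
    have "filterlim (\<lambda>n. n - r n) at_top sequentially"
      unfolding filterlim_at_top
    proof
      fix Z :: nat
      have "eventually (\<lambda>n. int n - int (r n) \<ge> int Z) sequentially"
        using assms(3) unfolding filterlim_at_top by (rule spec)
      thus "eventually (\<lambda>n. n - r n \<ge> Z) sequentially" by eventually_elim linarith
    qed
    moreover have "(\<lambda>k. (1 / q) ^ k) \<longlonglongrightarrow> 0" using q by (intro LIMSEQ_realpow_zero) simp_all
    ultimately have 1: "(\<lambda>n. (1 / q) ^ (n - r n)) \<longlonglongrightarrow> 0" by (rule filterlim_compose[rotated])
    have 2: "tail_term q \<longlonglongrightarrow> 0" by (rule summable_LIMSEQ_zero[OF summable_tail_term[OF q]])
    have 3: "(\<lambda>n. tail_term q (r n)) \<longlonglongrightarrow> 0" by (rule filterlim_compose[OF 2 assms(2)])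
    have 4: "(\<lambda>n. tail_sum q (r n)) \<longlonglongrightarrow> 0" by (rule filterlim_compose[OF tendsto_tail_sum[OF q] assms(2)])
    have "err \<longlonglongrightarrow> 0 + 2 * 0 + 2 * 0 + 0"
      unfolding err_def[abs_def] by (intro tendsto_intros 1 2 3 4)
    thus ?thesis by simp
  qed
  ultimately have "(\<lambda>n. ?S n - (real (r n) + 1 / (q - 1))) \<longlonglongrightarrow> 0"
    by (rule Lim_null_comparison)
  thus ?thesis unfolding q_def by (intro smalloI_tendsto) simp_all
qed

end
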